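(* Let $(X,\mathbb R^d,\mu)$ be a (one-colour) uniformly discrete stationary ergodic point process on $\mathbb R^d$. If $g,h\in\mathbb S$ are rapidly decreasing functions on $\mathbb R^d$, then for all $t\in\mathbb R^d$ $$(g*\tilde h*\dot\mu_1)(-t)=\langle U_t(\hat g),\hat h\rangle .$$ In particular, $$\langle U_t(\hat g),\hat h\rangle=(T_tN_g,N_h).$$ Thus there is an isometric embedding intertwining $U$ and $T$, $$\theta:L^2(\mathbb R^d,\widehat{\dot\mu_1})\longrightarrow L^2(X,\mu),$$ under which $\hat f\mapsto N_f$ for all $f\in\mathbb S$.
   Context: $C_R$ is the open cube of edge length $R$ centred at $0$ in $\mathbb R^d$; $\ell$ is Lebesgue measure. $M_p$ is the set of positive Radon measures $\lambda$ on $\mathbb R^d$ with $\lambda(A)\in\{0,1,2,\dots\}$ for every relatively compact Borel set $A$, with the vague topology ($\lambda_n\to\lambda$ iff $\lambda_n(f)\to\lambda(f)$ for all $f\in C_c(\mathbb R^d)$) and its Borel $\sigma$-algebra; $\mathbb R^d$ acts by $(T_t\lambda)(A)=\lambda(-t+A)$. For $r>0$, $M_p(C_r,1)$ is the (compact) set of $\lambda\in M_p$ with $\lambda(a+C_r)\le1$ for all $a\in\mathbb R^d$. A (one-colour) uniformly discrete stationary ergodic point process $(X,\mathbb R^d,\mu)$ is a Borel probability measure $\mu$ on $M_p$, invariant and ergodic under all $T_t$, whose support $X$ is a closed subset of $M_p(C_r,1)$ for some $r>0$, with positive intensity, i.e. the constant $I$ with $\int_X\lambda(A)\,d\mu(\lambda)=I\ell(A)$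 is positive. For $f$ bounded measurable of compact support, or $f\in\mathbb S$, $N_f:X\to\mathbb C$ is $N_f(\lambda)=\lambda(f)=\sum_{x\in\mathbb R^d}\lambda(\{x\})f(x)$. The Palm measure $\dot\mu$ is the finite positive measure on $X$ given by $\dot\mu(D)=\frac1{\ell(B)}\int_X\sum_{x\in B}\lambda(\{x\})\mathbf 1_D(T_{-x}\lambda)\,d\mu(\lambda)$, independent of the choice of bounded Borel $B\subset\mathbb R^d$ with $\ell(B)>0$. Its first moment is the measure $\dot\mu_1$ on $\mathbb R^d$ with $\dot\mu_1(f)=\int_XN_f\,d\dot\mu$, $f\in C_c(\mathbb R^d)$; it is positive, positive definite, translation bounded and Fourier transformable, and $\widehat{\dot\mu_1}$, determined by $\widehat{\dot\mu_1}(f)=\dot\mu_1(\hat f)$ for $f\in\mathbb S$, is a positive translation bounded measure. Here $\hat f(y)=\int e^{-2\pi i x\cdot y}f(x)\,dx$, and $\tilde h(x)=\overline{h(-x)}$. $\langle\cdot,\cdot\rangle$ and $(\cdot,\cdot)$ are the inner products (linear in the first variable) of $L^2(\mathbb R^d,\widehat{\dot\mu_1})$ and $L^2(X,\mu)$. $U$ is the unitary representation $U_tf(x)=e^{-2\pi i t\cdot x}f(x)$ on $L^2(\mathbb R^d,\widehat{\dot\mu_1})$, and $T$ is the unitary representation $(T_tF)(\lambda)=F(T_{-t}\lambda)$ on $L^2(X,\mu)$. Intertwining means $\theta U_t=T_t\theta$ for all $t$. *)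

theory Defs
  imports "HOL-Probability.Probability"
begin

subsection \<open>Functions on Euclidean space\<close>

definition Cc :: "('a::euclidean_space \<Rightarrow> complex) set" where
  "Cc = {f. continuous_on UNIV f \<and> compact (closure {x. f x \<noteq> 0})}"

definition partial_deriv :: "'a::euclidean_space \<Rightarrow> ('a \<Rightarrow> complex) \<Rightarrow> 'a \<Rightarrow> complex" where
  "partial_deriv b f x = frechet_derivative f (at x) b"

text \<open>The list \<open>bs\<close> plays the role of a multi-index: the empty list gives \<open>f\<close> itself, and since
  every iterated partial derivative is required to be differentiable, \<open>f\<close> is smooth.\<close>

definition schwartz :: "('a::euclidean_space \<Rightarrow> complex) set" where
  "schwartz = {f. \<forall>bs. set bs \<subseteq> Basis \<longrightarrow>
     (\<forall>x. foldr partial_deriv bs f differentiable (at x)) \<and>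
     (\<forall>k::nat. bounded (range (\<lambda>x. norm x ^ k *\<^sub>R foldr partial_deriv bs f x)))}"

definition fourier :: "('a::euclidean_space \<Rightarrow> complex) \<Rightarrow> 'a \<Rightarrow> complex" where
  "fourier f y = (\<integral>x. cis (- 2 * pi * (x \<bullet> y)) * f x \<partial>lborel)"

definition tilde :: "('a::euclidean_space \<Rightarrow> complex) \<Rightarrow> 'a \<Rightarrow> complex" where
  "tilde h x = cnj (h (- x))"

definition conv :: "('a::euclidean_space \<Rightarrow> complex) \<Rightarrow> ('a \<Rightarrow> complex) \<Rightarrow> 'a \<Rightarrow> complex" where
  "conv f g x = (\<integral>y. f y * g (x - y) \<partial>lborel)"

definition conv_measure :: "('a::euclidean_space \<Rightarrow> complex) \<Rightarrow> 'a measure \<Rightarrow> 'a \<Rightarrow> complex" where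
  "conv_measure f m x = (\<integral>y. f (x - y) \<partial>m)"


subsection \<open>Measures on Euclidean space\<close>

text \<open>Regularity is automatic for locally finite Borel measures on a Euclidean space.\<close>

definition radon :: "'a::euclidean_space measure \<Rightarrow> bool" where
  "radon m \<longleftrightarrow> sets m = sets borel \<and> (\<forall>K. compact K \<longrightarrow> emeasure m K < \<infinity>)"

definition translation_bounded :: "'a::euclidean_space measure \<Rightarrow> bool" where
  "translation_bounded m \<longleftrightarrow>
     (\<forall>K. compact K \<longrightarrow> (\<exists>C::real. \<forall>a. emeasure m ((+) a ` K) \<le> ennreal C))"

text \<open>Translation boundedness makes every Schwartz function integrable with respect to \<open>\<sigma>\<close>, so that
  the integral on the left is not a default value.\<close>

definition is_fourier_transform :: "'a::euclidean_space measure \<Rightarrow> 'a measure \<Rightarrow> bool" where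
  "is_fourier_transform m \<sigma> \<longleftrightarrow> radon \<sigma> \<and> translation_bounded \<sigma> \<and>
     (\<forall>f\<in>schwartz. (\<integral>x. f x \<partial>\<sigma>) = (\<integral>x. fourier f x \<partial>m))"


subsection \<open>Point measures\<close>

definition point_measures :: "'a::euclidean_space measure set" where
  "point_measures =
     {\<Lambda>. radon \<Lambda> \<and> (\<forall>A\<in>sets borel. compact (closure A) \<longrightarrow> emeasure \<Lambda> A \<in> \<nat>)}"

definition counting :: "('a::euclidean_space \<Rightarrow> complex) \<Rightarrow> 'a measure \<Rightarrow> complex" where
  "counting f \<Lambda> = (\<integral>x. f x \<partial>\<Lambda>)"

text \<open>The coarsest topology on the point measures for which \<open>counting f\<close> is continuous for every
  \<open>f\<close> in \<open>Cc\<close>.\<close>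

definition vague_topology :: "'a::euclidean_space measure topology" where
  "vague_topology = topology_generated_by
     {{\<Lambda> \<in> point_measures. counting f \<Lambda> \<in> U} | f U. f \<in> Cc \<and> open U}"

definition vague_borel :: "'a::euclidean_space measure measure" where
  "vague_borel = sigma point_measures {U. openin vague_topology U}"

definition translate :: "'a::euclidean_space \<Rightarrow> 'a measure \<Rightarrow> 'a measure" where
  "translate t \<Lambda> = distr \<Lambda> borel ((+) t)"

definition cube :: "real \<Rightarrow> 'a::euclidean_space set" where
  "cube R = {x. \<forall>b\<in>Basis. \<bar>x \<bullet> b\<bar> < R / 2}"

definition hard_core :: "real \<Rightarrow> 'a::euclidean_space measure set" where
  "hard_core r = {\<Lambda> \<in> point_measures. \<forall>a. emeasure \<Lambda> ((+) a ` cube r) \<le> 1}"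


subsection \<open>Uniformly discrete stationary ergodic point processes\<close>

text \<open>The support is the smallest closed set of full measure.\<close>

definition is_support :: "'a::euclidean_space measure measure \<Rightarrow> 'a measure set \<Rightarrow> bool" where
  "is_support \<mu> X \<longleftrightarrow> closedin vague_topology X \<and> emeasure \<mu> X = 1 \<and>
     (\<forall>Y. closedin vague_topology Y \<and> emeasure \<mu> Y = 1 \<longrightarrow> X \<subseteq> Y)"

locale ud_ergodic_process = prob_space \<mu>
  for X :: "'a::euclidean_space measure set" and \<mu> :: "'a measure measure" +
  assumes sets_eq: "sets \<mu> = sets vague_borel"
    and translate_measurable: "\<And>t. translate t \<in> \<mu> \<rightarrow>\<^sub>M \<mu>"
    and invariant: "\<And>t. distr \<mu> \<mu> (translate t) = \<mu>"
    and ergodic: "\<And>D. D \<in> sets \<mu> \<Longrightarrow> (\<And>t. translate t ` D = D) \<Longrightarrow>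
      emeasure \<mu> D = 0 \<or> emeasure \<mu> D = 1"
    and support: "is_support \<mu> X"
    and uniformly_discrete: "\<exists>r>0. X \<subseteq> hard_core r"
    and intensity: "\<exists>I::real. I > 0 \<and> (\<forall>A\<in>sets borel.
      (\<integral>\<^sup>+ \<Lambda>. emeasure \<Lambda> A \<partial>restrict_space \<mu> X) = ennreal I * emeasure lborel A)"

text \<open>The Palm measure on \<open>X\<close>; it does not depend on the bounded Borel set \<open>B\<close> of positive Lebesgue
  measure, which is therefore left as a parameter.\<close>

definition palm_measure ::
  "'a::euclidean_space set \<Rightarrow> 'a measure set \<Rightarrow> 'a measure measure \<Rightarrow> 'a measure measure" where
  "palm_measure B X \<mu> = measure_of X (sets (restrict_space \<mu> X))
     (\<lambda>D. (\<integral>\<^sup>+ \<Lambda>. (\<Sum>\<^sub>\<infinity>x\<in>B. emeasure \<Lambda> {x} * indicator D (translate (- x) \<Lambda>)) \<partial>restrict_space \<mu> X)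
          / emeasure lborel B)"

definition first_moment :: "'a::euclidean_space measure measure \<Rightarrow> 'a measure" where
  "first_moment P = (THE m. radon m \<and>
     (\<forall>f\<in>Cc. (\<integral>x. f x \<partial>m) = (\<integral>\<Lambda>. counting f \<Lambda> \<partial>P)))"


subsection \<open>Square-integrable functions\<close>

text \<open>Elements of the Hilbert space \<open>L\<^sup>2(M)\<close> are handled through representatives; equality in
  \<open>L\<^sup>2(M)\<close> is the relation \<open>L2_eq M\<close>, and a map of \<open>L\<^sup>2\<close> spaces has to respect it.\<close>

definition L2 :: "'b measure \<Rightarrow> ('b \<Rightarrow> complex) set" where
  "L2 M = {f \<in> borel_measurable M. integrable M (\<lambda>x. (cmod (f x))\<^sup>2)}"

definition L2_eq :: "'b measure \<Rightarrow> ('b \<Rightarrow> complex) \<Rightarrow> ('b \<Rightarrow> complex) \<Rightarrow> bool" where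
  "L2_eq M f g \<longleftrightarrow> f \<in> L2 M \<and> g \<in> L2 M \<and> (AE x in M. f x = g x)"

definition L2_inner :: "'b measure \<Rightarrow> ('b \<Rightarrow> complex) \<Rightarrow> ('b \<Rightarrow> complex) \<Rightarrow> complex" where
  "L2_inner M f g = (\<integral>x. f x * cnj (g x) \<partial>M)"

definition L2_norm :: "'b measure \<Rightarrow> ('b \<Rightarrow> complex) \<Rightarrow> real" where
  "L2_norm M f = sqrt (\<integral>x. (cmod (f x))\<^sup>2 \<partial>M)"

definition L2_isometric_embedding ::
  "'b measure \<Rightarrow> 'c measure \<Rightarrow> (('b \<Rightarrow> complex) \<Rightarrow> ('c \<Rightarrow> complex)) \<Rightarrow> bool" where
  "L2_isometric_embedding M N \<theta> \<longleftrightarrow>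
     (\<forall>f\<in>L2 M. \<theta> f \<in> L2 N) \<and>
     (\<forall>f g. L2_eq M f g \<longrightarrow> L2_eq N (\<theta> f) (\<theta> g)) \<and>
     (\<forall>f\<in>L2 M. \<forall>g\<in>L2 M. L2_eq N (\<theta> (\<lambda>x. f x + g x)) (\<lambda>y. \<theta> f y + \<theta> g y)) \<and>
     (\<forall>c. \<forall>f\<in>L2 M. L2_eq N (\<theta> (\<lambda>x. c * f x)) (\<lambda>y. c * \<theta> f y)) \<and>
     (\<forall>f\<in>L2 M. L2_norm N (\<theta> f) = L2_norm M f)"

definition U_rep :: "'a::euclidean_space \<Rightarrow> ('a \<Rightarrow> complex) \<Rightarrow> 'a \<Rightarrow> complex" where
  "U_rep t f x = cis (- 2 * pi * (t \<bullet> x)) * f x"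

definition T_rep :: "'a::euclidean_space \<Rightarrow> ('a measure \<Rightarrow> complex) \<Rightarrow> 'a measure \<Rightarrow> complex" where
  "T_rep t F \<Lambda> = F (translate (- t) \<Lambda>)"

end

theory Submission
  imports Defs "HOL-Real_Asymp.Real_Asymp"
begin

text \<open>Two independent computations meet in the number \<open>conv_measure (conv g (tilde h)) \<mu>\<^sub>1 (- t)\<close>.
  On the Fourier side, \<open>U_rep t (fourier g) * cnj (fourier h)\<close> is a Schwartz function whose transform is,
  by Fourier inversion, a translate of the convolution \<open>conv g (tilde h)\<close>; the defining property
  of \<open>\<sigma>\<close> moves the integral to \<open>\<mu>\<^sub>1\<close>.  On the probabilistic side, stationarity disintegrates the
  second moment measure, in the coordinates \<open>(x, y - x)\<close>, as the product of Lebesgue measure and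
  \<open>\<mu>\<^sub>1\<close> (Campbell's formula).  With \<open>t = 0\<close> and \<open>g = h\<close> this says that \<open>fourier g \<mapsto> counting g\<close> is
  isometric; it extends to all of \<open>L\<^sup>2(\<sigma>)\<close> because Schwartz functions are dense there and the
  Fourier transform maps them onto themselves.

  The Palm measure is a measure only if \<open>\<Lambda> \<mapsto> \<Lambda> {x \<in> B. translate (- x) \<Lambda> \<in> D}\<close> is measurable for every
  \<open>D\<close>.  For open \<open>D\<close> this map is lower semicontinuous, since translation is jointly continuous, and
  a Dynkin argument does the rest.  Uniform discreteness enters through one bound: the integral of
  the weight \<open>\<Prod>b. 1 / (1 + x\<^sub>b\<^sup>2)\<close>, which dominates Schwartz functions, is bounded uniformly over the
  configurations.\<close>

text \<open>The weight is a product over the coordinates so that its Lebesgue integral factors into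
  integrals of \<open>1 / (1 + t\<^sup>2)\<close>. It changes by at most the factor
  \<open>3 ^ DIM('a)\<close> under shifts of length one and is bounded below on bounded sets, so a
  bound on its integral is also a bound on local masses, and conversely uniform bounds for the
  masses of unit balls bound its integral. A configuration may have infinite total mass, hence
  averages of configurations are not averages over a subprobability kernel; multiplying by the
  weight reduces them to that case. Campbell's formula is proved for nonnegative integrands, where
  no integrability question arises, and is restated as an identity of measures before complex
  integrands are inserted. Elements of \<open>L2\<close> are representatives, so the extension by
  continuity is carried out on a relation: it is total, determines the partner of a function up to
  null sets and respects sums, scalars and translations; the embedding is a choice from it.\<close>

definition weight :: "'a::euclidean_space \<Rightarrow> real" where
  "weight x = (\<Prod>b\<in>Basis. inverse (1 + (x \<bullet> b)\<^sup>2))"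

lemma weight_pos: "0 < weight x"
  unfolding weight_def by (intro prod_pos) (auto simp: add_pos_nonneg)

lemma weight_le_1: "weight x \<le> 1"
  unfolding weight_def
  by (intro prod_le_1) (auto simp: field_simps add_pos_nonneg)

lemma weight_measurable [measurable]: "weight \<in> borel_measurable borel"
  unfolding weight_def[abs_def] by measurable

text \<open>Each of the \<open>DIM('a)\<close> factors \<open>1 + (x \<bullet> b)\<^sup>2\<close> is
  at most \<open>(1 + norm x)\<^sup>2\<close>, whence the exponent: this much polynomial decay lets
  a function be dominated by the weight.\<close>

lemma weight_ge: "inverse ((1 + norm x) ^ (2 * DIM('a))) \<le> weight (x::'a::euclidean_space)"
proof -
  have "(\<Prod>b\<in>(Basis::'a set). inverse ((1 + norm x)\<^sup>2)) \<le> weight x"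
    unfolding weight_def
  proof (intro prod_mono conjI le_imp_inverse_le)
    fix b :: 'a assume b: "b \<in> Basis"
    have "(x \<bullet> b)\<^sup>2 \<le> (norm x)\<^sup>2"
      using Basis_le_norm[OF b, of x] by (simp add: abs_le_square_iff[symmetric])
    then show "1 + (x \<bullet> b)\<^sup>2 \<le> (1 + norm x)\<^sup>2"
      using norm_ge_zero[of x] unfolding power2_sum power_one by linarith
  qed (auto simp: add_pos_nonneg)
  then show ?thesis by (simp add: power_mult power_inverse)
qed

text \<open>Coordinatewise \<open>(a + u)\<^sup>2 \<le> 2 * a\<^sup>2 + 2\<close> when
  \<open>\<bar>u\<bar> \<le> 1\<close>, so each factor costs at most 3. The inequality serves both
  to compare the weight with its local averages and to dominate difference quotients.\<close>

lemma weight_translate: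
  assumes "norm u \<le> 1"
  shows "weight x \<le> 3 ^ DIM('a) * weight (x + u :: 'a::euclidean_space)"
proof -
  have "weight x \<le> (\<Prod>b\<in>(Basis::'a set). 3 * inverse (1 + ((x + u) \<bullet> b)\<^sup>2))"
    unfolding weight_def
  proof (intro prod_mono conjI)
    fix b :: 'a assume b: "b \<in> Basis"
    have "\<bar>u \<bullet> b\<bar> \<le> 1" using Basis_le_norm[OF b, of u] assms by linarith
    then have u: "(u \<bullet> b)\<^sup>2 \<le> 1" by (simp add: abs_square_le_1)
    have "0 \<le> (x \<bullet> b - u \<bullet> b)\<^sup>2" by simp
    then have "(x \<bullet> b + u \<bullet> b)\<^sup>2 \<le> 2 * (x \<bullet> b)\<^sup>2 + 2 * (u \<bullet> b)\<^sup>2"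
      by (simp add: power2_eq_square algebra_simps)
    then have "1 + ((x + u) \<bullet> b)\<^sup>2 \<le> 3 * (1 + (x \<bullet> b)\<^sup>2)"
      using u zero_le_power2[of "x \<bullet> b"] unfolding inner_add_left distrib_left by linarith
    then show "inverse (1 + (x \<bullet> b)\<^sup>2) \<le> 3 * inverse (1 + ((x + u) \<bullet> b)\<^sup>2)"
      by (simp add: field_simps add_pos_nonneg)
  qed (auto simp: add_pos_nonneg)
  also have "\<dots> = 3 ^ DIM('a) * weight (x + u)"
    by (simp add: prod.distrib weight_def)
  finally show ?thesis .
qed

lemma nn_integral_weight_lborel: "(\<integral>\<^sup>+x. weight (x::'a::euclidean_space) \<partial>lborel) < \<infinity>"
proof -
  have "integrable lborel (\<lambda>x::real. inverse (1 + x\<^sup>2))"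
    using integrable_inverse_1_plus_square by (simp add: set_integrable_def einterval_def)
  then have 1: "(\<integral>\<^sup>+t. ennreal (inverse (1 + t\<^sup>2)) \<partial>lborel) < \<infinity>"
    by (subst (asm) integrable_iff_bounded) (auto simp: add_pos_nonneg add_nonneg_nonneg)
  have "(\<integral>\<^sup>+x. weight (x::'a) \<partial>lborel) = (\<integral>\<^sup>+x. (\<Prod>b\<in>Basis. ennreal (inverse (1 + ((x::'a) \<bullet> b)\<^sup>2))) \<partial>lborel)"
    unfolding weight_def by (subst prod_ennreal) (auto simp: add_nonneg_nonneg)
  also have "\<dots> = (\<Prod>b\<in>(Basis::'a set). \<integral>\<^sup>+t. ennreal (inverse (1 + t\<^sup>2)) \<partial>lborel)"
    by (intro nn_integral_lborel_prod) auto
  also have "\<dots> < \<infinity>" using 1 by (simp add: power_less_top_ennreal)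
  finally show ?thesis .
qed

lemma integrable_weight_lborel: "integrable lborel (weight :: 'a::euclidean_space \<Rightarrow> real)"
  using nn_integral_weight_lborel[where 'a='a] weight_pos
  by (simp add: integrable_iff_bounded less_imp_le abs_of_pos weight_pos)

subsection \<open>Rapidly decreasing functions\<close>

text \<open>The decay half of \<open>schwartz\<close> alone, so that products such as
  \<open>f x * of_real ((norm x)\<^sup>2)\<close> and Fourier transforms can be estimated without
  differentiating them.\<close>

definition rapid :: "('a::real_normed_vector \<Rightarrow> complex) \<Rightarrow> bool" where
  "rapid f \<longleftrightarrow> (\<forall>k::nat. bounded (range (\<lambda>x. norm x ^ k *\<^sub>R f x)))"

text \<open>Unlike powers of \<open>norm x\<close>, powers of \<open>1 + norm x\<close> are bounded
  below, also at the origin, so they can be divided by; this is the form used in the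
  estimates.\<close>

lemma rapid_iff: "rapid f \<longleftrightarrow> (\<forall>k. \<exists>C. \<forall>x. cmod (f x) * (1 + norm x) ^ k \<le> C)"
proof
  assume r: "rapid f"
  show "\<forall>k. \<exists>C. \<forall>x. cmod (f x) * (1 + norm x) ^ k \<le> C"
  proof
    fix k
    obtain A where A: "\<And>x. norm (norm x ^ 0 *\<^sub>R f x) \<le> A"
      using spec[OF r[unfolded rapid_def], of 0] unfolding bounded_iff by auto
    obtain B where B: "\<And>x. norm (norm x ^ k *\<^sub>R f x) \<le> B"
      using spec[OF r[unfolded rapid_def], of k] unfolding bounded_iff by auto
    have "cmod (f x) * (1 + norm x) ^ k \<le> 2 ^ k * (A + B)" for x
    proof -
      have "(1 + norm x) ^ k \<le> (2 * max 1 (norm x)) ^ k"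
        by (intro power_mono) auto
      also have "\<dots> \<le> 2 ^ k * (1 + norm x ^ k)"
        by (auto simp: power_mult_distrib max_def)
      finally have "cmod (f x) * (1 + norm x) ^ k \<le> cmod (f x) * (2 ^ k * (1 + norm x ^ k))"
        by (intro mult_left_mono) auto
      also have "\<dots> = 2 ^ k * (norm (norm x ^ 0 *\<^sub>R f x) + norm (norm x ^ k *\<^sub>R f x))"
        by (simp add: algebra_simps)
      also have "\<dots> \<le> 2 ^ k * (A + B)"
        by (intro mult_left_mono add_mono A B) auto
      finally show ?thesis .
    qed
    then show "\<exists>C. \<forall>x. cmod (f x) * (1 + norm x) ^ k \<le> C" by blast
  qed
next
  assume r: "\<forall>k. \<exists>C. \<forall>x. cmod (f x) * (1 + norm x) ^ k \<le> C"
  show "rapid f"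
    unfolding rapid_def
  proof
    fix k
    obtain C where C: "\<And>x. cmod (f x) * (1 + norm x) ^ k \<le> C" using r by blast
    have "norm (norm x ^ k *\<^sub>R f x) \<le> C" for x
    proof -
      have "norm (norm x ^ k *\<^sub>R f x) = cmod (f x) * norm x ^ k" by simp
      also have "\<dots> \<le> cmod (f x) * (1 + norm x) ^ k"
        by (intro mult_left_mono power_mono) auto
      finally show ?thesis using C[of x] by linarith
    qed
    then show "bounded (range (\<lambda>x. norm x ^ k *\<^sub>R f x))" by (auto simp: bounded_iff)
  qed
qed

lemma rapid_add: "rapid f \<Longrightarrow> rapid g \<Longrightarrow> rapid (\<lambda>x. f x + g x)"
  unfolding rapid_iff
proof
  fix k
  assume "\<forall>k. \<exists>C. \<forall>x. cmod (f x) * (1 + norm x) ^ k \<le> C"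
    and "\<forall>k. \<exists>C. \<forall>x. cmod (g x) * (1 + norm x) ^ k \<le> C"
  then obtain C D where *: "\<And>x. cmod (f x) * (1 + norm x) ^ k \<le> C" "\<And>x. cmod (g x) * (1 + norm x) ^ k \<le> D"
    by meson
  have "cmod (f x + g x) * (1 + norm x) ^ k \<le> C + D" for x
  proof -
    have "cmod (f x + g x) * (1 + norm x) ^ k \<le> (cmod (f x) + cmod (g x)) * (1 + norm x) ^ k"
      by (intro mult_right_mono norm_triangle_ineq) auto
    then show ?thesis using *(1)[of x] *(2)[of x] by (simp add: algebra_simps)
  qed
  then show "\<exists>C. \<forall>x. cmod (f x + g x) * (1 + norm x) ^ k \<le> C" by blast
qed

lemma rapid_mult:
  assumes "rapid f" "\<And>x. cmod (g x) \<le> C * (1 + norm x) ^ m"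
  shows "rapid (\<lambda>x. f x * g x)"
  unfolding rapid_iff
proof
  fix k
  obtain D where D: "\<And>x. cmod (f x) * (1 + norm x) ^ (m + k) \<le> D"
    using assms(1) unfolding rapid_iff by blast
  have C0: "0 \<le> C" using order_trans[OF norm_ge_zero assms(2)[of 0]] by simp
  have "cmod (f x * g x) * (1 + norm x) ^ k \<le> C * D" for x
  proof -
    have "cmod (f x * g x) * (1 + norm x) ^ k \<le> cmod (f x) * (C * (1 + norm x) ^ m) * (1 + norm x) ^ k"
      unfolding norm_mult by (intro mult_right_mono mult_left_mono assms) auto
    also have "\<dots> = C * (cmod (f x) * (1 + norm x) ^ (m + k))"
      by (simp add: power_add algebra_simps)
    also have "\<dots> \<le> C * D" by (intro mult_left_mono D C0)
    finally show ?thesis .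
  qed
  then show "\<exists>C. \<forall>x. cmod (f x * g x) * (1 + norm x) ^ k \<le> C" by blast
qed

text \<open>The bridge from decay to integrability: any Borel measure that integrates
  \<open>weight\<close> integrates every measurable rapidly decreasing function.\<close>

lemma rapid_le_weight:
  assumes "rapid f" shows "\<exists>C\<ge>0. \<forall>x. cmod (f x) \<le> C * weight (x::'a::euclidean_space)"
proof -
  obtain D where D: "\<And>x. cmod (f x) * (1 + norm x) ^ (2 * DIM('a)) \<le> D"
    using assms unfolding rapid_iff by blast
  have D0: "0 \<le> D" using order_trans[OF _ D[of 0]] by simp
  have "cmod (f x) \<le> D * weight x" for x
  proof -
    have p: "0 < (1 + norm x) ^ (2 * DIM('a))" by (simp add: add_pos_nonneg)
    have "cmod (f x) \<le> D * inverse ((1 + norm x) ^ (2 * DIM('a)))"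
      using D[of x] p by (simp add: field_simps)
    also have "\<dots> \<le> D * weight x" by (intro mult_left_mono weight_ge D0)
    finally show ?thesis .
  qed
  then show ?thesis using D0 by blast
qed

subsection \<open>Schwartz functions\<close>

lemma foldr_partial_deriv_mem:
  assumes "f \<in> A" "\<And>g b. g \<in> A \<Longrightarrow> b \<in> Basis \<Longrightarrow> partial_deriv b g \<in> A" "set bs \<subseteq> Basis"
  shows "foldr partial_deriv bs f \<in> A"
  using assms(3) by (induction bs) (auto intro: assms)

text \<open>Every iterated derivative of a member stays in a family that is closed under
  \<open>partial_deriv\<close>. With a well chosen family, membership in \<open>schwartz\<close>
  reduces to a single differentiation, and no formula for higher derivatives is written
  down.\<close>

lemma schwartz_coinduct:
  assumes "f \<in> A"
    and "\<And>g x. g \<in> A \<Longrightarrow> g differentiable (at x)"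
    and "\<And>g. g \<in> A \<Longrightarrow> rapid g"
    and "\<And>g b. g \<in> A \<Longrightarrow> b \<in> Basis \<Longrightarrow> partial_deriv b g \<in> A"
  shows "f \<in> schwartz"
  unfolding schwartz_def
  using foldr_partial_deriv_mem[OF assms(1,4)] assms(2,3) unfolding rapid_def by blast

lemma schwartz_differentiable: "f \<in> schwartz \<Longrightarrow> f differentiable (at x)"
  unfolding schwartz_def by (auto dest!: spec[of _ "[]"])

lemma schwartz_rapid: "f \<in> schwartz \<Longrightarrow> rapid f"
  unfolding schwartz_def rapid_def by (auto dest!: spec[of _ "[]"])

lemma schwartz_partial_deriv:
  assumes "f \<in> schwartz" "b \<in> Basis" shows "partial_deriv b f \<in> schwartz"
proof -
  \<comment> \<open>\<open>foldr\<close> applies the last entry of the list first, so the extra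
    derivative is appended at the end.\<close>
  have "foldr partial_deriv bs (partial_deriv b f) = foldr partial_deriv (bs @ [b]) f" for bs
    by simp
  then show ?thesis
    using assms unfolding schwartz_def
    by (auto simp del: foldr_append)
qed

lemma schwartz_continuous: "f \<in> schwartz \<Longrightarrow> continuous_on UNIV f"
  by (simp add: continuous_at_imp_continuous_on differentiable_imp_continuous_within schwartz_differentiable)

lemma schwartz_measurable: "f \<in> schwartz \<Longrightarrow> f \<in> borel_measurable borel"
  by (rule borel_measurable_continuous_onI) (rule schwartz_continuous)

text \<open>Multipliers of the Schwartz space.\<close>

definition slow :: "('a::euclidean_space \<Rightarrow> complex) set" where
  "slow = {f. \<forall>bs. set bs \<subseteq> Basis \<longrightarrow> (\<forall>x. foldr partial_deriv bs f differentiable (at x)) \<and>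
     (\<exists>C k. \<forall>x. cmod (foldr partial_deriv bs f x) \<le> C * (1 + norm x) ^ k)}"

lemma slow_coinduct:
  assumes "f \<in> A"
    and "\<And>g x. g \<in> A \<Longrightarrow> g differentiable (at x)"
    and "\<And>g. g \<in> A \<Longrightarrow> \<exists>C k. \<forall>x. cmod (g x) \<le> C * (1 + norm x) ^ k"
    and "\<And>g b. g \<in> A \<Longrightarrow> b \<in> Basis \<Longrightarrow> partial_deriv b g \<in> A"
  shows "f \<in> slow"
  unfolding slow_def
  using foldr_partial_deriv_mem[OF assms(1,4)] assms(2,3) by blast

lemma slow_differentiable: "f \<in> slow \<Longrightarrow> f differentiable (at x)"
  unfolding slow_def by (auto dest!: spec[of _ "[]"])

lemma slow_growth: "f \<in> slow \<Longrightarrow> \<exists>C k. \<forall>x. cmod (f x) \<le> C * (1 + norm x) ^ k"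
  unfolding slow_def mem_Collect_eq by (drule spec[of _ "[]"]) simp

lemma slow_partial_deriv:
  assumes "f \<in> slow" "b \<in> Basis" shows "partial_deriv b f \<in> slow"
proof -
  have "foldr partial_deriv bs (partial_deriv b f) = foldr partial_deriv (bs @ [b]) f" for bs
    by simp
  then show ?thesis
    using assms unfolding slow_def
    by (auto simp del: foldr_append)
qed

lemma partial_deriv_eq:
  assumes "\<And>x. (f has_derivative D x) (at x)"
  shows "partial_deriv b f = (\<lambda>x. D x b)"
  using frechet_derivative_at[OF assms] by (auto simp: partial_deriv_def fun_eq_iff)

lemma differentiable_has_derivative:
  "f differentiable (at x) \<Longrightarrow> (f has_derivative frechet_derivative f (at x)) (at x)"
  by (simp add: frechet_derivative_works)

lemma partial_deriv_add:
  assumes "\<And>x. f differentiable (at x)" "\<And>x. g differentiable (at x)"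
  shows "partial_deriv b (\<lambda>x. f x + g x) = (\<lambda>x. partial_deriv b f x + partial_deriv b g x)"
  by (subst partial_deriv_eq) (auto intro!: has_derivative_add differentiable_has_derivative assms simp: partial_deriv_def)

lemma partial_deriv_mult:
  assumes "\<And>x. f differentiable (at x)" "\<And>x. g differentiable (at x)"
  shows "partial_deriv b (\<lambda>x. f x * g x) = (\<lambda>x. f x * partial_deriv b g x + partial_deriv b f x * g x)"
  by (subst partial_deriv_eq) (auto intro!: has_derivative_mult differentiable_has_derivative assms simp: partial_deriv_def)

text \<open>The family for the coinduction: by the Leibniz rule a derivative of a product is a sum
  of two products, so products have to be closed under sums.\<close>

inductive_set product_sums :: "('a::euclidean_space \<Rightarrow> complex) set" where
  product: "f \<in> schwartz \<Longrightarrow> g \<in> slow \<Longrightarrow> (\<lambda>x. f x * g x) \<in> product_sums"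
| sum: "f \<in> product_sums \<Longrightarrow> g \<in> product_sums \<Longrightarrow> (\<lambda>x. f x + g x) \<in> product_sums"

lemma product_sums_differentiable: "f \<in> product_sums \<Longrightarrow> f differentiable (at x)"
proof (induction rule: product_sums.induct)
  case (product f g)
  then show ?case by (intro differentiable_mult schwartz_differentiable slow_differentiable)
qed (rule differentiable_add)

lemma product_sums_subset_schwartz: "product_sums \<subseteq> (schwartz :: ('a::euclidean_space \<Rightarrow> complex) set)"
proof
  fix f :: "'a \<Rightarrow> complex" assume "f \<in> product_sums"
  then show "f \<in> schwartz"
  proof (rule schwartz_coinduct)
    show "g differentiable (at x)" if "g \<in> product_sums" for g :: "'a \<Rightarrow> complex" and x
      using that by (rule product_sums_differentiable)
    show "rapid g" if "g \<in> product_sums" for g :: "'a \<Rightarrow> complex"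
      using that
    proof induction
      case (product f g)
      then show ?case using slow_growth[of g] rapid_mult[OF schwartz_rapid, of f g] by blast
    qed (rule rapid_add)
    show "partial_deriv b g \<in> product_sums" if "g \<in> product_sums" "b \<in> Basis" for g :: "'a \<Rightarrow> complex" and b
      using that
    proof induction
      case (product f g)
      have "partial_deriv b (\<lambda>x. f x * g x) = (\<lambda>x. f x * partial_deriv b g x + partial_deriv b f x * g x)"
        using product by (intro partial_deriv_mult schwartz_differentiable slow_differentiable)
      then show ?case
        using product by (simp add: product_sums.intros schwartz_partial_deriv slow_partial_deriv)
    next
      case (sum f g)
      then show ?case
        by (subst partial_deriv_add) (auto intro!: product_sums.intros product_sums_differentiable)
    qed
  qed
qed

lemma schwartz_mult_slow: "f \<in> schwartz \<Longrightarrow> g \<in> slow \<Longrightarrow> (\<lambda>x. f x * g x) \<in> schwartz"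
  using product_sums_subset_schwartz product_sums.product by blast

text \<open>Affine rather than linear, since the derivative of a linear function is a constant and
  the family has to contain it, as the case of slope 0.\<close>

lemma slow_affine: "(\<lambda>x. c * complex_of_real (x \<bullet> v) + d) \<in> (slow :: ('a::euclidean_space \<Rightarrow> complex) set)"
proof -
  let ?A = "{(\<lambda>x. c * complex_of_real (x \<bullet> v) + d) | c v d. True} :: ('a \<Rightarrow> complex) set"
  have D: "((\<lambda>x. c * complex_of_real (x \<bullet> v) + d) has_derivative (\<lambda>u. c * complex_of_real (u \<bullet> v))) (at x)"
    for c d and v x :: 'a
    by (auto intro!: derivative_eq_intros)
  show ?thesis
  proof (rule slow_coinduct[where A="?A"])
    show "g differentiable (at x)" if "g \<in> ?A" for g x
      using that differentiableI[OF D] by auto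
    show "\<exists>C k. \<forall>x. cmod (g x) \<le> C * (1 + norm x) ^ k" if g: "g \<in> ?A" for g
    proof -
      obtain c v d where "g = (\<lambda>x. c * complex_of_real (x \<bullet> v) + d)" using g by blast
      moreover have "cmod (c * complex_of_real (x \<bullet> v) + d) \<le> (cmod c * norm v + cmod d) * (1 + norm x) ^ 1" for x
      proof -
        have "cmod (c * complex_of_real (x \<bullet> v) + d) \<le> cmod c * \<bar>x \<bullet> v\<bar> + cmod d"
          using norm_triangle_ineq[of "c * complex_of_real (x \<bullet> v)" d] by (simp add: norm_mult)
        also have "\<dots> \<le> cmod c * (norm x * norm v) + cmod d"
          by (intro add_right_mono mult_left_mono Cauchy_Schwarz_ineq2) auto
        finally show ?thesis by (simp add: algebra_simps) (smt (verit) mult_nonneg_nonneg norm_ge_zero)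
      qed
      ultimately show ?thesis by blast
    qed
    show "partial_deriv b g \<in> ?A" if g: "g \<in> ?A" for g b
    proof -
      obtain c v d where "g = (\<lambda>x. c * complex_of_real (x \<bullet> v) + d)" using g by blast
      then have "partial_deriv b g = (\<lambda>x. c * complex_of_real (b \<bullet> v))"
        using partial_deriv_eq[OF D] by simp
      then have "partial_deriv b g = (\<lambda>x. 0 * complex_of_real (x \<bullet> v) + c * complex_of_real (b \<bullet> v))"
        by simp
      then show ?thesis by blast
    qed
  qed blast
qed

lemma slow_const: "(\<lambda>x. c) \<in> slow"
  using slow_affine[of 0 0 c] by simp

lemma slow_linear: "(\<lambda>x. c * complex_of_real (x \<bullet> v)) \<in> slow"
  using slow_affine[of c v 0] by simp

text \<open>The free scalar \<open>c\<close> in the family absorbs the factor that each derivative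
  produces. All members have constant modulus, so growth of order 0 suffices.\<close>

lemma slow_cis: "(\<lambda>x. cis (a * (t \<bullet> x))) \<in> (slow :: ('a::euclidean_space \<Rightarrow> complex) set)"
proof -
  let ?A = "{(\<lambda>x. c * cis (a * (t \<bullet> x))) | c. True} :: ('a \<Rightarrow> complex) set"
  have D: "((\<lambda>x. c * cis (a * (t \<bullet> x))) has_derivative (\<lambda>u. c * (\<i> * complex_of_real (a * (t \<bullet> u)) * cis (a * (t \<bullet> x))))) (at x)"
    for c x
  proof -
    have "((\<lambda>x. exp (\<i> * complex_of_real (a * (t \<bullet> x)))) has_derivative
        (\<lambda>u. exp (\<i> * complex_of_real (a * (t \<bullet> x))) * (\<i> * complex_of_real (a * (t \<bullet> u))))) (at x)"
      by (rule has_derivative_compose[OF _ DERIV_exp[unfolded has_field_derivative_def]])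
        (auto intro!: derivative_eq_intros)
    from has_derivative_mult_right[OF this, of c] show ?thesis
      unfolding cis_conv_exp by (simp add: mult_ac)
  qed
  show ?thesis
  proof (rule slow_coinduct[where A="?A"])
    show "g differentiable (at x)" if "g \<in> ?A" for g x
      using that differentiableI[OF D] by auto
    show "\<exists>C k. \<forall>x. cmod (g x) \<le> C * (1 + norm x) ^ k" if g: "g \<in> ?A" for g
    proof -
      obtain c where "g = (\<lambda>x. c * cis (a * (t \<bullet> x)))" using g by blast
      then have "\<forall>x. cmod (g x) \<le> cmod c * (1 + norm x) ^ 0" by (simp add: norm_mult)
      then show ?thesis by blast
    qed
    show "partial_deriv b g \<in> ?A" if g: "g \<in> ?A" for g b
    proof -
      obtain c where "g = (\<lambda>x. c * cis (a * (t \<bullet> x)))" using g by blast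
      then have "partial_deriv b g = (\<lambda>x. (c * (\<i> * complex_of_real (a * (t \<bullet> b)))) * cis (a * (t \<bullet> x)))"
        using partial_deriv_eq[OF D] by (simp add: mult.assoc)
      then show ?thesis by blast
    qed
    have "(\<lambda>x. cis (a * (t \<bullet> x))) = (\<lambda>x. 1 * cis (a * (t \<bullet> x)))" by simp
    then show "(\<lambda>x. cis (a * (t \<bullet> x))) \<in> ?A" by blast
  qed
qed

lemma schwartz_subset_slow: "schwartz \<subseteq> slow"
proof
  fix f :: "'a \<Rightarrow> complex" assume "f \<in> schwartz"
  then show "f \<in> slow"
  proof (rule slow_coinduct)
    show "\<exists>C k. \<forall>x. cmod (g x) \<le> C * (1 + norm x) ^ k" if "g \<in> schwartz" for g :: "'a \<Rightarrow> complex"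
      using schwartz_rapid[OF that] unfolding rapid_iff
      by (metis mult.right_neutral power_0)
  qed (auto intro: schwartz_differentiable schwartz_partial_deriv)
qed

lemma schwartz_mult: "f \<in> schwartz \<Longrightarrow> g \<in> schwartz \<Longrightarrow> (\<lambda>x. f x * g x) \<in> schwartz"
  using schwartz_mult_slow schwartz_subset_slow by blast

lemma schwartz_add:
  assumes "f \<in> schwartz" "g \<in> schwartz" shows "(\<lambda>x. f x + g x) \<in> schwartz"
proof -
  have "(\<lambda>x. f x * 1 + g x * 1) \<in> product_sums"
    by (intro product_sums.intros assms slow_const)
  then show ?thesis using product_sums_subset_schwartz by auto
qed

lemma schwartz_cmult: "f \<in> schwartz \<Longrightarrow> (\<lambda>x. c * f x) \<in> schwartz"
  using schwartz_mult_slow[OF _ slow_const, of f c] by (simp add: mult.commute)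

lemma schwartz_cnj:
  assumes "f \<in> schwartz" shows "(\<lambda>x. cnj (f x)) \<in> schwartz"
proof -
  have D: "((\<lambda>x. cnj (g x)) has_derivative (\<lambda>u. cnj (frechet_derivative g (at x) u))) (at x)"
    if "g \<in> schwartz" for g :: "'a \<Rightarrow> complex" and x
    by (intro has_derivative_cnj differentiable_has_derivative schwartz_differentiable that)
  let ?A = "{(\<lambda>x. cnj (g x)) | g. g \<in> schwartz} :: ('a \<Rightarrow> complex) set"
  show ?thesis
  proof (rule schwartz_coinduct[where A="?A"])
    show "g differentiable (at x)" if "g \<in> ?A" for g x
      using that differentiableI[OF D] by auto
    show "rapid g" if "g \<in> ?A" for g
    proof -
      obtain h where "h \<in> schwartz" "g = (\<lambda>x. cnj (h x))" using \<open>g \<in> ?A\<close> by blast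
      then show ?thesis using schwartz_rapid[of h] by (simp add: rapid_iff)
    qed
    show "partial_deriv b g \<in> ?A" if g: "g \<in> ?A" and b: "b \<in> Basis" for g b
    proof -
      obtain h where h: "h \<in> schwartz" "g = (\<lambda>x. cnj (h x))" using g by blast
      have "partial_deriv b g = (\<lambda>x. cnj (partial_deriv b h x))"
        unfolding h using partial_deriv_eq[OF D[OF h(1)]] by (simp add: partial_deriv_def)
      then show ?thesis using schwartz_partial_deriv[OF h(1) b] by blast
    qed
  qed (use assms in blast)
qed

text \<open>Covers translations (\<open>s = 1\<close>) and the reflection (\<open>s = - 1\<close>)
  at once. The family carries a scalar because the chain rule contributes \<open>s\<close>; decay is
  transferred by \<open>1 + norm x \<le> (1 + norm t) * (1 + norm (s *\<^sub>R x +
  t))\<close>.\<close>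

lemma schwartz_compose_isometry:
  assumes "f \<in> schwartz" "\<bar>s\<bar> = 1"
  shows "(\<lambda>x. f (s *\<^sub>R x + t)) \<in> schwartz"
proof -
  have D: "((\<lambda>x. c * g (s *\<^sub>R x + t)) has_derivative (\<lambda>u. c * frechet_derivative g (at (s *\<^sub>R x + t)) (s *\<^sub>R u))) (at x)"
    if "g \<in> schwartz" for g :: "'a \<Rightarrow> complex" and x c
    by (rule has_derivative_mult_right, rule has_derivative_compose[where f="\<lambda>x. s *\<^sub>R x + t", OF _ differentiable_has_derivative[OF schwartz_differentiable[OF that]]])
      (auto intro!: derivative_eq_intros)
  let ?A = "{(\<lambda>x. c * g (s *\<^sub>R x + t)) | g c. g \<in> schwartz} :: ('a \<Rightarrow> complex) set"
  show ?thesis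
  proof (rule schwartz_coinduct[where A="?A"])
    show "g differentiable (at x)" if "g \<in> ?A" for g x
      using that differentiableI[OF D] by auto
    show "rapid g" if g: "g \<in> ?A" for g
    proof -
      obtain h c where h: "h \<in> schwartz" "g = (\<lambda>x. c * h (s *\<^sub>R x + t))" using g by blast
      have "\<exists>C. \<forall>x. cmod (g x) * (1 + norm x) ^ k \<le> C" for k
      proof -
        obtain C where C: "\<And>x. cmod (h x) * (1 + norm x) ^ k \<le> C"
          using schwartz_rapid[OF h(1)] unfolding rapid_iff by blast
        have "cmod (g x) * (1 + norm x) ^ k \<le> cmod c * (1 + norm t) ^ k * C" for x
        proof -
          have "norm x \<le> norm (s *\<^sub>R x + t) + norm t"
            using norm_triangle_ineq4[of "s *\<^sub>R x + t" t] assms(2) by simp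
          then have "1 + norm x \<le> (1 + norm t) * (1 + norm (s *\<^sub>R x + t))"
            by (simp add: algebra_simps) (smt (verit) mult_nonneg_nonneg norm_ge_zero)
          then have "(1 + norm x) ^ k \<le> ((1 + norm t) * (1 + norm (s *\<^sub>R x + t))) ^ k"
            by (intro power_mono) auto
          then have "cmod (g x) * (1 + norm x) ^ k \<le> cmod (g x) * ((1 + norm t) * (1 + norm (s *\<^sub>R x + t))) ^ k"
            by (intro mult_left_mono) auto
          also have "\<dots> = cmod c * (1 + norm t) ^ k * (cmod (h (s *\<^sub>R x + t)) * (1 + norm (s *\<^sub>R x + t)) ^ k)"
            by (simp add: h power_mult_distrib norm_mult)
          also have "\<dots> \<le> cmod c * (1 + norm t) ^ k * C"
            by (intro mult_left_mono C) auto
          finally show ?thesis .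
        qed
        then show ?thesis by blast
      qed
      then show ?thesis unfolding rapid_iff by blast
    qed
    show "partial_deriv b g \<in> ?A" if g: "g \<in> ?A" and b: "b \<in> Basis" for g b
    proof -
      obtain h c where h: "h \<in> schwartz" "g = (\<lambda>x. c * h (s *\<^sub>R x + t))" using g by blast
      have "partial_deriv b g = (\<lambda>x. (c * complex_of_real s) * partial_deriv b h (s *\<^sub>R x + t))"
        unfolding h using partial_deriv_eq[OF D[OF h(1)]]
        by (simp add: partial_deriv_def linear_cmul[OF linear_frechet_derivative[OF schwartz_differentiable[OF h(1)]]] scaleR_conv_of_real mult.assoc)
      then show ?thesis using schwartz_partial_deriv[OF h(1) b] by blast
    qed
    have "(\<lambda>x. f (s *\<^sub>R x + t)) = (\<lambda>x. 1 * f (s *\<^sub>R x + t))" by simp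
    then show "(\<lambda>x. f (s *\<^sub>R x + t)) \<in> ?A" using assms by blast
  qed
qed

lemma schwartz_translate: "f \<in> schwartz \<Longrightarrow> (\<lambda>x. f (x - t)) \<in> schwartz"
  using schwartz_compose_isometry[of f 1 "- t"] by simp

lemma schwartz_reflect: "f \<in> schwartz \<Longrightarrow> (\<lambda>x. f (- x)) \<in> schwartz"
  using schwartz_compose_isometry[of f "-1" 0] by simp

section \<open>Integrability criteria and changes of variable\<close>

lemma integrable_le_weight:
  fixes f :: "'a::euclidean_space \<Rightarrow> complex"
  assumes "sets m = sets borel" "(\<integral>\<^sup>+x. weight x \<partial>m) < \<infinity>"
    and "f \<in> borel_measurable borel" "\<And>x. cmod (f x) \<le> C * weight x"
  shows "integrable m f"
proof (rule Bochner_Integration.integrable_bound)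
  have "weight \<in> borel_measurable m"
    unfolding measurable_cong_sets[OF assms(1) refl] by (rule weight_measurable)
  then have "integrable m weight"
    using assms(2) weight_pos by (simp add: integrable_iff_bounded less_imp_le abs_of_pos[OF weight_pos])
  then show "integrable m (\<lambda>x. C * weight x)" by simp
  show "f \<in> borel_measurable m"
    unfolding measurable_cong_sets[OF assms(1) refl] by (rule assms)
  show "AE x in m. norm (f x) \<le> norm (C * weight x)"
    by (auto intro!: AE_I2 order_trans[OF assms(4)])
qed

lemma rapid_integrable:
  assumes "sets m = sets borel" "(\<integral>\<^sup>+x. weight x \<partial>m) < \<infinity>"
    and "rapid (f :: 'a::euclidean_space \<Rightarrow> complex)" "f \<in> borel_measurable borel"
  shows "integrable m f"
  using rapid_le_weight[OF assms(3)] integrable_le_weight[OF assms(1,2,4)] by blast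

lemma schwartz_integrable:
  "f \<in> schwartz \<Longrightarrow> integrable lborel f"
  by (rule rapid_integrable)
    (auto intro: schwartz_rapid schwartz_measurable simp: nn_integral_weight_lborel[simplified])

lemma integrable_cis_mult:
  assumes "integrable lborel (f :: 'a::euclidean_space \<Rightarrow> complex)"
    and [measurable]: "g \<in> borel_measurable borel"
  shows "integrable lborel (\<lambda>x. cis (g x) * f x)"
proof (rule Bochner_Integration.integrable_bound[OF assms(1)])
  have [measurable]: "f \<in> borel_measurable borel" using assms(1) by simp
  show "(\<lambda>x. cis (g x) * f x) \<in> borel_measurable lborel"
    unfolding cis_conv_exp by measurable
qed (simp add: norm_mult)

lemma lborel_integral_translate:
  fixes f :: "'a::euclidean_space \<Rightarrow> complex"
  assumes [measurable]: "f \<in> borel_measurable borel"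
  shows "(\<integral>x. f (x + t) \<partial>lborel) = (\<integral>x. f x \<partial>lborel)"
proof -
  have "(\<integral>x. f x \<partial>lborel) = (\<integral>x. f x \<partial>distr lborel borel ((+) t))"
    by (simp add: lborel_distr_plus)
  also have "\<dots> = (\<integral>x. f (t + x) \<partial>lborel)"
    by (intro integral_distr) auto
  finally show ?thesis by (simp add: add.commute)
qed

lemma lborel_integral_scale:
  fixes f :: "'a::euclidean_space \<Rightarrow> complex"
  assumes [measurable]: "f \<in> borel_measurable borel" and c: "c \<noteq> 0"
  shows "(\<integral>x. f x \<partial>lborel) = \<bar>c\<bar> ^ DIM('a) *\<^sub>R (\<integral>x. f (c *\<^sub>R x) \<partial>lborel)"
proof -
  have "(\<integral>x. f x \<partial>lborel) = (\<integral>x. f x \<partial>density (distr lborel borel (\<lambda>x. 0 + c *\<^sub>R x)) (\<lambda>_. \<bar>c\<bar> ^ DIM('a)))"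
    using lborel_affine[OF c, of "0::'a"] by simp
  also have "\<dots> = (\<integral>x. \<bar>c\<bar> ^ DIM('a) *\<^sub>R f x \<partial>distr lborel borel (\<lambda>x. 0 + c *\<^sub>R x))"
    by (intro integral_density) auto
  also have "\<dots> = (\<integral>x. \<bar>c\<bar> ^ DIM('a) *\<^sub>R f (0 + c *\<^sub>R x) \<partial>lborel)"
    by (intro integral_distr) auto
  finally show ?thesis by simp
qed

lemma lborel_integral_reflect:
  fixes f :: "'a::euclidean_space \<Rightarrow> complex"
  assumes "f \<in> borel_measurable borel"
  shows "(\<integral>x. f (- x) \<partial>lborel) = (\<integral>x. f x \<partial>lborel)"
  using lborel_integral_scale[OF assms, of "-1"] by simp

text \<open>The integrands to which Fubini is applied in the Fourier computations are a factor of
  modulus 1 times a product of two integrable functions of separate variables.\<close>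

lemma integrable_pair_bound:
  fixes F :: "'a \<times> 'b \<Rightarrow> complex"
  assumes "sigma_finite_measure M" "sigma_finite_measure N"
    and f: "integrable M f" and g: "integrable N g"
    and F: "F \<in> borel_measurable (M \<Otimes>\<^sub>M N)"
    and le: "\<And>x y. x \<in> space M \<Longrightarrow> y \<in> space N \<Longrightarrow> cmod (F (x, y)) \<le> cmod (f x) * cmod (g y)"
  shows "integrable (M \<Otimes>\<^sub>M N) F"
proof (rule integrableI_bounded[OF F])
  interpret M: sigma_finite_measure M by fact
  interpret N: sigma_finite_measure N by fact
  have [measurable]: "f \<in> borel_measurable M" "g \<in> borel_measurable N"
    using f g by auto
  have "(\<integral>\<^sup>+p. norm (F p) \<partial>(M \<Otimes>\<^sub>M N)) = (\<integral>\<^sup>+x. \<integral>\<^sup>+y. norm (F (x, y)) \<partial>N \<partial>M)"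
    using F by (intro N.nn_integral_fst[symmetric]) simp
  also have "\<dots> \<le> (\<integral>\<^sup>+x. \<integral>\<^sup>+y. ennreal (norm (f x)) * ennreal (norm (g y)) \<partial>N \<partial>M)"
    using le by (intro nn_integral_mono) (auto simp: ennreal_mult[symmetric] intro!: ennreal_leI)
  also have "\<dots> = (\<integral>\<^sup>+x. norm (f x) \<partial>M) * (\<integral>\<^sup>+y. norm (g y) \<partial>N)"
    by (simp add: nn_integral_cmult nn_integral_multc)
  also have "\<dots> < \<infinity>"
    using f g by (simp add: integrable_iff_bounded ennreal_mult_less_top)
  finally show "(\<integral>\<^sup>+p. norm (F p) \<partial>(M \<Otimes>\<^sub>M N)) < \<infinity>" .
qed

subsection \<open>The Fourier transform\<close>

lemma fourier_bound: "cmod (fourier f y) \<le> (\<integral>x. cmod (f x) \<partial>lborel)"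
proof -
  have "cmod (fourier f y) \<le> (\<integral>x. cmod (cis (- 2 * pi * (x \<bullet> y)) * f x) \<partial>lborel)"
    unfolding fourier_def by (rule integral_norm_bound)
  then show ?thesis by (simp add: norm_mult)
qed

lemma cis_remainder: "cmod (cis (a + b) - cis a - \<i> * of_real b * cis a) \<le> b\<^sup>2 / 2"
proof -
  have "cis (a + b) - cis a - \<i> * of_real b * cis a = cis a * (cis b - 1 - \<i> * of_real b)"
    by (simp add: cis_mult[symmetric] algebra_simps)
  then have "cmod (cis (a + b) - cis a - \<i> * of_real b * cis a) = cmod (cis b - (1 + \<i> * of_real b))"
    by (simp only: norm_mult norm_cis mult_1 diff_diff_eq)
  also have "\<dots> \<le> b\<^sup>2 / 2"
    using iexp_approx1[of b 1] by (simp add: cis_conv_exp numeral_2_eq_2)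
  finally show ?thesis .
qed

text \<open>Differentiation under the integral sign with an explicit remainder: the second-order
  Taylor estimate for \<open>cis\<close> bounds the error by
  \<open>2 * pi\<^sup>2 * (norm h)\<^sup>2\<close> times the second absolute moment \<open>K\<close>
  of \<open>f\<close>.\<close>

lemma fourier_has_derivative:
  fixes f :: "'a::euclidean_space \<Rightarrow> complex"
  assumes f: "f \<in> schwartz"
  shows "(fourier f has_derivative (\<lambda>v. fourier (\<lambda>x. - 2 * pi * \<i> * of_real (x \<bullet> v) * f x) y)) (at y)"
proof -
  define D where "D v = fourier (\<lambda>x. - 2 * pi * \<i> * of_real (x \<bullet> v) * f x) y" for v
  note [measurable] = schwartz_measurable[OF f]
  have cis_m [measurable]: "(\<lambda>x::'a. cis (g x)) \<in> borel_measurable borel"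
    if "g \<in> borel_measurable borel" for g
    using that unfolding cis_conv_exp by measurable
  have i0: "integrable lborel (\<lambda>x. cis (- 2 * pi * (x \<bullet> y)) * f x)" for y
    by (intro integrable_cis_mult schwartz_integrable f) measurable
  have i1: "integrable lborel (\<lambda>x. cis (- 2 * pi * (x \<bullet> y)) * (- 2 * pi * \<i> * of_real (x \<bullet> v) * f x))" for v
    using schwartz_mult_slow[OF f slow_linear[of "- 2 * pi * \<i>" v]]
    by (intro integrable_cis_mult schwartz_integrable) (simp_all add: mult.commute)
  have i2: "integrable lborel (\<lambda>x. f x * of_real ((norm x)\<^sup>2))"
  proof -
    have "rapid (\<lambda>x. f x * of_real ((norm x)\<^sup>2))"
      by (rule rapid_mult[OF schwartz_rapid[OF f], of _ 1 2]) (auto simp: power_mono norm_power)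
    then show ?thesis
      by (intro rapid_integrable) (auto simp: nn_integral_weight_lborel[simplified])
  qed
  define K where "K = (\<integral>x. cmod (f x * of_real ((norm x)\<^sup>2)) \<partial>lborel)"
  have rem: "cmod (fourier f (y + h) - fourier f y - D h) \<le> 2 * pi\<^sup>2 * K * (norm h)\<^sup>2" for h
  proof -
    let ?R = "\<lambda>x. cis (- 2 * pi * (x \<bullet> (y + h))) * f x - cis (- 2 * pi * (x \<bullet> y)) * f x
        - cis (- 2 * pi * (x \<bullet> y)) * (- 2 * pi * \<i> * of_real (x \<bullet> h) * f x)"
    have eq: "fourier f (y + h) - fourier f y - D h = (\<integral>x. ?R x \<partial>lborel)"
      unfolding D_def fourier_def
      by (simp only: Bochner_Integration.integral_diff i0 i1 Bochner_Integration.integrable_diff)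
    have "cmod (fourier f (y + h) - fourier f y - D h) \<le> (\<integral>x. cmod (?R x) \<partial>lborel)"
      unfolding eq by (rule integral_norm_bound)
    also have "\<dots> \<le> (\<integral>x. 2 * pi\<^sup>2 * (norm h)\<^sup>2 * cmod (f x * of_real ((norm x)\<^sup>2)) \<partial>lborel)"
    proof (rule integral_mono)
      show "integrable lborel (\<lambda>x. cmod (?R x))"
        by (intro integrable_norm Bochner_Integration.integrable_diff i0 i1)
      show "integrable lborel (\<lambda>x. 2 * pi\<^sup>2 * (norm h)\<^sup>2 * cmod (f x * of_real ((norm x)\<^sup>2)))"
        by (intro integrable_mult_right integrable_norm i2)
      fix x
      let ?a = "- 2 * pi * (x \<bullet> y)" and ?b = "- 2 * pi * (x \<bullet> h)"
      have "?R x = (cis (?a + ?b) - cis ?a - \<i> * of_real ?b * cis ?a) * f x"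
        by (simp add: inner_add_right algebra_simps)
      then have "cmod (?R x) = cmod (cis (?a + ?b) - cis ?a - \<i> * of_real ?b * cis ?a) * cmod (f x)"
        by (simp only: norm_mult)
      moreover have "?b\<^sup>2 / 2 \<le> 2 * pi\<^sup>2 * (norm x * norm h)\<^sup>2"
        using power_mono[OF Cauchy_Schwarz_ineq2[of x h], of 2]
        by (simp add: power_mult_distrib mult_left_mono)
      ultimately have "cmod (?R x) \<le> 2 * pi\<^sup>2 * (norm x * norm h)\<^sup>2 * cmod (f x)"
        using cis_remainder[of ?a ?b] by (auto intro!: mult_right_mono intro: order_trans)
      then show "cmod (?R x) \<le> 2 * pi\<^sup>2 * (norm h)\<^sup>2 * cmod (f x * of_real ((norm x)\<^sup>2))"
        by (simp add: norm_mult power_mult_distrib mult_ac norm_power)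
    qed
    also have "\<dots> = 2 * pi\<^sup>2 * K * (norm h)\<^sup>2" by (simp add: K_def)
    finally show ?thesis .
  qed
  have lin: "linear D"
  proof (rule linearI)
    show "D (u + v) = D u + D v" for u v
      unfolding D_def fourier_def Bochner_Integration.integral_add[OF i1 i1, symmetric]
      by (intro Bochner_Integration.integral_cong) (auto simp: inner_add_right algebra_simps)
    show "D (c *\<^sub>R v) = c *\<^sub>R D v" for c v
      unfolding D_def fourier_def Bochner_Integration.integral_scaleR_right[symmetric]
      by (intro Bochner_Integration.integral_cong) (auto simp: scaleR_conv_of_real algebra_simps)
  qed
  show ?thesis
    unfolding D_def[symmetric]
  proof (rule has_derivativeI_sandwich[where e=1 and H="\<lambda>z. 2 * pi\<^sup>2 * K * norm (z - y)"])
    show "bounded_linear D" using lin by (simp add: linear_conv_bounded_linear)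
    show "norm (fourier f z - fourier f y - D (z - y)) / norm (z - y) \<le> 2 * pi\<^sup>2 * K * norm (z - y)"
      if "z \<noteq> y" for z
      using rem[of "z - y"] that by (simp add: field_simps power2_eq_square)
    show "((\<lambda>z. 2 * pi\<^sup>2 * K * norm (z - y)) \<longlongrightarrow> 0) (at y)"
      by (auto intro!: tendsto_eq_intros)
  qed auto
qed

lemma fourier_partial_deriv_eq:
  assumes "f \<in> schwartz"
  shows "partial_deriv b (fourier f) = fourier (\<lambda>x. - 2 * pi * \<i> * of_real (x \<bullet> b) * f x)"
  using partial_deriv_eq[OF fourier_has_derivative[OF assms]] by simp

text \<open>Difference quotients of \<open>f\<close> integrate to zero by translation invariance.\<close>

lemma schwartz_integral_partial_deriv:
  fixes f :: "'a::euclidean_space \<Rightarrow> complex"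
  assumes f: "f \<in> schwartz" and b: "b \<in> Basis"
  shows "(\<integral>x. partial_deriv b f x \<partial>lborel) = 0"
proof -
  note [measurable] = schwartz_measurable[OF f]
  let ?g = "partial_deriv b f"
  have g: "?g \<in> schwartz" by (intro schwartz_partial_deriv f b)
  obtain C where C: "C \<ge> 0" "\<And>x. cmod (?g x) \<le> C * weight x"
    using rapid_le_weight[OF schwartz_rapid[OF g]] by blast
  have line: "((\<lambda>u. f (x + u *\<^sub>R b)) has_derivative (\<lambda>h. h *\<^sub>R ?g (x + u *\<^sub>R b))) (at u within S)" for x u S
  proof -
    have "((\<lambda>u. f (x + u *\<^sub>R b)) has_derivative (\<lambda>h. frechet_derivative f (at (x + u *\<^sub>R b)) (h *\<^sub>R b))) (at u within S)"
      by (rule has_derivative_compose[OF _ differentiable_has_derivative[OF schwartz_differentiable[OF f]]])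
        (auto intro!: derivative_eq_intros)
    then show ?thesis
      by (simp add: linear_cmul[OF linear_frechet_derivative[OF schwartz_differentiable[OF f]]] partial_deriv_def)
  qed
  define \<phi> where "\<phi> n x = real (Suc n) *\<^sub>R (f (x + (1 / real (Suc n)) *\<^sub>R b) - f x)" for n x
  \<comment> \<open>Mean value inequality along the segment from \<open>x\<close> to
    \<open>x + b\<close>. The step \<open>1 / real (Suc n)\<close> is at most 1, so the weight at
    every intermediate point is comparable with the weight at \<open>x\<close>, uniformly in
    \<open>n\<close>.\<close>
  have bound: "cmod (\<phi> n x) \<le> C * 3 ^ DIM('a) * weight x" for n x
  proof -
    have "cmod (f (x + (1 / real (Suc n)) *\<^sub>R b) - f (x + 0 *\<^sub>R b))
        \<le> C * 3 ^ DIM('a) * weight x * norm (1 / real (Suc n) - 0)"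
    proof (rule differentiable_bound[where S="{0..1}", OF _ line])
      fix u :: real assume u: "u \<in> {0..1}"
      have "weight (x + u *\<^sub>R b) \<le> 3 ^ DIM('a) * weight (x + u *\<^sub>R b + (- u *\<^sub>R b))"
        using u b by (intro weight_translate) auto
      then have le: "cmod (?g (x + u *\<^sub>R b)) \<le> C * (3 ^ DIM('a) * weight x)"
        using C(2)[of "x + u *\<^sub>R b"] C(1) by (auto intro: order_trans mult_left_mono)
      have "norm (h *\<^sub>R ?g (x + u *\<^sub>R b)) \<le> C * 3 ^ DIM('a) * weight x * norm h" for h :: real
        using mult_left_mono[OF le, of "\<bar>h\<bar>"] by (simp add: mult_ac)
      then show "onorm (\<lambda>h. h *\<^sub>R ?g (x + u *\<^sub>R b)) \<le> C * 3 ^ DIM('a) * weight x"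
        using C(1) weight_pos[of x] by (intro onorm_bound) simp_all
    qed (auto simp: field_simps)
    moreover have "cmod (\<phi> n x) = real (Suc n) * cmod (f (x + (1 / real (Suc n)) *\<^sub>R b) - f x)"
      unfolding \<phi>_def norm_scaleR by (simp del: of_nat_Suc)
    ultimately show ?thesis by (simp add: field_simps del: of_nat_Suc)
  qed
  have lim: "(\<lambda>n. \<phi> n x) \<longlonglongrightarrow> ?g x" for x
  proof -
    have vd: "((\<lambda>u. f (x + u *\<^sub>R b)) has_vector_derivative ?g x) (at 0)"
      using line[of x 0 UNIV] by (simp add: has_vector_derivative_def)
    have "((\<lambda>h. (f (x + h *\<^sub>R b) - f x - h *\<^sub>R ?g x) /\<^sub>R norm h) \<longlongrightarrow> 0) (at 0)"
      using line[of x 0 UNIV] by (simp add: has_derivative_def)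
    moreover have "filterlim (\<lambda>n. 1 / real (Suc n)) (at 0) sequentially"
      using LIMSEQ_inverse_real_of_nat
      by (auto simp: filterlim_at inverse_eq_divide simp del: of_nat_Suc)
    ultimately have "(\<lambda>n. (f (x + (1 / real (Suc n)) *\<^sub>R b) - f x - (1 / real (Suc n)) *\<^sub>R ?g x) /\<^sub>R norm (1 / real (Suc n)))
        \<longlonglongrightarrow> 0"
      by (rule filterlim_compose)
    then have "(\<lambda>n. \<phi> n x - ?g x) \<longlonglongrightarrow> 0"
      by (rule Lim_transform_eventually)
        (auto simp: \<phi>_def algebra_simps simp del: of_nat_Suc)
    then show ?thesis by (rule LIM_zero_cancel)
  qed
  have "(\<lambda>n. \<integral>x. \<phi> n x \<partial>lborel) \<longlonglongrightarrow> (\<integral>x. ?g x \<partial>lborel)"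
  proof (rule integral_dominated_convergence)
    show "integrable lborel (\<lambda>x. C * 3 ^ DIM('a) * weight (x::'a))"
      by (intro integrable_mult_right integrable_weight_lborel)
    show "?g \<in> borel_measurable lborel" using schwartz_measurable[OF g] by simp
    show "\<phi> n \<in> borel_measurable lborel" for n unfolding \<phi>_def by measurable
  qed (use bound lim in auto)
  moreover have "(\<integral>x. \<phi> n x \<partial>lborel) = 0" for n
  proof -
    have i: "integrable lborel (\<lambda>x. f (x + t))" for t
      using schwartz_integrable[OF schwartz_translate[OF f, of "- t"]] by simp
    have "(\<integral>x. f (x + (1 / real (Suc n)) *\<^sub>R b) - f x \<partial>lborel) = 0"
      using Bochner_Integration.integral_diff[OF i[of "(1 / real (Suc n)) *\<^sub>R b"] i[of 0]]
      by (simp add: lborel_integral_translate)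
    then show ?thesis by (simp add: \<phi>_def)
  qed
  ultimately show ?thesis by (simp add: LIMSEQ_const_iff)
qed

text \<open>Integration by parts: with \<open>e\<close> the character at \<open>y\<close>, the
  integral of the derivative of \<open>f * e\<close> vanishes, and the Leibniz rule splits it into
  the two sides of the identity.\<close>

lemma fourier_partial_deriv:
  fixes f :: "'a::euclidean_space \<Rightarrow> complex"
  assumes f: "f \<in> schwartz" and b: "b \<in> Basis"
  shows "fourier (partial_deriv b f) y = 2 * pi * \<i> * of_real (y \<bullet> b) * fourier f y"
proof -
  define e where "e x = cis (- 2 * pi * (y \<bullet> x))" for x
  have e: "e \<in> slow" unfolding e_def[abs_def] by (rule slow_cis)
  have de: "partial_deriv b e x = - 2 * pi * \<i> * of_real (y \<bullet> b) * e x" for x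
  proof -
    have "((\<lambda>x. exp (\<i> * complex_of_real (- 2 * pi * (y \<bullet> x)))) has_derivative
        (\<lambda>u. exp (\<i> * complex_of_real (- 2 * pi * (y \<bullet> x))) * (\<i> * complex_of_real (- 2 * pi * (y \<bullet> u))))) (at x)" for x
      by (rule has_derivative_compose[OF _ DERIV_exp[unfolded has_field_derivative_def]])
        (auto intro!: derivative_eq_intros)
    from partial_deriv_eq[OF this] show ?thesis
      unfolding e_def cis_conv_exp by simp
  qed
  have fe: "(\<lambda>x. f x * e x) \<in> schwartz" by (intro schwartz_mult_slow f e)
  have i1: "integrable lborel (\<lambda>x. partial_deriv b f x * e x)"
    by (intro schwartz_integrable schwartz_mult_slow schwartz_partial_deriv f b e)
  have "partial_deriv b (\<lambda>x. f x * e x) = (\<lambda>x. f x * partial_deriv b e x + partial_deriv b f x * e x)"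
    by (intro partial_deriv_mult schwartz_differentiable slow_differentiable f e)
  also have "\<dots> = (\<lambda>x. (- 2 * pi * \<i> * of_real (y \<bullet> b)) * (f x * e x) + partial_deriv b f x * e x)"
    by (simp add: de mult_ac)
  finally have "0 = (\<integral>x. (- 2 * pi * \<i> * of_real (y \<bullet> b)) * (f x * e x) + partial_deriv b f x * e x \<partial>lborel)"
    using schwartz_integral_partial_deriv[OF fe b] by simp
  also have "\<dots> = (- 2 * pi * \<i> * of_real (y \<bullet> b)) * (\<integral>x. f x * e x \<partial>lborel) + (\<integral>x. partial_deriv b f x * e x \<partial>lborel)"
    using schwartz_integrable[OF fe] i1
    by (subst Bochner_Integration.integral_add) auto
  finally show ?thesis
    unfolding fourier_def e_def by (simp add: inner_commute[of y] mult.commute[of "cis _"] eq_neg_iff_add_eq_0 algebra_simps)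
qed

text \<open>Each power of \<open>norm y\<close> is traded for a derivative of \<open>f\<close>:
  \<open>norm y\<close> is at most the sum of the absolute coordinates, and multiplication by
  \<open>y \<bullet> b\<close> corresponds to \<open>partial_deriv b f\<close>. Hence the induction
  on \<open>k\<close> ranges over all Schwartz functions.\<close>

lemma fourier_rapid:
  fixes f :: "'a::euclidean_space \<Rightarrow> complex"
  assumes "f \<in> schwartz" shows "rapid (fourier f)"
proof -
  have "\<exists>C. \<forall>y. norm y ^ k * cmod (fourier f y) \<le> C" for k
    using assms
  proof (induction k arbitrary: f)
    case 0
    then show ?case using fourier_bound[of f] by auto
  next
    case (Suc k)
    have "\<forall>b\<in>Basis. \<exists>C. \<forall>y. norm y ^ k * cmod (fourier (partial_deriv b f) y) \<le> C"
      using Suc by (auto intro: schwartz_partial_deriv)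
    then obtain C where C: "\<And>b y. b \<in> Basis \<Longrightarrow> norm y ^ k * cmod (fourier (partial_deriv b f) y) \<le> C b"
      by metis
    have "norm y ^ Suc k * cmod (fourier f y) \<le> (\<Sum>b\<in>Basis. C b)" for y
    proof -
      have "norm y ^ Suc k * cmod (fourier f y) = norm y * (norm y ^ k * cmod (fourier f y))" by simp
      also have "\<dots> \<le> (\<Sum>b\<in>Basis. \<bar>y \<bullet> b\<bar>) * (norm y ^ k * cmod (fourier f y))"
        by (intro mult_right_mono norm_le_l1) auto
      also have "\<dots> = (\<Sum>b\<in>Basis. \<bar>y \<bullet> b\<bar> * (norm y ^ k * cmod (fourier f y)))"
        by (simp add: sum_distrib_right)
      also have "\<dots> \<le> (\<Sum>b\<in>Basis. C b)"
      proof (rule sum_mono)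
        fix b :: 'a assume b: "b \<in> Basis"
        \<comment> \<open>Inserting the factor \<open>2 * pi \<ge> 1\<close> loses a constant and
          makes the expression equal to the transform of the derivative.\<close>
        have "\<bar>y \<bullet> b\<bar> * (norm y ^ k * cmod (fourier f y)) \<le> (2 * pi) * (\<bar>y \<bullet> b\<bar> * (norm y ^ k * cmod (fourier f y)))"
          using mult_right_mono[of 1 "2 * pi" "\<bar>y \<bullet> b\<bar> * (norm y ^ k * cmod (fourier f y))"] pi_ge_two by simp
        also have "\<dots> = norm y ^ k * cmod (fourier (partial_deriv b f) y)"
          by (simp add: fourier_partial_deriv[OF Suc.prems b] norm_mult)
        finally show "\<bar>y \<bullet> b\<bar> * (norm y ^ k * cmod (fourier f y)) \<le> C b"
          using C[OF b, of y] by linarith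
      qed
      finally show ?thesis .
    qed
    then show ?case by blast
  qed
  then show ?thesis unfolding rapid_def bounded_iff by (auto simp: norm_power)
qed

text \<open>The image of \<open>schwartz\<close> under \<open>fourier\<close> is itself a family for
  the coinduction: differentiating a transform means transforming a linear function times the
  original, which is again Schwartz.\<close>

lemma fourier_schwartz:
  assumes "f \<in> schwartz" shows "fourier f \<in> (schwartz :: ('a::euclidean_space \<Rightarrow> complex) set)"
proof (rule schwartz_coinduct[where A="fourier ` schwartz"])
  show "g differentiable (at x)" if "g \<in> fourier ` schwartz" for g :: "'a \<Rightarrow> complex" and x
    using that differentiableI[OF fourier_has_derivative] by auto
  show "rapid g" if "g \<in> fourier ` schwartz" for g :: "'a \<Rightarrow> complex"
    using that fourier_rapid by auto
  show "partial_deriv b g \<in> fourier ` schwartz" if g: "g \<in> fourier ` schwartz" for g :: "'a \<Rightarrow> complex" and b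
  proof -
    obtain h where h: "h \<in> schwartz" "g = fourier h" using g by blast
    have "(\<lambda>x. - 2 * pi * \<i> * of_real (x \<bullet> b) * h x) \<in> schwartz"
      using schwartz_mult_slow[OF h(1) slow_linear[of "- 2 * pi * \<i>" b]] by (simp add: mult.commute)
    then show ?thesis using h fourier_partial_deriv_eq[OF h(1), of b] by simp
  qed
qed (use assms in blast)

subsection \<open>Fourier inversion\<close>

text \<open>Scaled by \<open>pi\<close> so that it is its own Fourier transform and has integral 1;
  the inversion formula then carries no constant.\<close>

definition gauss :: "'a::euclidean_space \<Rightarrow> real" where
  "gauss x = exp (- pi * (norm x)\<^sup>2)"

lemma gauss_measurable [measurable]: "gauss \<in> borel_measurable borel"
  unfolding gauss_def[abs_def] by measurable

lemma gauss_prod: "gauss x = (\<Prod>b\<in>Basis. exp (- pi * (x \<bullet> b)\<^sup>2))"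
proof -
  have "(norm x)\<^sup>2 = (\<Sum>b\<in>Basis. (x \<bullet> b)\<^sup>2)"
    unfolding power2_norm_eq_inner by (subst euclidean_inner) (simp add: power2_eq_square)
  then show ?thesis by (simp add: gauss_def exp_sum[symmetric] sum_distrib_left sum_negf)
qed

lemma lborel_integral_prod:
  fixes f :: "'a::euclidean_space \<Rightarrow> real \<Rightarrow> complex"
  assumes "\<And>b. b \<in> Basis \<Longrightarrow> integrable lborel (f b)"
  shows "integrable lborel (\<lambda>x. \<Prod>b\<in>Basis. f b (x \<bullet> b))"
    and "(\<integral>x. (\<Prod>b\<in>Basis. f b (x \<bullet> b)) \<partial>lborel) = (\<Prod>b\<in>Basis. \<integral>t. f b t \<partial>lborel)"
proof -
  interpret product_sigma_finite "\<lambda>_::'a. lborel :: real measure" ..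
  have [measurable]: "f b \<in> borel_measurable borel" if "b \<in> Basis" for b
    using assms[OF that] by simp
  have m: "(\<lambda>f. \<Sum>b\<in>Basis. f b *\<^sub>R b) \<in> (\<Pi>\<^sub>M b\<in>(Basis::'a set). lborel) \<rightarrow>\<^sub>M borel" by measurable
  have p: "(\<lambda>x::'a. \<Prod>b\<in>Basis. f b (x \<bullet> b)) \<in> borel_measurable borel" by measurable
  have eq: "(\<Prod>b\<in>(Basis::'a set). f b ((\<Sum>c\<in>Basis. x c *\<^sub>R c) \<bullet> b)) = (\<Prod>b\<in>Basis. f b (x b))" for x
    by (intro prod.cong) auto
  show "integrable lborel (\<lambda>x::'a. \<Prod>b\<in>Basis. f b (x \<bullet> b))"
    unfolding lborel_eq[where 'a='a] integrable_distr_eq[OF m p] eq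
    using assms by (intro product_integrable_prod) auto
  show "(\<integral>x. (\<Prod>b\<in>(Basis::'a set). f b (x \<bullet> b)) \<partial>lborel) = (\<Prod>b\<in>Basis. \<integral>t. f b t \<partial>lborel)"
    unfolding lborel_eq[where 'a='a] integral_distr[OF m p] eq
    using assms by (intro product_integral_prod) auto
qed

text \<open>Reduction to the characteristic function of the standard normal law by
  \<open>x \<mapsto> c * x\<close>. With \<open>c = sqrt (2 * pi)\<close> the exponent
  \<open>(c * x)\<^sup>2 / 2\<close> becomes \<open>pi * x\<^sup>2\<close>, and the Jacobian
  \<open>c\<close> cancels the normalisation of the density.\<close>

lemma gauss_char_real:
  "integrable lborel (\<lambda>x. cis (- 2 * pi * (x * u)) * of_real (exp (- pi * x\<^sup>2)))"
  "(\<integral>x. cis (- 2 * pi * (x * u)) * of_real (exp (- pi * x\<^sup>2)) \<partial>lborel) = of_real (exp (- pi * u\<^sup>2))"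
proof -
  define c where "c = sqrt (2 * pi)"
  have c: "c > 0" "c * c = 2 * pi" by (auto simp: c_def)
  let ?g = "\<lambda>x. complex_of_real (std_normal_density x) * iexp (- c * u * x)"
  have n: "std_normal_density (c * x) = exp (- pi * x\<^sup>2) / c" for x
    using c by (simp add: std_normal_density_def c_def[symmetric] power_mult_distrib power2_eq_square[of c])
  have g: "cis (- 2 * pi * (x * u)) * of_real (exp (- pi * x\<^sup>2)) = c *\<^sub>R ?g (0 + c * x)" for x
  proof -
    have "- c * u * (c * x) = - 2 * pi * (x * u)" using c(2) by (simp add: algebra_simps)
    then have "iexp (- c * u * (c * x)) = cis (- 2 * pi * (x * u))" by (simp only: cis_conv_exp)
    then show ?thesis using c(1) unfolding add_0 n by (simp only: scaleR_conv_of_real) simp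
  qed
  have i: "integrable lborel ?g"
    by (rule Bochner_Integration.integrable_bound[OF integrable_normal_density[of 1 0]]) (auto simp: norm_mult)
  show "integrable lborel (\<lambda>x. cis (- 2 * pi * (x * u)) * of_real (exp (- pi * x\<^sup>2)))"
    unfolding g using lborel_integrable_real_affine[OF i, of c 0] c by (intro integrable_scaleR_right) auto
  have "(\<integral>x. cis (- 2 * pi * (x * u)) * of_real (exp (- pi * x\<^sup>2)) \<partial>lborel) = (\<integral>x. ?g x \<partial>lborel)"
    unfolding g using lborel_integral_real_affine[of c ?g 0] c by (simp del: add_0)
  also have "\<dots> = char std_normal_distribution (- c * u)"
    unfolding char_def by (subst integral_density) (auto simp: normal_density_nonneg scaleR_conv_of_real)
  also have "\<dots> = of_real (exp (- pi * u\<^sup>2))"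
    unfolding char_std_normal_distribution using c(2) by (simp add: power_mult_distrib power2_eq_square[of c])
  finally show "(\<integral>x. cis (- 2 * pi * (x * u)) * of_real (exp (- pi * x\<^sup>2)) \<partial>lborel) = of_real (exp (- pi * u\<^sup>2))" .
qed

lemma cis_inner_prod: "cis (a * (x \<bullet> y)) = (\<Prod>b\<in>Basis. cis (a * ((x \<bullet> b) * (y \<bullet> b))))"
  by (subst euclidean_inner) (simp add: cis_conv_exp exp_sum[symmetric] sum_distrib_left)

lemma gauss_char:
  shows gauss_char_integrable: "integrable lborel (\<lambda>x::'a::euclidean_space. cis (- 2 * pi * (x \<bullet> y)) * of_real (gauss x))"
    and fourier_gauss: "fourier (\<lambda>x::'a. of_real (gauss x)) y = of_real (gauss y)"
proof -
  let ?f = "\<lambda>b t. cis (- 2 * pi * (t * (y \<bullet> b))) * complex_of_real (exp (- pi * t\<^sup>2))"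
  have eq: "cis (- 2 * pi * (x \<bullet> y)) * of_real (gauss x) = (\<Prod>b\<in>Basis. ?f b (x \<bullet> b))" for x :: 'a
    unfolding gauss_prod cis_inner_prod by (simp add: prod.distrib)
  show "integrable lborel (\<lambda>x::'a. cis (- 2 * pi * (x \<bullet> y)) * of_real (gauss x))"
    unfolding eq by (intro lborel_integral_prod gauss_char_real)
  show "fourier (\<lambda>x::'a. of_real (gauss x)) y = of_real (gauss y)"
    unfolding fourier_def eq by (subst lborel_integral_prod(2)) (simp_all only: gauss_char_real gauss_prod of_real_prod)
qed

lemma integrable_gauss: "integrable lborel (\<lambda>x::'a::euclidean_space. complex_of_real (gauss x))"
  using gauss_char_integrable[of "0::'a"] by simp

lemma integral_gauss: "(\<integral>x. complex_of_real (gauss (x::'a::euclidean_space)) \<partial>lborel) = 1"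
  using fourier_gauss[of "0::'a"] by (simp add: fourier_def gauss_def)

lemma cis_measurable [measurable (raw)]: "g \<in> borel_measurable M \<Longrightarrow> (\<lambda>x. cis (g x)) \<in> borel_measurable M"
  unfolding cis_conv_exp by measurable

lemma cnj_measurable [measurable (raw)]: "g \<in> borel_measurable M \<Longrightarrow> (\<lambda>x. cnj (g x)) \<in> borel_measurable M"
  by (rule measurable_compose[OF _ borel_measurable_continuous_onI]) (auto intro: continuous_intros)

lemma gauss_scaled_char:
  fixes u :: "'a::euclidean_space"
  assumes s: "s > 0"
  shows "s ^ DIM('a) *\<^sub>R (\<integral>x. cis (- 2 * pi * (x \<bullet> (s *\<^sub>R u))) * of_real (gauss (s *\<^sub>R x)) \<partial>lborel) = of_real (gauss u)"
proof -
  have "of_real (gauss u) = (\<integral>x. cis (- 2 * pi * (x \<bullet> u)) * of_real (gauss x) \<partial>lborel)"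
    using fourier_gauss[of u] by (simp add: fourier_def)
  also have "\<dots> = s ^ DIM('a) *\<^sub>R (\<integral>x. cis (- 2 * pi * ((s *\<^sub>R x) \<bullet> u)) * of_real (gauss (s *\<^sub>R x)) \<partial>lborel)"
    using s by (subst lborel_integral_scale[where c=s]) auto
  finally show ?thesis by simp
qed

text \<open>The factor \<open>gauss (s *\<^sub>R x)\<close> makes the double integral absolutely convergent; inversion is the
  limit \<open>s \<rightarrow> 0\<close>.\<close>

lemma fourier_gauss_mollified:
  fixes f :: "'a::euclidean_space \<Rightarrow> complex"
  assumes f: "f \<in> schwartz" and s: "s > 0"
  shows "(\<integral>x. cis (- 2 * pi * (x \<bullet> y)) * fourier f x * of_real (gauss (s *\<^sub>R x)) \<partial>lborel)
    = (\<integral>v. f (s *\<^sub>R v - y) * of_real (gauss v) \<partial>lborel)"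
proof -
  note [measurable] = schwartz_measurable[OF f]
  \<comment> \<open>The inner integral after the exchange of order. By scaling it is a Gaussian of
    width proportional to \<open>s\<close> and of total mass one.\<close>
  define K where "K u = (\<integral>x. cis (- 2 * pi * (x \<bullet> u)) * of_real (gauss (s *\<^sub>R x)) \<partial>lborel)" for u :: 'a
  have K: "s ^ DIM('a) *\<^sub>R K (s *\<^sub>R u) = of_real (gauss u)" for u
    unfolding K_def by (rule gauss_scaled_char[OF s])
  have K': "K u = (1 / s ^ DIM('a)) *\<^sub>R of_real (gauss (u /\<^sub>R s))" for u
    using arg_cong[OF K[of "u /\<^sub>R s"], of "scaleR (1 / s ^ DIM('a))"] s by simp
  have [measurable]: "K \<in> borel_measurable borel"
    unfolding K'[abs_def] by measurable
  define F where "F x z = cis (- 2 * pi * (x \<bullet> (z + y))) * (f z * of_real (gauss (s *\<^sub>R x)))" for x z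
  have ig: "integrable lborel (\<lambda>x::'a. complex_of_real (gauss (s *\<^sub>R x)))"
  proof -
    have "integrable lborel (\<lambda>x::'a. complex_of_real (gauss (0 + s *\<^sub>R x)))"
    proof -
      have "integrable (density (distr lborel borel (\<lambda>x. 0 + s *\<^sub>R x)) (\<lambda>_. ennreal (\<bar>s\<bar> ^ DIM('a)))) (\<lambda>x::'a. complex_of_real (gauss x))"
        using integrable_gauss lborel_affine[of s "0::'a"] s by simp
      then have "integrable (distr lborel borel (\<lambda>x. 0 + s *\<^sub>R x)) (\<lambda>x::'a. \<bar>s\<bar> ^ DIM('a) *\<^sub>R complex_of_real (gauss x))"
        by (subst (asm) integrable_density) auto
      then have "integrable lborel (\<lambda>x::'a. \<bar>s\<bar> ^ DIM('a) *\<^sub>R complex_of_real (gauss (0 + s *\<^sub>R x)))"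
        by (subst (asm) integrable_distr_eq) auto
      from integrable_scaleR_right[OF this, of "1 / \<bar>s\<bar> ^ DIM('a)"] show ?thesis using s by simp
    qed
    then show ?thesis by simp
  qed
  have int: "integrable (lborel \<Otimes>\<^sub>M lborel) (\<lambda>(x, z). F x z)"
  proof (rule integrable_pair_bound[OF _ _ ig schwartz_integrable[OF f]])
    show "(\<lambda>(x, z). F x z) \<in> borel_measurable (lborel \<Otimes>\<^sub>M lborel)"
      unfolding F_def by measurable
  qed (auto simp: F_def norm_mult lborel.sigma_finite_measure_axioms)
  have "(\<integral>x. cis (- 2 * pi * (x \<bullet> y)) * fourier f x * of_real (gauss (s *\<^sub>R x)) \<partial>lborel)
      = (\<integral>x. (\<integral>z. F x z \<partial>lborel) \<partial>lborel)"
  proof (intro Bochner_Integration.integral_cong refl)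
    fix x
    have F: "F x z = cis (- 2 * pi * (x \<bullet> y)) * of_real (gauss (s *\<^sub>R x)) * (cis (- 2 * pi * (z \<bullet> x)) * f z)" for z
    proof -
      have "cis (- 2 * pi * (x \<bullet> (z + y))) = cis (- 2 * pi * (x \<bullet> y)) * cis (- 2 * pi * (z \<bullet> x))"
        unfolding cis_mult by (simp add: inner_add_right inner_commute[of _ x] algebra_simps)
      then show ?thesis by (simp add: F_def mult_ac)
    qed
    show "cis (- 2 * pi * (x \<bullet> y)) * fourier f x * of_real (gauss (s *\<^sub>R x)) = (\<integral>z. F x z \<partial>lborel)"
      unfolding F fourier_def integral_mult_right_zero by (simp add: mult_ac)
  qed
  also have "\<dots> = (\<integral>z. (\<integral>x. F x z \<partial>lborel) \<partial>lborel)"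
    by (rule lborel_pair.Fubini_integral[symmetric, OF int])
  \<comment> \<open>\<open>f (z + y - y)\<close> is \<open>f z\<close> written as a function of
    \<open>z + y\<close>, so that translation invariance removes the shift from
    \<open>K\<close>.\<close>
  also have "\<dots> = (\<integral>z. f (z + y - y) * K (z + y) \<partial>lborel)"
  proof (intro Bochner_Integration.integral_cong refl)
    fix z
    have F: "F x z = f z * (cis (- 2 * pi * (x \<bullet> (z + y))) * of_real (gauss (s *\<^sub>R x)))" for x
      by (simp add: F_def mult_ac)
    show "(\<integral>x. F x z \<partial>lborel) = f (z + y - y) * K (z + y)"
      unfolding F K_def integral_mult_right_zero by simp
  qed
  also have "\<dots> = (\<integral>z. f (z - y) * K z \<partial>lborel)"
    by (rule lborel_integral_translate) measurable
  also have "\<dots> = \<bar>s\<bar> ^ DIM('a) *\<^sub>R (\<integral>v. f (s *\<^sub>R v - y) * K (s *\<^sub>R v) \<partial>lborel)"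
    using s by (intro lborel_integral_scale) auto
  also have "\<dots> = (\<integral>v. f (s *\<^sub>R v - y) * (s ^ DIM('a) *\<^sub>R K (s *\<^sub>R v)) \<partial>lborel)"
    using s by (simp flip: integral_scaleR_right)
  finally show ?thesis unfolding K .
qed

text \<open>Dominated convergence on both sides of the mollified identity along
  \<open>s n = 1 / real (Suc n)\<close>: the left side is dominated by
  \<open>cmod (fourier f)\<close>, the right side by a constant times \<open>gauss\<close>. On the
  right the argument of \<open>f\<close> tends to \<open>- y\<close>, hence the reflection.\<close>

theorem fourier_inversion:
  fixes f :: "'a::euclidean_space \<Rightarrow> complex"
  assumes f: "f \<in> schwartz"
  shows "fourier (fourier f) y = f (- y)"
proof -
  note [measurable] = schwartz_measurable[OF f] schwartz_measurable[OF fourier_schwartz[OF f]]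
  define s where "s n = 1 / real (Suc n)" for n
  have s: "s n > 0" for n by (simp add: s_def)
  have s0: "s \<longlonglongrightarrow> 0" unfolding s_def[abs_def] using LIMSEQ_inverse_real_of_nat by (simp add: inverse_eq_divide)
  have gl: "gauss x \<le> 1" for x :: 'a by (simp add: gauss_def)
  have gp: "gauss x \<ge> 0" for x :: 'a by (simp add: gauss_def)
  have lim1: "(\<lambda>n. \<integral>x. cis (- 2 * pi * (x \<bullet> y)) * fourier f x * of_real (gauss (s n *\<^sub>R x)) \<partial>lborel)
      \<longlonglongrightarrow> (\<integral>x. cis (- 2 * pi * (x \<bullet> y)) * fourier f x \<partial>lborel)"
  proof (rule integral_dominated_convergence[where w="\<lambda>x. cmod (fourier f x)"])
    show "AE x in lborel. (\<lambda>n. cis (- 2 * pi * (x \<bullet> y)) * fourier f x * of_real (gauss (s n *\<^sub>R x)))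
        \<longlonglongrightarrow> cis (- 2 * pi * (x \<bullet> y)) * fourier f x"
      unfolding gauss_def by (intro AE_I2) (auto intro!: tendsto_eq_intros s0)
    show "AE x in lborel. norm (cis (- 2 * pi * (x \<bullet> y)) * fourier f x * of_real (gauss (s n *\<^sub>R x))) \<le> cmod (fourier f x)" for n
      using gl gp by (auto simp: norm_mult mult_left_le)
  qed (auto intro!: integrable_norm schwartz_integrable fourier_schwartz f)
  obtain C where C: "\<And>x. cmod (f x) \<le> C"
    using schwartz_rapid[OF f] unfolding rapid_iff by (metis mult.right_neutral power_0)
  have f_lim: "(\<lambda>n. f (s n *\<^sub>R v - y)) \<longlonglongrightarrow> f (- y)" for v
  proof -
    have "(\<lambda>n. s n *\<^sub>R v - y) \<longlonglongrightarrow> - y" by (auto intro!: tendsto_eq_intros s0)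
    moreover have "isCont f (- y)"
      by (rule differentiable_imp_continuous_within) (rule schwartz_differentiable[OF f])
    ultimately show ?thesis by (rule isCont_tendsto_compose[rotated])
  qed
  have lim2: "(\<lambda>n. \<integral>v. f (s n *\<^sub>R v - y) * of_real (gauss v) \<partial>lborel)
      \<longlonglongrightarrow> (\<integral>v. f (- y) * of_real (gauss (v::'a)) \<partial>lborel)"
  proof (rule integral_dominated_convergence[where w="\<lambda>v::'a. C * gauss v"])
    show "integrable lborel (\<lambda>v::'a. C * gauss v)"
      using integrable_gauss integrable_norm[OF integrable_gauss[where 'a='a]] gp by simp
    show "AE v in lborel. (\<lambda>n. f (s n *\<^sub>R v - y) * of_real (gauss v)) \<longlonglongrightarrow> f (- y) * of_real (gauss v)"
      by (intro AE_I2 tendsto_mult f_lim tendsto_const)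
    show "AE v in lborel. norm (f (s n *\<^sub>R v - y) * of_real (gauss v)) \<le> C * gauss v" for n
      using C gp by (auto simp: norm_mult intro!: mult_right_mono)
  qed auto
  have "(\<integral>x. cis (- 2 * pi * (x \<bullet> y)) * fourier f x \<partial>lborel) = (\<integral>v. f (- y) * of_real (gauss (v::'a)) \<partial>lborel)"
    using lim1 lim2 unfolding fourier_gauss_mollified[OF f s] by (rule LIMSEQ_unique)
  then show ?thesis
    unfolding fourier_def[of "fourier f"] integral_mult_right_zero integral_gauss by simp
qed

text \<open>Inversion read as surjectivity: the reflected transform is a preimage of
  \<open>f\<close>. It turns density of Schwartz functions into density of their transforms.\<close>

lemma fourier_surj:
  assumes "f \<in> schwartz"
  shows "fourier (\<lambda>x. fourier f (- x)) = (f :: 'a::euclidean_space \<Rightarrow> complex)"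
proof
  fix y
  note [measurable] = schwartz_measurable[OF fourier_schwartz[OF assms]]
  have "fourier (\<lambda>x. fourier f (- x)) y = (\<integral>x. cis (- 2 * pi * ((- x) \<bullet> (- y))) * fourier f (- x) \<partial>lborel)"
    by (simp add: fourier_def)
  also have "\<dots> = fourier (fourier f) (- y)"
    unfolding fourier_def[of "fourier f"] by (rule lborel_integral_reflect) measurable
  finally show "fourier (\<lambda>x. fourier f (- x)) y = f y" using fourier_inversion[OF assms, of "- y"] by simp
qed

text \<open>Expanding \<open>fourier g\<close> as an integral over \<open>z\<close> and exchanging
  the order leaves an integral over \<open>x\<close> that is, up to conjugation, a double transform
  of \<open>h\<close>; inversion evaluates it.\<close>

lemma fourier_mult_cnj:
  fixes g h :: "'a::euclidean_space \<Rightarrow> complex"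
  assumes g: "g \<in> schwartz" and h: "h \<in> schwartz"
  shows "fourier (\<lambda>x. U_rep t (fourier g) x * cnj (fourier h x)) y = conv g (tilde h) (- t - y)"
proof -
  note [measurable] = schwartz_measurable[OF g] schwartz_measurable[OF fourier_schwartz[OF h]]
  define F where "F x z = cis (- 2 * pi * (x \<bullet> (y + t + z))) * (g z * cnj (fourier h x))" for x z
  have int: "integrable (lborel \<Otimes>\<^sub>M lborel) (\<lambda>(x, z). F x z)"
  proof (rule integrable_pair_bound[OF _ _ schwartz_integrable[OF fourier_schwartz[OF h]] schwartz_integrable[OF g]])
    show "(\<lambda>(x, z). F x z) \<in> borel_measurable (lborel \<Otimes>\<^sub>M lborel)"
      unfolding F_def by measurable
  qed (auto simp: F_def norm_mult lborel.sigma_finite_measure_axioms)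
  have "fourier (\<lambda>x. U_rep t (fourier g) x * cnj (fourier h x)) y = (\<integral>x. (\<integral>z. F x z \<partial>lborel) \<partial>lborel)"
    unfolding fourier_def[of "\<lambda>x. U_rep t (fourier g) x * cnj (fourier h x)"]
  proof (intro Bochner_Integration.integral_cong refl)
    fix x
    have F: "F x z = cis (- 2 * pi * (x \<bullet> y)) * cis (- 2 * pi * (t \<bullet> x)) * cnj (fourier h x) * (cis (- 2 * pi * (z \<bullet> x)) * g z)" for z
    proof -
      have "cis (- 2 * pi * (x \<bullet> (y + t + z))) = cis (- 2 * pi * (x \<bullet> y)) * cis (- 2 * pi * (t \<bullet> x)) * cis (- 2 * pi * (z \<bullet> x))"
        unfolding cis_mult by (simp add: inner_add_right inner_commute[of _ x] algebra_simps)
      then show ?thesis by (simp add: F_def mult_ac)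
    qed
    show "cis (- 2 * pi * (x \<bullet> y)) * (U_rep t (fourier g) x * cnj (fourier h x)) = (\<integral>z. F x z \<partial>lborel)"
      unfolding F U_rep_def fourier_def[of g] integral_mult_right_zero by (simp add: mult_ac)
  qed
  also have "\<dots> = (\<integral>z. (\<integral>x. F x z \<partial>lborel) \<partial>lborel)"
    by (rule lborel_pair.Fubini_integral[symmetric, OF int])
  also have "\<dots> = (\<integral>z. g z * cnj (h (y + t + z)) \<partial>lborel)"
  proof (intro Bochner_Integration.integral_cong refl)
    fix z
    have F: "F x z = g z * cnj (cis (- 2 * pi * (x \<bullet> (- (y + t + z)))) * fourier h x)" for x
      unfolding F_def by (simp add: cis_cnj inner_minus_right del: minus_add_distrib)
    have "(\<integral>x. F x z \<partial>lborel) = g z * cnj (fourier (fourier h) (- (y + t + z)))"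
      unfolding F integral_mult_right_zero
      by (subst Bochner_Integration.integral_cnj) (simp only: fourier_def[of "fourier h"])
    then show "(\<integral>x. F x z \<partial>lborel) = g z * cnj (h (y + t + z))"
      unfolding fourier_inversion[OF h] minus_minus .
  qed
  also have "\<dots> = conv g (tilde h) (- t - y)"
    unfolding conv_def tilde_def
    by (intro Bochner_Integration.integral_cong refl) (simp add: algebra_simps)
  finally show ?thesis .
qed

subsection \<open>Radon measures and compactly supported functions\<close>

lemma Cc_iff: "f \<in> Cc \<longleftrightarrow> continuous_on UNIV f \<and> (\<exists>r. \<forall>x. f x \<noteq> 0 \<longrightarrow> norm x \<le> r)"
  unfolding Cc_def by (auto simp: compact_closure bounded_iff)

lemma Cc_measurable: "f \<in> Cc \<Longrightarrow> f \<in> borel_measurable borel"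
  by (auto simp: Cc_iff intro: borel_measurable_continuous_onI)

lemma Cc_bounded:
  assumes "f \<in> Cc" obtains B where "\<And>x. cmod (f x) \<le> B"
proof -
  obtain r where c: "continuous_on UNIV f" and r: "\<And>x. f x \<noteq> 0 \<Longrightarrow> norm x \<le> r"
    using assms by (auto simp: Cc_iff)
  have "bounded (f ` cball 0 r)"
    by (intro compact_imp_bounded compact_continuous_image continuous_on_subset[OF c]) auto
  then obtain B where B: "\<forall>x\<in>cball 0 r. cmod (f x) \<le> B" unfolding bounded_iff by blast
  have "cmod (f x) \<le> max B 0" for x using B r[of x] by (cases "f x = 0") (auto simp: le_max_iff_disj)
  then show ?thesis using that by blast
qed

lemma radon_finite: "radon m \<Longrightarrow> bounded A \<Longrightarrow> emeasure m A < \<infinity>"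
proof -
  assume m: "radon m" and A: "bounded A"
  have "emeasure m A \<le> emeasure m (closure A)"
    using m by (intro emeasure_mono) (auto simp: radon_def closure_subset)
  also have "\<dots> < \<infinity>" using m A by (auto simp: radon_def compact_closure)
  finally show ?thesis .
qed

lemma radon_sets: "radon m \<Longrightarrow> sets m = sets borel"
  by (simp add: radon_def)

lemma radon_space: "radon m \<Longrightarrow> space m = UNIV"
  using sets_eq_imp_space_eq[OF radon_sets] by simp

lemma radon_measurable: "radon m \<Longrightarrow> f \<in> borel_measurable borel \<Longrightarrow> f \<in> borel_measurable m"
  using measurable_cong_sets[OF radon_sets refl] by blast

lemma radon_sigma_finite: "radon m \<Longrightarrow> sigma_finite_measure m"
proof
  assume m: "radon m"
  show "\<exists>A. countable A \<and> A \<subseteq> sets m \<and> \<Union> A = space m \<and> (\<forall>a\<in>A. emeasure m a \<noteq> \<infinity>)"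
  proof (intro exI conjI)
    show "countable (range (\<lambda>n::nat. cball (0::'a) (real n)))" by simp
    show "range (\<lambda>n::nat. cball 0 (real n)) \<subseteq> sets m"
      unfolding radon_sets[OF m] by (intro image_subsetI borel_closed closed_cball)
    show "\<Union> (range (\<lambda>n::nat. cball 0 (real n))) = space m"
    proof -
      have "\<exists>n::nat. x \<in> cball 0 (real n)" for x :: 'a
        using real_arch_simple[of "norm x"] by simp
      then show ?thesis unfolding radon_space[OF m] by blast
    qed
    show "\<forall>a\<in>range (\<lambda>n::nat. cball 0 (real n)). emeasure m a \<noteq> \<infinity>"
    proof
      fix a :: "'a set" assume "a \<in> range (\<lambda>n::nat. cball 0 (real n))"
      then obtain n :: nat where "a = cball 0 (real n)" by blast
      then show "emeasure m a \<noteq> \<infinity>" using radon_finite[OF m bounded_cball, of 0 "real n"] by simp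
    qed
  qed
qed

lemma Cc_integrable:
  assumes m: "radon m" and f: "f \<in> Cc" shows "integrable m f"
proof -
  obtain r where r: "\<And>x. f x \<noteq> 0 \<Longrightarrow> norm x \<le> r" using f by (auto simp: Cc_iff)
  obtain B where B: "\<And>x. cmod (f x) \<le> B" using Cc_bounded[OF f] by blast
  have "integrable m (\<lambda>x. B * indicator (cball 0 r) x)"
    using radon_finite[OF m, of "cball 0 r"] radon_sets[OF m]
    by (intro integrable_mult_right integrable_real_indicator) auto
  then show ?thesis
  proof (rule Bochner_Integration.integrable_bound)
    show "f \<in> borel_measurable m" by (intro radon_measurable[OF m] Cc_measurable f)
    have "cmod (f x) \<le> norm (B * indicator (cball 0 r) x)" for x
      using r[of x] B[of x] by (cases "f x = 0") (auto simp: indicator_def)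
    then show "AE x in m. norm (f x) \<le> norm (B * indicator (cball 0 r) x)" by simp
  qed
qed

lemma nn_integral_Cc:
  fixes f :: "'a::euclidean_space \<Rightarrow> real"
  assumes m: "radon m" and f: "(\<lambda>x. complex_of_real (f x)) \<in> Cc" "\<And>x. 0 \<le> f x"
  shows "(\<integral>\<^sup>+x. f x \<partial>m) = ennreal (Re (counting (\<lambda>x. of_real (f x)) m))"
proof -
  have "integrable m (\<lambda>x. Re (complex_of_real (f x)))"
    by (intro integrable_Re Cc_integrable m f)
  then have "integrable m f" by simp
  then show ?thesis
    using f(2) by (simp add: counting_def nn_integral_eq_integral)
qed

text \<open>One factor grows to 1 inside \<open>U\<close> with the distance from the complement, the
  other cuts off at radius \<open>n\<close>; both increase with \<open>n\<close>.\<close>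

lemma cutoff_Cc:
  fixes U :: "'a::euclidean_space set"
  assumes U: "open U"
  obtains f :: "nat \<Rightarrow> 'a \<Rightarrow> real" where
    "\<And>n. (\<lambda>x. complex_of_real (f n x)) \<in> Cc" "\<And>n x. 0 \<le> f n x"
    "incseq f" "\<And>x. (SUP n. ennreal (f n x)) = indicator U x"
proof
  \<comment> \<open>\<open>infdist\<close> to the empty set is 0 by convention, so the whole space
    gets a value of its own.\<close>
  define d where "d x = (if U = UNIV then 1 else infdist x (- U))" for x
  define f where "f n x = min 1 (real n * d x) * max 0 (min 1 (real n - norm x))" for n x
  have dc: "continuous_on UNIV d"
    unfolding d_def[abs_def] by (cases "U = UNIV") (auto intro!: continuous_intros)
  have d0: "0 \<le> d x" for x by (simp add: d_def infdist_nonneg)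
  show f0: "0 \<le> f n x" for n x using d0[of x] by (auto simp: f_def)
  have fmono: "f m x \<le> f n x" if "m \<le> n" for m n x
    unfolding f_def using that d0[of x]
    by (intro mult_mono min.mono max.mono) (auto intro: mult_right_mono)
  then show "incseq f" by (auto simp: incseq_def le_fun_def)
  show "(\<lambda>x. complex_of_real (f n x)) \<in> Cc" for n
  proof -
    have "continuous_on UNIV (\<lambda>x. complex_of_real (f n x))"
      unfolding f_def by (intro continuous_intros dc)
    moreover have "f n x \<noteq> 0 \<longrightarrow> norm x \<le> real n" for x by (auto simp: f_def)
    ultimately show ?thesis unfolding Cc_iff by auto
  qed
  show "(SUP n. ennreal (f n x)) = indicator U x" for x
  proof (cases "x \<in> U")
    case True
    have "d x > 0"
    proof (cases "U = UNIV")
      case False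
      then have "infdist x (- U) \<noteq> 0"
        using True U by (subst in_closed_iff_infdist_zero[symmetric]) auto
      then show ?thesis using False infdist_nonneg[of x "- U"] by (simp add: d_def)
    qed (simp add: d_def)
    then obtain k where k: "real k * d x \<ge> 1"
      using reals_Archimedean3[of "d x"] less_imp_le by blast
    obtain j where j: "real j \<ge> norm x + 1" using real_arch_simple by blast
    have "real (max k j) * d x \<ge> real k * d x" using d0[of x] by (intro mult_right_mono) auto
    then have 1: "f (max k j) x = 1" unfolding f_def using k j by auto
    have "f n x \<le> 1" for n unfolding f_def using d0[of x] by (intro mult_le_one) auto
    then have "(SUP n. ennreal (f n x)) \<le> 1" by (intro SUP_least) (simp add: ennreal_le_1)
    moreover have "ennreal (f (max k j) x) \<le> (SUP n. ennreal (f n x))" by (intro SUP_upper) auto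
    ultimately have "(SUP n. ennreal (f n x)) = 1" unfolding 1 by (intro antisym) simp_all
    then show ?thesis using True by simp
  next
    case False
    then have "d x = 0" by (auto simp: d_def)
    then show ?thesis using False by (simp add: f_def)
  qed
qed

text \<open>Monotone convergence along the cutoffs. The right-hand side sees the measure only
  through integrals of functions in \<open>Cc\<close>, which yields uniqueness of Radon measures as
  well as semicontinuity of masses of open sets.\<close>

lemma radon_emeasure_open_SUP:
  fixes f :: "nat \<Rightarrow> 'a::euclidean_space \<Rightarrow> real"
  assumes m: "radon m" and f: "\<And>n. (\<lambda>x. complex_of_real (f n x)) \<in> Cc" "\<And>n x. 0 \<le> f n x"
    "incseq f" "\<And>x. (SUP n. ennreal (f n x)) = indicator U x" and U: "open U"
  shows "emeasure m U = (SUP n. ennreal (Re (counting (\<lambda>x. of_real (f n x)) m)))"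
proof -
  have "f n \<in> borel_measurable m" for n
    using Cc_measurable[OF f(1), of n] by (intro radon_measurable[OF m]) (simp add: borel_measurable_complex_iff)
  then have "(SUP n. \<integral>\<^sup>+x. f n x \<partial>m) = (\<integral>\<^sup>+x. (SUP n. ennreal (f n x)) \<partial>m)"
    using f(3) by (intro nn_integral_monotone_convergence_SUP[symmetric])
      (auto simp: incseq_def le_fun_def intro: ennreal_leI)
  also have "\<dots> = emeasure m U" unfolding f(4) using radon_sets[OF m] U by simp
  finally show ?thesis by (simp add: nn_integral_Cc[OF m f(1,2)])
qed

text \<open>Open sets form an intersection-stable generator, and their masses are determined by
  \<open>Cc\<close>. This is the uniqueness behind the definite description in
  \<open>first_moment\<close>.\<close>

lemma radon_eqI:
  assumes m: "radon m" and n: "radon n" and eq: "\<And>f. f \<in> Cc \<Longrightarrow> counting f m = counting f n"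
  shows "m = n"
proof (rule measure_eqI_generator_eq[where E="Collect open" and \<Omega>=UNIV and A="\<lambda>i. ball 0 (real i)"])
  show "Int_stable (Collect open)" by (auto simp: Int_stable_def)
  show "emeasure m U = emeasure n U" if "U \<in> Collect open" for U
  proof -
    have U: "open U" using that by simp
    obtain f where "\<And>n. (\<lambda>x. complex_of_real (f n x)) \<in> Cc" "\<And>n x. 0 \<le> f n x"
      "incseq f" "\<And>x. (SUP n. ennreal (f n x)) = indicator U x"
      using cutoff_Cc[OF U] by metis
    note f = this
    show ?thesis
      unfolding radon_emeasure_open_SUP[OF m f U] radon_emeasure_open_SUP[OF n f U] eq[OF f(1)] ..
  qed
  show "sets m = sigma_sets UNIV (Collect open)" "sets n = sigma_sets UNIV (Collect open)"
    using radon_sets[OF m] radon_sets[OF n] by (simp_all add: borel_def)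
  show "(\<Union>i. ball 0 (real i)) = (UNIV :: 'a set)"
    using reals_Archimedean2 by auto
  show "emeasure m (ball 0 (real i)) \<noteq> \<infinity>" for i
    using radon_finite[OF m, of "ball 0 (real i)"] by auto
qed auto

subsection \<open>The vague topology\<close>

lemma Cc_0: "(\<lambda>x. 0) \<in> Cc" by (auto simp: Cc_iff)

lemma vague_subbase_open:
  "f \<in> Cc \<Longrightarrow> open U \<Longrightarrow> openin vague_topology {\<Lambda> \<in> point_measures. counting f \<Lambda> \<in> U}"
  unfolding vague_topology_def by (intro topology_generated_by_Basis) blast

lemma topspace_vague [simp]: "topspace vague_topology = point_measures"
proof
  show "topspace vague_topology \<subseteq> point_measures"
    unfolding vague_topology_def topology_generated_by_topspace by auto
  show "point_measures \<subseteq> topspace vague_topology"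
    using openin_subset[OF vague_subbase_open[OF Cc_0 open_UNIV]] by auto
qed

lemma point_measures_radon: "\<Lambda> \<in> point_measures \<Longrightarrow> radon \<Lambda>"
  by (simp add: point_measures_def)

text \<open>The mass of an open set is a supremum of vaguely continuous functionals, so the
  condition defines a union of subbasic open sets.\<close>

lemma vague_emeasure_lower:
  fixes U :: "'a::euclidean_space set"
  assumes U: "open U"
  shows "openin vague_topology {\<Lambda> \<in> point_measures. c < emeasure \<Lambda> U}"
proof -
  obtain f where f: "\<And>n. (\<lambda>x. complex_of_real (f n x)) \<in> Cc" "\<And>n x. 0 \<le> f n x"
    "incseq f" "\<And>x. (SUP n. ennreal (f n x)) = indicator U x"
    using cutoff_Cc[OF U] by metis
  have "{\<Lambda> \<in> point_measures. c < emeasure \<Lambda> U} =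
      (\<Union>n. {\<Lambda> \<in> point_measures. counting (\<lambda>x. of_real (f n x)) \<Lambda> \<in> {z. c < ennreal (Re z)}})"
    using radon_emeasure_open_SUP[OF point_measures_radon f U] by (auto simp: less_SUP_iff)
  also have "openin vague_topology \<dots>"
  proof (intro openin_Union ballI, clarify, intro vague_subbase_open f)
    have "open ((\<lambda>z. ennreal (Re z)) -` {c<..})"
      by (intro open_vimage continuous_on_ennreal continuous_intros open_greaterThan)
    then show "open {z. c < ennreal (Re z)}" by (simp add: vimage_def)
  qed
  finally show ?thesis .
qed

lemma translate_space_sets [simp]: "sets (translate t \<Lambda>) = sets borel" "space (translate t \<Lambda>) = UNIV"
  by (simp_all add: translate_def)

lemma radon_plus_measurable: "radon \<Lambda> \<Longrightarrow> (+) t \<in> \<Lambda> \<rightarrow>\<^sub>M borel"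
  by (rule radon_measurable) (auto intro: borel_measurable_continuous_onI continuous_intros)

lemma emeasure_translate:
  assumes "radon \<Lambda>" "A \<in> sets borel"
  shows "emeasure (translate t \<Lambda>) A = emeasure \<Lambda> ((+) (- t) ` A)"
proof -
  have "(+) t -` A = (+) (- t) ` A"
    by (force simp: image_iff)
  then show ?thesis
    unfolding translate_def using assms
    by (subst emeasure_distr) (auto intro: radon_plus_measurable simp: radon_space)
qed

lemma nn_integral_translate:
  assumes "radon \<Lambda>" "f \<in> borel_measurable borel"
  shows "(\<integral>\<^sup>+x. f x \<partial>translate t \<Lambda>) = (\<integral>\<^sup>+x. f (t + x) \<partial>\<Lambda>)"
  unfolding translate_def using assms by (intro nn_integral_distr radon_plus_measurable) auto

lemma counting_translate:
  assumes "radon \<Lambda>" "f \<in> borel_measurable borel"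
  shows "counting f (translate t \<Lambda>) = counting (\<lambda>x. f (t + x)) \<Lambda>"
  unfolding translate_def counting_def using assms by (intro integral_distr radon_plus_measurable) auto

lemma sets_borel_translate_image: "A \<in> sets borel \<Longrightarrow> (+) (t::'a::euclidean_space) ` A \<in> sets borel"
proof -
  assume A: "A \<in> sets borel"
  have "(+) t ` A = (+) (- t) -` A \<inter> space borel"
    by (force simp: image_iff)
  then show ?thesis using A measurable_sets[of "(+) (- t)" borel borel A] by simp
qed

lemma translate_point_measures:
  assumes "\<Lambda> \<in> point_measures" shows "translate t \<Lambda> \<in> point_measures"
proof -
  have r: "radon \<Lambda>" using assms by (rule point_measures_radon)
  have "emeasure (translate t \<Lambda>) K < \<infinity>" if "compact K" for K
    unfolding emeasure_translate[OF r borel_compact[OF that]]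
    by (intro radon_finite[OF r] bounded_translation compact_imp_bounded that)
  moreover have "emeasure (translate t \<Lambda>) A \<in> \<nat>" if "A \<in> sets borel" "compact (closure A)" for A
  proof -
    have "compact (closure ((+) (- t) ` A))"
      using that(2) unfolding compact_closure by (rule bounded_translation)
    then show ?thesis
      using assms sets_borel_translate_image[OF that(1), of "- t"]
      unfolding emeasure_translate[OF r that(1)] point_measures_def mem_Collect_eq by blast
  qed
  ultimately show ?thesis unfolding point_measures_def radon_def by simp
qed

lemma translate_translate:
  assumes "radon \<Lambda>" shows "translate s (translate t \<Lambda>) = translate (s + t) \<Lambda>"
  unfolding translate_def using assms
  by (subst distr_distr) (auto intro: radon_plus_measurable simp: comp_def add.assoc intro!: arg_cong[where f="distr \<Lambda> borel"])

lemma translate_0: "radon \<Lambda> \<Longrightarrow> translate 0 \<Lambda> = \<Lambda>"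
  by (intro measure_eqI) (auto simp: emeasure_translate radon_sets)

lemma Cc_translate:
  assumes "f \<in> Cc" shows "(\<lambda>x. f (t + x)) \<in> Cc"
proof -
  obtain r where c: "continuous_on UNIV f" and r: "\<And>x. f x \<noteq> 0 \<Longrightarrow> norm x \<le> r"
    using assms by (auto simp: Cc_iff)
  have "continuous_on UNIV (\<lambda>x. f (t + x))"
    by (rule continuous_on_compose2[OF c]) (auto intro!: continuous_intros)
  moreover have "norm x \<le> r + norm t" if "f (t + x) \<noteq> 0" for x
    using r[OF that] norm_triangle_ineq4[of "t + x" t] by simp
  ultimately show ?thesis unfolding Cc_iff by blast
qed

lemma Cc_uniformly_continuous:
  assumes "f \<in> Cc" "0 < e"
  obtains d where "0 < d" "d \<le> 1" "\<And>u v. dist u v < d \<Longrightarrow> cmod (f u - f v) < e"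
proof -
  obtain r where c: "continuous_on UNIV f" and r: "\<And>x. f x \<noteq> 0 \<Longrightarrow> norm x \<le> r"
    using assms by (auto simp: Cc_iff)
  have "uniformly_continuous_on (cball 0 (r + 1)) f"
    by (intro compact_uniformly_continuous continuous_on_subset[OF c]) auto
  then obtain d where d: "d > 0" "\<And>u v. u \<in> cball 0 (r + 1) \<Longrightarrow> v \<in> cball 0 (r + 1) \<Longrightarrow> dist v u < d \<Longrightarrow> dist (f v) (f u) < e"
    using assms(2) unfolding uniformly_continuous_on_def by metis
  \<comment> \<open>Distances are kept below 1 so that, as soon as one point lies in the ball
    carrying \<open>f\<close>, both lie in the compact ball of radius \<open>r + 1\<close> where
    uniform continuity is known.\<close>
  have "cmod (f u - f v) < e" if uv: "dist u v < min d 1" for u v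
  proof (cases "norm u \<le> r \<or> norm v \<le> r")
    case True
    have "norm u \<le> norm v + dist u v" "norm v \<le> norm u + dist u v"
      using norm_triangle_ineq2[of u v] norm_triangle_ineq2[of v u] by (auto simp: dist_norm norm_minus_commute)
    then have "u \<in> cball 0 (r + 1)" "v \<in> cball 0 (r + 1)" using True uv by auto
    from d(2)[OF this(2,1)] uv show ?thesis by (simp add: dist_norm)
  next
    case False
    then have "f u = 0" "f v = 0" using r by blast+
    then show ?thesis using assms(2) by simp
  qed
  then show ?thesis using that[of "min d 1"] d(1) by simp
qed

text \<open>Both configuration and translation vector vary: the vague topology sees a perturbation of
  the translation vector only through a uniformly small change of the test function on a fixed ball.\<close>

lemma continuous_map_translate:
  "continuous_map (prod_topology euclidean vague_topology) vague_topology
     (\<lambda>(t::'a::euclidean_space, \<Lambda>). translate t \<Lambda>)"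
  unfolding vague_topology_def
proof (rule continuous_on_generated_topo, fold vague_topology_def)
  let ?T = "prod_topology euclidean (vague_topology :: 'a measure topology)"
  show "(\<lambda>(t, \<Lambda>). translate t \<Lambda>) ` topspace ?T
      \<subseteq> \<Union> {{\<Lambda> \<in> point_measures. counting f \<Lambda> \<in> U} |f U. f \<in> Cc \<and> open U}"
    using translate_point_measures topspace_vague
    unfolding vague_topology_def topology_generated_by_topspace by auto
  fix S assume "S \<in> {{\<Lambda> \<in> point_measures. counting f \<Lambda> \<in> U} |f U. f \<in> (Cc :: ('a \<Rightarrow> complex) set) \<and> open U}"
  then obtain f :: "'a \<Rightarrow> complex" and U where f: "f \<in> Cc" and U: "open U"
    and S: "S = {\<Lambda> \<in> point_measures. counting f \<Lambda> \<in> U}" by blast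
  have "(\<lambda>(t, \<Lambda>). translate t \<Lambda>) -` S \<inter> topspace ?T
      = {(t, \<Lambda>). \<Lambda> \<in> point_measures \<and> counting (\<lambda>x. f (t + x)) \<Lambda> \<in> U}"
    using translate_point_measures counting_translate[OF point_measures_radon Cc_measurable[OF f]]
    unfolding S by auto
  also have "openin ?T \<dots>"
    unfolding openin_prod_topology_alt
  proof (intro allI impI)
    fix t \<Lambda> assume "(t, \<Lambda>) \<in> {(t, \<Lambda>). \<Lambda> \<in> point_measures \<and> counting (\<lambda>x. f (t + x)) \<Lambda> \<in> U}"
    then have L: "\<Lambda> \<in> point_measures" and z: "counting (\<lambda>x. f (t + x)) \<Lambda> \<in> U" by auto
    let ?z = "counting (\<lambda>x. f (t + x)) \<Lambda>"
    obtain e where e: "e > 0" "ball ?z e \<subseteq> U" using U z open_contains_ball by blast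
    obtain r where r: "\<And>x. f x \<noteq> 0 \<Longrightarrow> norm x \<le> r" using f by (auto simp: Cc_iff)
    \<comment> \<open>\<open>\<phi>\<close> equals 1 wherever \<open>f (s + x)\<close> can be
      nonzero for some \<open>s\<close> within distance 1 of \<open>t\<close>; its integral bounds
      the mass affected by a perturbation of \<open>t\<close>.\<close>
    define \<phi> where "\<phi> x = max 0 (min 1 (r + norm t + 2 - norm x))" for x :: 'a
    have \<phi>: "(\<lambda>x. complex_of_real (\<phi> x)) \<in> Cc"
    proof -
      have "continuous_on UNIV (\<lambda>x. complex_of_real (\<phi> x))"
        unfolding \<phi>_def by (intro continuous_intros)
      moreover have "complex_of_real (\<phi> x) \<noteq> 0 \<longrightarrow> norm x \<le> r + norm t + 2" for x by (auto simp: \<phi>_def)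
      ultimately show ?thesis unfolding Cc_iff by blast
    qed
    have \<phi>0: "0 \<le> \<phi> x" for x by (simp add: \<phi>_def)
    have \<phi>1: "\<phi> x = 1" if "norm x \<le> r + norm t + 1" for x using that by (auto simp: \<phi>_def)
    \<comment> \<open>The added 1 makes the bound on the integral of \<open>\<phi>\<close> strict,
      so that it persists on a neighbourhood of \<open>\<Lambda>\<close>, and keeps
      \<open>e / (2 * M)\<close> positive.\<close>
    define M where "M = \<bar>Re (counting (\<lambda>x. of_real (\<phi> x)) \<Lambda>)\<bar> + 1"
    have M: "M > 0" by (simp add: M_def)
    obtain d where d: "0 < d" "d \<le> 1" "\<And>u v. dist u v < d \<Longrightarrow> cmod (f u - f v) < e / (2 * M)"
      using Cc_uniformly_continuous[OF f, of "e / (2 * M)"] e(1) M by auto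
    define V where "V = {\<Lambda> \<in> point_measures. counting (\<lambda>x. of_real (\<phi> x)) \<Lambda> \<in> {z. Re z < M}} \<inter>
      {\<Lambda> \<in> point_measures. counting (\<lambda>x. f (t + x)) \<Lambda> \<in> ball ?z (e / 2)}"
    have "openin vague_topology V"
      unfolding V_def by (intro openin_Int vague_subbase_open \<phi> Cc_translate f open_ball open_halfspace_Re_lt)
    moreover have "\<Lambda> \<in> V" using L e(1) by (auto simp: V_def M_def)
    moreover have "ball t d \<times> V \<subseteq> {(t, \<Lambda>). \<Lambda> \<in> point_measures \<and> counting (\<lambda>x. f (t + x)) \<Lambda> \<in> U}"
    proof (clarify, intro conjI)
      fix s N assume s: "s \<in> ball t d" and N: "N \<in> V"
      show Np: "N \<in> point_measures" using N by (simp add: V_def)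
      note rN = point_measures_radon[OF Np]
      have le: "cmod (f (s + x) - f (t + x)) \<le> e / (2 * M) * \<phi> x" for x
      proof (cases "f (s + x) = 0 \<and> f (t + x) = 0")
        case True
        then show ?thesis using \<phi>0[of x] e(1) M by simp
      next
        case False
        then have "norm (s + x) \<le> r \<or> norm (t + x) \<le> r" using r by blast
        moreover have "norm x \<le> norm (s + x) + norm s" "norm x \<le> norm (t + x) + norm t"
          using norm_triangle_ineq4[of "s + x" s] norm_triangle_ineq4[of "t + x" t] by simp_all
        moreover have "norm s \<le> norm t + 1"
          using s d(2) norm_triangle_ineq2[of s t] by (simp add: dist_norm norm_minus_commute)
        ultimately have "\<phi> x = 1" by (intro \<phi>1) auto
        moreover have "dist (s + x) (t + x) < d" using s by (simp add: dist_norm norm_minus_commute)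
        ultimately show ?thesis using d(3) by (simp add: less_imp_le)
      qed
      have i: "integrable N (\<lambda>x. f (s + x))" "integrable N (\<lambda>x. f (t + x))"
        by (intro Cc_integrable rN Cc_translate f)+
      have i\<phi>: "integrable N \<phi>" using integrable_Re[OF Cc_integrable[OF rN \<phi>]] by simp
      have "cmod (counting (\<lambda>x. f (s + x)) N - counting (\<lambda>x. f (t + x)) N) = cmod (\<integral>x. f (s + x) - f (t + x) \<partial>N)"
        unfolding counting_def using i by simp
      also have "\<dots> \<le> (\<integral>x. cmod (f (s + x) - f (t + x)) \<partial>N)" by (rule integral_norm_bound)
      also have "\<dots> \<le> (\<integral>x. e / (2 * M) * \<phi> x \<partial>N)"
        by (intro integral_mono integrable_norm Bochner_Integration.integrable_diff i integrable_mult_right i\<phi> le)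
      also have "\<dots> = e / (2 * M) * Re (counting (\<lambda>x. of_real (\<phi> x)) N)"
        by (simp add: counting_def)
      also have "\<dots> \<le> e / (2 * M) * M"
        using N e(1) M by (intro mult_left_mono) (auto simp: V_def)
      finally have "cmod (counting (\<lambda>x. f (s + x)) N - counting (\<lambda>x. f (t + x)) N) \<le> e / 2"
        using M by simp
      moreover have "cmod (counting (\<lambda>x. f (t + x)) N - ?z) < e / 2"
        using N by (simp add: V_def dist_norm norm_minus_commute)
      ultimately have "cmod (counting (\<lambda>x. f (s + x)) N - ?z) < e"
        using norm_triangle_ineq[of "counting (\<lambda>x. f (s + x)) N - counting (\<lambda>x. f (t + x)) N" "counting (\<lambda>x. f (t + x)) N - ?z"]
        by simp
      then show "counting (\<lambda>x. f (s + x)) N \<in> U"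
        using e(2) by (auto simp: subset_iff dist_norm norm_minus_commute)
    qed
    ultimately show "\<exists>A B. openin euclidean A \<and> openin vague_topology B \<and> t \<in> A \<and> \<Lambda> \<in> B \<and>
        A \<times> B \<subseteq> {(t, \<Lambda>). \<Lambda> \<in> point_measures \<and> counting (\<lambda>x. f (t + x)) \<Lambda> \<in> U}"
      using d(1) by (intro exI[of _ "ball t d"] exI[of _ V]) auto
  qed
  finally show "openin ?T ((\<lambda>(t, \<Lambda>). translate t \<Lambda>) -` S \<inter> topspace ?T)" .
qed

text \<open>The map \<open>(x, \<Lambda>) \<mapsto> translate (- x) \<Lambda>\<close> is only known to be Borel for the Borel structure of the
  product topology.  The next two lemmas make second countability of the vague topology
  unnecessary: the mass of the section of an open set is semicontinuous.\<close>

lemma open_section: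
  fixes W :: "('a::metric_space \<times> 'b) set"
  assumes W: "openin (prod_topology euclidean T) W"
  shows "open {x. (x, y) \<in> W}"
  unfolding open_contains_ball
proof
  fix x assume "x \<in> {x. (x, y) \<in> W}"
  then have "\<exists>U V. openin euclidean U \<and> openin T V \<and> x \<in> U \<and> y \<in> V \<and> U \<times> V \<subseteq> W"
    using W unfolding openin_prod_topology_alt by blast
  then obtain U V where UV: "open U" "x \<in> U" "y \<in> V" "U \<times> V \<subseteq> W"
    by (auto simp: open_openin[symmetric])
  then obtain e where "e > 0" "ball x e \<subseteq> U" using open_contains_ball by blast
  then show "\<exists>e>0. ball x e \<subseteq> {x. (x, y) \<in> W}" using UV(3,4) by blast
qed

lemma vague_section_lower:
  fixes W :: "('a::euclidean_space \<times> 'a measure) set"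
  assumes W: "openin (prod_topology euclidean vague_topology) W"
  shows "openin vague_topology {\<Lambda> \<in> point_measures. c < emeasure \<Lambda> {x. (x, \<Lambda>) \<in> W}}"
proof (subst openin_subopen, intro ballI)
  fix \<Lambda> assume "\<Lambda> \<in> {\<Lambda> \<in> point_measures. c < emeasure \<Lambda> {x. (x, \<Lambda>) \<in> W}}"
  then have L: "\<Lambda> \<in> point_measures" and c: "c < emeasure \<Lambda> {x. (x, \<Lambda>) \<in> W}" by auto
  note r = point_measures_radon[OF L]
  obtain C where C: "\<And>n. compact (C n)" "\<And>n. C n \<subseteq> {x. (x, \<Lambda>) \<in> W}"
    "\<And>n. C n \<subseteq> interior (C (Suc n))" "\<Union> (range C) = {x. (x, \<Lambda>) \<in> W}"
    using open_Union_compact_subsets[OF open_section[OF W]] by metis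
  have "(SUP n. emeasure \<Lambda> (C n)) = emeasure \<Lambda> (\<Union> (range C))"
  proof (rule SUP_emeasure_incseq)
    show "range C \<subseteq> sets \<Lambda>" using C(1) radon_sets[OF r] by (auto intro: borel_compact)
    show "incseq C" using C(3) interior_subset by (intro incseq_SucI) blast
  qed
  then obtain n where n: "c < emeasure \<Lambda> (C n)" using c unfolding C(4) by (metis less_SUP_iff)
  \<comment> \<open>The compact piece \<open>C n\<close> already has mass above \<open>c\<close>.
    The tube lemma encloses it in an open \<open>U\<close> lying in the section for every
    configuration near \<open>\<Lambda>\<close>, and the mass of the fixed set \<open>U\<close> is
    lower semicontinuous.\<close>
  obtain U V where UV: "open U" "openin vague_topology V" "C n \<subseteq> U" "\<Lambda> \<in> V" "U \<times> V \<subseteq> W"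
    using tube_lemma_left[OF W, of "C n" \<Lambda>] C(1,2) L by force
  let ?T = "V \<inter> {\<Lambda> \<in> point_measures. c < emeasure \<Lambda> U}"
  have "openin vague_topology ?T" by (intro openin_Int UV vague_emeasure_lower)
  moreover have "\<Lambda> \<in> ?T"
    using UV L n emeasure_mono[OF UV(3), of \<Lambda>] radon_sets[OF r] by (auto intro: less_le_trans)
  moreover have "?T \<subseteq> {\<Lambda> \<in> point_measures. c < emeasure \<Lambda> {x. (x, \<Lambda>) \<in> W}}"
  proof
    fix N assume N: "N \<in> ?T"
    then have "emeasure N U \<le> emeasure N {x. (x, N) \<in> W}"
      using UV(5) radon_sets[OF point_measures_radon, of N] open_section[OF W]
      by (intro emeasure_mono) auto
    then show "N \<in> {\<Lambda> \<in> point_measures. c < emeasure \<Lambda> {x. (x, \<Lambda>) \<in> W}}"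
      using N by (auto intro: less_le_trans)
  qed
  ultimately show "\<exists>T. openin vague_topology T \<and> \<Lambda> \<in> T \<and> T \<subseteq> {\<Lambda> \<in> point_measures. c < emeasure \<Lambda> {x. (x, \<Lambda>) \<in> W}}"
    by blast
qed

subsection \<open>Mixtures of measures\<close>

text \<open>A strictly positive \<open>w\<close> with uniformly bounded integral turns a kernel of
  possibly infinite measures into a bounded one. The locale is used with \<open>weight\<close> for
  configurations, with a product of weights for
  \<open>\<Lambda> \<Otimes>\<^sub>M \<Lambda>\<close>, and with the constant 1 for the Palm
  kernel.\<close>

locale weighted_kernel =
  fixes M :: "'w measure" and N :: "'b measure" and k :: "'w \<Rightarrow> 'b measure" and w :: "'b \<Rightarrow> real" and C :: real
  assumes sets_kernel: "\<And>\<omega>. \<omega> \<in> space M \<Longrightarrow> sets (k \<omega>) = sets N"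
    and emeasure_kernel: "\<And>A. A \<in> sets N \<Longrightarrow> (\<lambda>\<omega>. emeasure (k \<omega>) A) \<in> borel_measurable M"
    and w_measurable [measurable]: "w \<in> borel_measurable N"
    and w_pos: "\<And>x. x \<in> space N \<Longrightarrow> 0 < w x"
    and w_bound: "\<And>\<omega>. \<omega> \<in> space M \<Longrightarrow> (\<integral>\<^sup>+x. w x \<partial>k \<omega>) \<le> ennreal C"
    and space_N: "space N \<noteq> {}"
begin

lemma space_kernel: "\<omega> \<in> space M \<Longrightarrow> space (k \<omega>) = space N"
  using sets_eq_imp_space_eq[OF sets_kernel] by simp

lemma kernel_measurable: "\<omega> \<in> space M \<Longrightarrow> f \<in> N \<rightarrow>\<^sub>M L \<Longrightarrow> f \<in> k \<omega> \<rightarrow>\<^sub>M L"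
  using measurable_cong_sets[OF sets_kernel refl] by blast

lemma nn_integral_kernel:
  assumes "f \<in> borel_measurable N"
  shows "(\<lambda>\<omega>. \<integral>\<^sup>+x. f x \<partial>k \<omega>) \<in> borel_measurable M"
  using assms
proof induction
  case (cong f g)
  then have "(\<integral>\<^sup>+x. f x \<partial>k \<omega>) = (\<integral>\<^sup>+x. g x \<partial>k \<omega>)" if "\<omega> \<in> space M" for \<omega>
    using that by (intro nn_integral_cong) (simp add: space_kernel)
  then show ?case using cong by (simp cong: measurable_cong)
next
  case (set A)
  then have "(\<integral>\<^sup>+x. indicator A x \<partial>k \<omega>) = emeasure (k \<omega>) A" if "\<omega> \<in> space M" for \<omega>
    using that by (simp add: sets_kernel)
  then show ?case using emeasure_kernel[OF set] by (simp cong: measurable_cong)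
next
  case (mult u c)
  then have "(\<integral>\<^sup>+x. c * u x \<partial>k \<omega>) = c * (\<integral>\<^sup>+x. u x \<partial>k \<omega>)" if "\<omega> \<in> space M" for \<omega>
    using that by (intro nn_integral_cmult) (rule kernel_measurable)
  then show ?case using mult by (simp cong: measurable_cong)
next
  case (add u v)
  then have "(\<integral>\<^sup>+x. v x + u x \<partial>k \<omega>) = (\<integral>\<^sup>+x. v x \<partial>k \<omega>) + (\<integral>\<^sup>+x. u x \<partial>k \<omega>)" if "\<omega> \<in> space M" for \<omega>
    using that by (intro nn_integral_add) (auto intro: kernel_measurable)
  then show ?case using add by (simp cong: measurable_cong)
next
  case (seq U)
  then have "(\<integral>\<^sup>+x. (SUP i. U i) x \<partial>k \<omega>) = (SUP i. \<integral>\<^sup>+x. U i x \<partial>k \<omega>)" if "\<omega> \<in> space M" for \<omega>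
    using that nn_integral_monotone_convergence_SUP[of U "k \<omega>"]
    by (simp add: kernel_measurable image_comp)
  then show ?case using seq by (simp cong: measurable_cong)
qed

text \<open>Here the integrand may depend on \<open>\<omega>\<close>. The density
  \<open>w / D\<close> gives a measurable map into \<open>subprob_algebra N\<close>, and the factor
  \<open>D / w\<close> in the integrand undoes it.\<close>

lemma nn_integral_kernel2:
  assumes [measurable]: "(\<lambda>(\<omega>, x). f \<omega> x) \<in> borel_measurable (M \<Otimes>\<^sub>M N)"
  shows "(\<lambda>\<omega>. \<integral>\<^sup>+x. f \<omega> x \<partial>k \<omega>) \<in> borel_measurable M"
proof -
  \<comment> \<open>At least 1, so that dividing by \<open>D\<close> is harmless whatever the sign
    of \<open>C\<close>.\<close>
  define D where "D = max C 1"
  have D: "0 < D" "C \<le> D" by (auto simp: D_def)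
  define L where "L \<omega> = density (k \<omega>) (\<lambda>x. ennreal (w x / D))" for \<omega>
  have wk [measurable]: "w \<in> borel_measurable (k \<omega>)" if "\<omega> \<in> space M" for \<omega>
    using that by (rule kernel_measurable) (rule w_measurable)
  have L: "L \<in> M \<rightarrow>\<^sub>M subprob_algebra N"
  proof (rule measurable_subprob_algebra)
    fix \<omega> assume \<omega>: "\<omega> \<in> space M"
    show "sets (L \<omega>) = sets N" using \<omega> by (simp add: L_def sets_kernel)
    show "subprob_space (L \<omega>)"
    proof
      have "emeasure (L \<omega>) (space (L \<omega>)) = (\<integral>\<^sup>+x. ennreal (1 / D) * ennreal (w x) \<partial>k \<omega>)"
      proof -
        have "emeasure (L \<omega>) (space (L \<omega>)) = (\<integral>\<^sup>+x. ennreal (w x / D) * indicator (space (k \<omega>)) x \<partial>k \<omega>)"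
          using wk[OF \<omega>] unfolding L_def space_density by (intro emeasure_density) auto
        also have "\<dots> = (\<integral>\<^sup>+x. ennreal (1 / D) * ennreal (w x) \<partial>k \<omega>)"
          using D by (intro nn_integral_cong) (auto simp: ennreal_mult'[symmetric])
        finally show ?thesis .
      qed
      also have "\<dots> = ennreal (1 / D) * (\<integral>\<^sup>+x. w x \<partial>k \<omega>)"
        using \<omega> by (intro nn_integral_cmult) (auto intro: wk)
      also have "\<dots> \<le> ennreal (1 / D) * ennreal D"
        using w_bound[OF \<omega>] D by (intro mult_left_mono) (auto intro: order_trans ennreal_leI)
      also have "\<dots> = 1" using D by (simp add: ennreal_mult[symmetric])
      finally show "emeasure (L \<omega>) (space (L \<omega>)) \<le> 1" .
      show "space (L \<omega>) \<noteq> {}" using \<omega> space_N by (simp add: L_def space_kernel)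
    qed
  next
    fix A assume A [measurable]: "A \<in> sets N"
    have "(\<lambda>\<omega>. \<integral>\<^sup>+x. ennreal (w x / D) * indicator A x \<partial>k \<omega>) \<in> borel_measurable M"
      by (intro nn_integral_kernel) measurable
    moreover have "emeasure (L \<omega>) A = (\<integral>\<^sup>+x. ennreal (w x / D) * indicator A x \<partial>k \<omega>)" if "\<omega> \<in> space M" for \<omega>
      using that A wk[OF that] unfolding L_def by (subst emeasure_density) (auto simp: sets_kernel)
    ultimately show "(\<lambda>\<omega>. emeasure (L \<omega>) A) \<in> borel_measurable M" by (simp cong: measurable_cong)
  qed
  have "(\<lambda>\<omega>. \<integral>\<^sup>+x. f \<omega> x * ennreal (D / w x) \<partial>L \<omega>) \<in> borel_measurable M"
    by (rule nn_integral_measurable_subprob_algebra2[OF _ L]) measurable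
  moreover have "(\<integral>\<^sup>+x. f \<omega> x * ennreal (D / w x) \<partial>L \<omega>) = (\<integral>\<^sup>+x. f \<omega> x \<partial>k \<omega>)" if \<omega>: "\<omega> \<in> space M" for \<omega>
  proof -
    have [measurable]: "f \<omega> \<in> borel_measurable (k \<omega>)"
      using measurable_Pair2[OF assms \<omega>] by (intro kernel_measurable[OF \<omega>]) simp
    note wk[OF \<omega>, measurable]
    have "(\<integral>\<^sup>+x. f \<omega> x * ennreal (D / w x) \<partial>L \<omega>) = (\<integral>\<^sup>+x. ennreal (w x / D) * (f \<omega> x * ennreal (D / w x)) \<partial>k \<omega>)"
      unfolding L_def by (intro nn_integral_density) measurable
    also have "\<dots> = (\<integral>\<^sup>+x. f \<omega> x \<partial>k \<omega>)"
    proof (intro nn_integral_cong)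
      fix x assume "x \<in> space (k \<omega>)"
      then have "0 < w x" using w_pos \<omega> by (simp add: space_kernel)
      then have "ennreal (w x / D) * ennreal (D / w x) = 1" using D by (simp add: ennreal_mult[symmetric])
      then show "ennreal (w x / D) * (f \<omega> x * ennreal (D / w x)) = f \<omega> x" by (metis mult.assoc mult.commute mult_1)
    qed
    finally show ?thesis .
  qed
  ultimately show ?thesis by (simp cong: measurable_cong)
qed

lemma integral_kernel_real:
  fixes f :: "'b \<Rightarrow> real"
  assumes f: "f \<in> borel_measurable N" and i: "\<And>\<omega>. \<omega> \<in> space M \<Longrightarrow> integrable (k \<omega>) f"
  shows "(\<lambda>\<omega>. \<integral>x. f x \<partial>k \<omega>) \<in> borel_measurable M"
proof -
  have "(\<lambda>\<omega>. enn2real (\<integral>\<^sup>+x. f x \<partial>k \<omega>) - enn2real (\<integral>\<^sup>+x. ennreal (- f x) \<partial>k \<omega>)) \<in> borel_measurable M"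
    using nn_integral_kernel[of f] nn_integral_kernel[of "\<lambda>x. - f x"] f by measurable
  then show ?thesis by (simp add: real_lebesgue_integral_def[OF i] cong: measurable_cong)
qed

lemma integral_kernel:
  fixes f :: "'b \<Rightarrow> complex"
  assumes f: "f \<in> borel_measurable N" and i: "\<And>\<omega>. \<omega> \<in> space M \<Longrightarrow> integrable (k \<omega>) f"
  shows "(\<lambda>\<omega>. \<integral>x. f x \<partial>k \<omega>) \<in> borel_measurable M"
proof -
  have "(\<lambda>\<omega>. \<integral>x. Re (f x) \<partial>k \<omega>) \<in> borel_measurable M" "(\<lambda>\<omega>. \<integral>x. Im (f x) \<partial>k \<omega>) \<in> borel_measurable M"
    using f i by (auto intro!: integral_kernel_real integrable_Re integrable_Im)
  moreover have "Re (\<integral>x. f x \<partial>k \<omega>) = (\<integral>x. Re (f x) \<partial>k \<omega>)" "Im (\<integral>x. f x \<partial>k \<omega>) = (\<integral>x. Im (f x) \<partial>k \<omega>)"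
    if "\<omega> \<in> space M" for \<omega>
    using i[OF that] by (simp_all add: integral_Re integral_Im)
  ultimately show ?thesis by (simp add: borel_measurable_complex_iff cong: measurable_cong)
qed

definition mixture :: "'b measure" where
  "mixture = measure_of (space N) (sets N) (\<lambda>A. \<integral>\<^sup>+\<omega>. emeasure (k \<omega>) A \<partial>M)"

lemma sets_mixture [simp]: "sets mixture = sets N" "space mixture = space N"
  by (simp_all add: mixture_def sets.space_closed sets.sigma_sets_eq)

lemma measurable_mixture [simp]: "mixture \<rightarrow>\<^sub>M L = N \<rightarrow>\<^sub>M L"
  by (rule measurable_cong_sets[OF sets_mixture(1) refl])

text \<open>\<open>measure_of\<close> yields the zero measure when the set function is not countably
  additive. Additivity holds because a series of measurable nonnegative functions is integrated term
  by term.\<close>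

lemma emeasure_mixture:
  assumes "A \<in> sets N"
  shows "emeasure mixture A = (\<integral>\<^sup>+\<omega>. emeasure (k \<omega>) A \<partial>M)"
proof (rule emeasure_measure_of[OF mixture_def])
  show "countably_additive (sets mixture) (\<lambda>A. \<integral>\<^sup>+\<omega>. emeasure (k \<omega>) A \<partial>M)"
    unfolding countably_additive_def
  proof (intro allI impI)
    fix A :: "nat \<Rightarrow> 'b set"
    assume A: "range A \<subseteq> sets mixture" "disjoint_family A"
    then have "(\<Sum>i. \<integral>\<^sup>+\<omega>. emeasure (k \<omega>) (A i) \<partial>M) = (\<integral>\<^sup>+\<omega>. (\<Sum>i. emeasure (k \<omega>) (A i)) \<partial>M)"
      by (intro nn_integral_suminf[symmetric] emeasure_kernel) auto
    also have "\<dots> = (\<integral>\<^sup>+\<omega>. emeasure (k \<omega>) (\<Union> (range A)) \<partial>M)"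
      using A by (intro nn_integral_cong suminf_emeasure) (auto simp: sets_kernel)
    finally show "(\<Sum>i. \<integral>\<^sup>+\<omega>. emeasure (k \<omega>) (A i) \<partial>M) = (\<integral>\<^sup>+\<omega>. emeasure (k \<omega>) (\<Union> (range A)) \<partial>M)" .
  qed
qed (use assms in \<open>auto simp: positive_def sets.space_closed\<close>)

lemma nn_integral_mixture:
  assumes "f \<in> borel_measurable N"
  shows "(\<integral>\<^sup>+x. f x \<partial>mixture) = (\<integral>\<^sup>+\<omega>. \<integral>\<^sup>+x. f x \<partial>k \<omega> \<partial>M)"
  using assms
proof induction
  case (cong f g)
  have "(\<integral>\<^sup>+x. f x \<partial>mixture) = (\<integral>\<^sup>+x. g x \<partial>mixture)" using cong by (intro nn_integral_cong) auto
  moreover have "(\<integral>\<^sup>+\<omega>. \<integral>\<^sup>+x. f x \<partial>k \<omega> \<partial>M) = (\<integral>\<^sup>+\<omega>. \<integral>\<^sup>+x. g x \<partial>k \<omega> \<partial>M)"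
    using cong by (intro nn_integral_cong) (auto simp: space_kernel)
  ultimately show ?case using cong by simp
next
  case (set A)
  have "(\<integral>\<^sup>+\<omega>. \<integral>\<^sup>+x. indicator A x \<partial>k \<omega> \<partial>M) = (\<integral>\<^sup>+\<omega>. emeasure (k \<omega>) A \<partial>M)"
    using set by (intro nn_integral_cong nn_integral_indicator) (simp add: sets_kernel)
  then show ?case using set by (simp add: emeasure_mixture)
next
  case (mult u c)
  have "(\<integral>\<^sup>+\<omega>. \<integral>\<^sup>+x. c * u x \<partial>k \<omega> \<partial>M) = (\<integral>\<^sup>+\<omega>. c * (\<integral>\<^sup>+x. u x \<partial>k \<omega>) \<partial>M)"
    using mult by (intro nn_integral_cong nn_integral_cmult) (rule kernel_measurable)
  also have "\<dots> = c * (\<integral>\<^sup>+\<omega>. (\<integral>\<^sup>+x. u x \<partial>k \<omega>) \<partial>M)"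
    using mult by (intro nn_integral_cmult nn_integral_kernel)
  finally show ?case using mult by (simp add: nn_integral_cmult)
next
  case (add u v)
  have "(\<integral>\<^sup>+\<omega>. \<integral>\<^sup>+x. v x + u x \<partial>k \<omega> \<partial>M) = (\<integral>\<^sup>+\<omega>. (\<integral>\<^sup>+x. v x \<partial>k \<omega>) + (\<integral>\<^sup>+x. u x \<partial>k \<omega>) \<partial>M)"
    using add by (intro nn_integral_cong nn_integral_add) (auto intro: kernel_measurable)
  also have "\<dots> = (\<integral>\<^sup>+\<omega>. \<integral>\<^sup>+x. v x \<partial>k \<omega> \<partial>M) + (\<integral>\<^sup>+\<omega>. \<integral>\<^sup>+x. u x \<partial>k \<omega> \<partial>M)"
    using add by (intro nn_integral_add nn_integral_kernel)
  finally show ?case using add by (simp add: nn_integral_add)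
next
  case (seq U)
  have U: "U i \<in> borel_measurable mixture" for i using seq(1) by simp
  have "(\<integral>\<^sup>+\<omega>. \<integral>\<^sup>+x. (SUP i. U i) x \<partial>k \<omega> \<partial>M) = (\<integral>\<^sup>+\<omega>. (SUP i. \<integral>\<^sup>+x. U i x \<partial>k \<omega>) \<partial>M)"
    using seq nn_integral_monotone_convergence_SUP[of U "k _"]
    by (intro nn_integral_cong) (simp add: kernel_measurable image_comp)
  also have "\<dots> = (SUP i. \<integral>\<^sup>+\<omega>. \<integral>\<^sup>+x. U i x \<partial>k \<omega> \<partial>M)"
    using seq by (intro nn_integral_monotone_convergence_SUP nn_integral_kernel)
      (auto simp: incseq_def le_fun_def intro!: nn_integral_mono)
  also have "\<dots> = (SUP i. \<integral>\<^sup>+x. U i x \<partial>mixture)" using seq by simp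
  also have "\<dots> = (\<integral>\<^sup>+x. (SUP i. U i) x \<partial>mixture)"
    using seq nn_integral_monotone_convergence_SUP[OF _ U] by (simp add: image_comp)
  finally show ?case ..
qed

text \<open>Positive and negative parts are handled through nonnegative integrals. Integrability is
  assumed for every \<open>\<omega>\<close>, so the inner integrals are finite everywhere and no
  exceptional set has to be removed.\<close>

lemma integral_mixture_real:
  fixes f :: "'b \<Rightarrow> real"
  assumes int: "integrable mixture f" and i: "\<And>\<omega>. \<omega> \<in> space M \<Longrightarrow> integrable (k \<omega>) f"
  shows "integrable M (\<lambda>\<omega>. \<integral>x. f x \<partial>k \<omega>)" "(\<integral>x. f x \<partial>mixture) = (\<integral>\<omega>. \<integral>x. f x \<partial>k \<omega> \<partial>M)"
proof -
  have f [measurable]: "f \<in> borel_measurable N" using borel_measurable_integrable[OF int] by simp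
  define P where "P g \<omega> = (\<integral>\<^sup>+x. ennreal (g x) \<partial>k \<omega>)" for g :: "'b \<Rightarrow> real" and \<omega>
  have P [measurable]: "P g \<in> borel_measurable M" if "g \<in> borel_measurable N" for g
    unfolding P_def using that by (intro nn_integral_kernel) auto
  have fin: "P g \<omega> < \<infinity>" if "\<omega> \<in> space M" "integrable (k \<omega>) g" for g \<omega>
    using that(2) unfolding P_def integrable_iff_bounded
    by (elim conjE le_less_trans[OF nn_integral_mono, rotated]) (simp add: ennreal_leI)
  have mix: "(\<integral>\<^sup>+x. ennreal (g x) \<partial>mixture) = (\<integral>\<^sup>+\<omega>. P g \<omega> \<partial>M)" if "g \<in> borel_measurable N" for g
    unfolding P_def using that by (intro nn_integral_mixture) auto
  have main: "integrable M (\<lambda>\<omega>. enn2real (P g \<omega>))" "(\<integral>\<omega>. enn2real (P g \<omega>) \<partial>M) = enn2real (\<integral>\<^sup>+x. ennreal (g x) \<partial>mixture)"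
    if g: "integrable mixture g" "\<And>\<omega>. \<omega> \<in> space M \<Longrightarrow> integrable (k \<omega>) g" for g
  proof -
    have gm [measurable]: "g \<in> borel_measurable N" using borel_measurable_integrable[OF g(1)] by simp
    have eq: "(\<integral>\<^sup>+\<omega>. ennreal (enn2real (P g \<omega>)) \<partial>M) = (\<integral>\<^sup>+x. ennreal (g x) \<partial>mixture)"
      unfolding mix[OF gm] using fin g(2) by (intro nn_integral_cong) (auto simp: less_top)
    also have "\<dots> < \<infinity>"
      using g(1) unfolding integrable_iff_bounded by (elim conjE le_less_trans[OF nn_integral_mono, rotated]) (simp add: ennreal_leI)
    finally show int: "integrable M (\<lambda>\<omega>. enn2real (P g \<omega>))"
      by (intro integrableI_nonneg) auto
    show "(\<integral>\<omega>. enn2real (P g \<omega>) \<partial>M) = enn2real (\<integral>\<^sup>+x. ennreal (g x) \<partial>mixture)"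
      by (subst integral_eq_nn_integral) (auto simp: eq)
  qed
  have eq: "(\<integral>x. f x \<partial>k \<omega>) = enn2real (P f \<omega>) - enn2real (P (\<lambda>x. - f x) \<omega>)" if "\<omega> \<in> space M" for \<omega>
    unfolding P_def by (rule real_lebesgue_integral_def[OF i[OF that]])
  have m1: "integrable M (\<lambda>\<omega>. enn2real (P f \<omega>))" "integrable M (\<lambda>\<omega>. enn2real (P (\<lambda>x. - f x) \<omega>))"
    using int i by (auto intro!: main)
  show "integrable M (\<lambda>\<omega>. \<integral>x. f x \<partial>k \<omega>)"
    using Bochner_Integration.integrable_diff[OF m1] by (simp add: eq cong: Bochner_Integration.integrable_cong)
  have "(\<integral>\<omega>. \<integral>x. f x \<partial>k \<omega> \<partial>M) = (\<integral>\<omega>. enn2real (P f \<omega>) - enn2real (P (\<lambda>x. - f x) \<omega>) \<partial>M)"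
    by (intro Bochner_Integration.integral_cong) (auto simp: eq)
  also have "\<dots> = (\<integral>x. f x \<partial>mixture)"
    using int i by (simp add: m1 main real_lebesgue_integral_def[OF int])
  finally show "(\<integral>x. f x \<partial>mixture) = (\<integral>\<omega>. \<integral>x. f x \<partial>k \<omega> \<partial>M)" ..
qed

lemma integral_mixture:
  fixes f :: "'b \<Rightarrow> complex"
  assumes int: "integrable mixture f" and i: "\<And>\<omega>. \<omega> \<in> space M \<Longrightarrow> integrable (k \<omega>) f"
  shows "(\<integral>x. f x \<partial>mixture) = (\<integral>\<omega>. \<integral>x. f x \<partial>k \<omega> \<partial>M)"
proof -
  have re: "(\<integral>x. Re (f x) \<partial>k \<omega>) = Re (\<integral>x. f x \<partial>k \<omega>)" "(\<integral>x. Im (f x) \<partial>k \<omega>) = Im (\<integral>x. f x \<partial>k \<omega>)"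
    if "\<omega> \<in> space M" for \<omega>
    using i[OF that] by (simp_all add: integral_Re integral_Im)
  have R: "integrable M (\<lambda>\<omega>. Re (\<integral>x. f x \<partial>k \<omega>))" "(\<integral>x. Re (f x) \<partial>mixture) = (\<integral>\<omega>. Re (\<integral>x. f x \<partial>k \<omega>) \<partial>M)"
    using integral_mixture_real[of "\<lambda>x. Re (f x)"] int i
    by (simp_all add: re cong: Bochner_Integration.integrable_cong Bochner_Integration.integral_cong)
  have I: "integrable M (\<lambda>\<omega>. Im (\<integral>x. f x \<partial>k \<omega>))" "(\<integral>x. Im (f x) \<partial>mixture) = (\<integral>\<omega>. Im (\<integral>x. f x \<partial>k \<omega>) \<partial>M)"
    using integral_mixture_real[of "\<lambda>x. Im (f x)"] int i
    by (simp_all add: re cong: Bochner_Integration.integrable_cong Bochner_Integration.integral_cong)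
  have "integrable M (\<lambda>\<omega>. \<integral>x. f x \<partial>k \<omega>)"
  proof -
    have "integrable M (\<lambda>\<omega>. complex_of_real (Re (\<integral>x. f x \<partial>k \<omega>)) + \<i> * complex_of_real (Im (\<integral>x. f x \<partial>k \<omega>)))"
      using R(1) I(1) by (intro Bochner_Integration.integrable_add integrable_mult_right integrable_of_real)
    then show ?thesis by (simp add: complex_eq[symmetric])
  qed
  then show ?thesis
    using R(2) I(2) int by (intro complex_eqI) (simp_all add: integral_Re integral_Im)
qed

end

subsection \<open>Atoms of point measures\<close>

lemma point_measure_integer:
  assumes "\<Lambda> \<in> point_measures" "A \<in> sets borel" "bounded A"
  shows "emeasure \<Lambda> A \<in> \<nat>"
  using assms by (auto simp: point_measures_def compact_closure)

text \<open>Masses of bounded sets are natural numbers: once a ball shrinking to \<open>x\<close>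
  has mass below 1, it has mass 0.\<close>

lemma point_measure_null_nbhd:
  assumes L: "\<Lambda> \<in> point_measures" and x: "emeasure \<Lambda> {x::'a::euclidean_space} = 0"
  shows "\<exists>U. open U \<and> x \<in> U \<and> emeasure \<Lambda> U = 0"
proof -
  note r = point_measures_radon[OF L]
  have "(INF n. emeasure \<Lambda> (ball x (1 / real (Suc n)))) = emeasure \<Lambda> (\<Inter>n. ball x (1 / real (Suc n)))"
  proof (rule INF_emeasure_decseq)
    show "decseq (\<lambda>n. ball x (1 / real (Suc n)))"
      by (intro decseq_SucI subset_ball) (simp add: field_simps)
    show "range (\<lambda>n. ball x (1 / real (Suc n))) \<subseteq> sets \<Lambda>"
      unfolding radon_sets[OF r] by (intro image_subsetI borel_open open_ball)
    show "emeasure \<Lambda> (ball x (1 / real (Suc n))) \<noteq> \<infinity>" for n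
      using radon_finite[OF r bounded_ball, of x "1 / real (Suc n)"] by simp
  qed
  also have "(\<Inter>n. ball x (1 / real (Suc n))) = {x}"
  proof
    show "(\<Inter>n. ball x (1 / real (Suc n))) \<subseteq> {x}"
    proof
      fix y assume y: "y \<in> (\<Inter>n. ball x (1 / real (Suc n)))"
      show "y \<in> {x}"
      proof (rule ccontr)
        assume "y \<notin> {x}"
        then obtain n where "inverse (real (Suc n)) < dist x y"
          using reals_Archimedean[of "dist x y"] by auto
        moreover have "dist x y < 1 / real (Suc n)" using y by simp
        ultimately show False by (simp add: inverse_eq_divide)
      qed
    qed
  qed auto
  finally have "(INF n. emeasure \<Lambda> (ball x (1 / real (Suc n)))) < 1" using x by simp
  then obtain n where n: "emeasure \<Lambda> (ball x (1 / real (Suc n))) < 1" by (auto simp: INF_less_iff)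
  moreover have "emeasure \<Lambda> (ball x (1 / real (Suc n))) \<in> \<nat>"
    by (intro point_measure_integer[OF L]) auto
  ultimately have "emeasure \<Lambda> (ball x (1 / real (Suc n))) = 0"
    by (auto simp: Nats_def)
  then show ?thesis by (intro exI[of _ "ball x (1 / real (Suc n))"]) auto
qed

text \<open>By Lindelof's theorem the union of all null open sets is the union of countably many of
  them, hence null, although the points that are not atoms are uncountable.\<close>

lemma point_measure_diffuse_null:
  assumes L: "\<Lambda> \<in> point_measures"
  obtains U where "open U" "emeasure \<Lambda> U = 0" "{x::'a::euclidean_space. emeasure \<Lambda> {x} = 0} \<subseteq> U"
proof -
  note r = point_measures_radon[OF L]
  obtain \<F> where F: "\<F> \<subseteq> {U. open U \<and> emeasure \<Lambda> U = 0}" "countable \<F>" "\<Union>\<F> = \<Union>{U. open U \<and> emeasure \<Lambda> U = 0}"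
    using Lindelof[of "{U. open U \<and> emeasure \<Lambda> U = 0}"] by auto
  have "(\<Union>U\<in>\<F>. U) \<in> null_sets \<Lambda>"
    using F radon_sets[OF r] by (intro null_sets_UN' F) (auto simp: null_sets_def)
  moreover have "open (\<Union>\<F>)" using F(1) by auto
  moreover have "{x. emeasure \<Lambda> {x} = 0} \<subseteq> \<Union>\<F>"
    unfolding F(3) using point_measure_null_nbhd[OF L] by blast
  ultimately show ?thesis using that[of "\<Union>\<F>"] by (simp add: null_sets_def)
qed

text \<open>Every atom has mass at least 1, so each ball, being of finite mass, contains only
  finitely many.\<close>

lemma point_measure_countable_atoms:
  assumes L: "\<Lambda> \<in> point_measures"
  shows "countable {x::'a::euclidean_space. emeasure \<Lambda> {x} \<noteq> 0}"
proof -
  note r = point_measures_radon[OF L]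
  have ge: "1 \<le> emeasure \<Lambda> {x}" if "emeasure \<Lambda> {x} \<noteq> 0" for x
    using that point_measure_integer[OF L, of "{x}"] by (auto simp: Nats_def)
  have "finite ({x. emeasure \<Lambda> {x} \<noteq> 0} \<inter> cball 0 (real n))" for n
  proof (rule ccontr)
    let ?S = "{x. emeasure \<Lambda> {x} \<noteq> 0} \<inter> cball 0 (real n)"
    assume inf: "infinite ?S"
    have fin: "emeasure \<Lambda> (cball 0 (real n)) < \<infinity>" by (intro radon_finite[OF r]) auto
    then obtain N :: nat where N: "emeasure \<Lambda> (cball 0 (real n)) < of_nat N"
      using ennreal_Ex_less_of_nat by auto
    obtain F where F: "F \<subseteq> ?S" "finite F" "card F = N" using infinite_arbitrarily_large[OF inf] by blast
    have "of_nat N \<le> (\<Sum>x\<in>F. emeasure \<Lambda> {x})"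
      using F ge sum_mono[of F "\<lambda>_. 1" "\<lambda>x. emeasure \<Lambda> {x}"] by auto
    also have "\<dots> = emeasure \<Lambda> F"
      using F(2) radon_sets[OF r] by (intro emeasure_eq_sum_singleton[symmetric]) auto
    also have "\<dots> \<le> emeasure \<Lambda> (cball 0 (real n))"
      using F(1) radon_sets[OF r] by (intro emeasure_mono) auto
    finally show False using N by simp
  qed
  then have "countable (\<Union>n. {x. emeasure \<Lambda> {x} \<noteq> 0} \<inter> cball 0 (real n))"
    by (intro countable_UN) (auto intro: countable_finite)
  moreover have "(\<Union>n. {x. emeasure \<Lambda> {x} \<noteq> 0} \<inter> cball 0 (real n)) = {x::'a. emeasure \<Lambda> {x} \<noteq> 0}"
  proof -
    have "\<exists>n::nat. x \<in> cball 0 (real n)" for x :: 'a using real_arch_simple[of "norm x"] by simp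
    then show ?thesis by blast
  qed
  ultimately show ?thesis by simp
qed

text \<open>The atoms are countable and the remaining points lie in a null set. This converts the
  unordered sum over points in \<open>palm_measure\<close> into the mass of a set.\<close>

lemma point_measure_atomic:
  assumes L: "\<Lambda> \<in> point_measures" and A: "A \<in> sets borel"
  shows "(\<Sum>\<^sub>\<infinity>x\<in>A. emeasure \<Lambda> {x}) = emeasure \<Lambda> (A :: 'a::euclidean_space set)"
proof (rule antisym)
  note r = point_measures_radon[OF L]
  have inf: "(\<Sum>\<^sub>\<infinity>x\<in>A. emeasure \<Lambda> {x}) = (SUP F\<in>{F. finite F \<and> F \<subseteq> A}. \<Sum>x\<in>F. emeasure \<Lambda> {x})"
    by (rule nonneg_infsum_complete) simp
  have fin: "(\<Sum>x\<in>F. emeasure \<Lambda> {x}) = emeasure \<Lambda> F" if "finite F" for F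
    using that radon_sets[OF r] by (intro emeasure_eq_sum_singleton[symmetric]) auto
  show "(\<Sum>\<^sub>\<infinity>x\<in>A. emeasure \<Lambda> {x}) \<le> emeasure \<Lambda> A"
    unfolding inf using A radon_sets[OF r] by (intro SUP_least) (auto simp: fin intro!: emeasure_mono)
  define S where "S = A \<inter> {x. emeasure \<Lambda> {x} \<noteq> 0}"
  have S: "countable S" unfolding S_def using point_measure_countable_atoms[OF L] by (rule countable_Int2)
  obtain U where U: "open U" "emeasure \<Lambda> U = 0" "{x. emeasure \<Lambda> {x} = 0} \<subseteq> U"
    using point_measure_diffuse_null[OF L] .
  have S_sets: "S \<in> sets borel" using S by (rule sets.countable[rotated]) auto
  have "emeasure \<Lambda> A \<le> emeasure \<Lambda> (S \<union> U)"
    using U S_sets radon_sets[OF r] by (intro emeasure_mono) (auto simp: S_def)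
  also have "\<dots> \<le> emeasure \<Lambda> S + emeasure \<Lambda> U"
    using U S_sets radon_sets[OF r] by (intro emeasure_subadditive) auto
  also have "\<dots> = emeasure \<Lambda> S" using U by simp
  also have "\<dots> \<le> (\<Sum>\<^sub>\<infinity>x\<in>A. emeasure \<Lambda> {x})"
  proof (cases "S = {}")
    case False
    let ?F = "\<lambda>n. from_nat_into S ` {..<n}"
    have "(\<Union>n. ?F n) = range (from_nat_into S)" by (auto intro: lessI)
    then have "(\<Union>n. ?F n) = S" unfolding range_from_nat_into[OF False S] .
    moreover have "(SUP n. emeasure \<Lambda> (?F n)) = emeasure \<Lambda> (\<Union>n. ?F n)"
    proof (rule SUP_emeasure_incseq)
      show "range ?F \<subseteq> sets \<Lambda>"
        unfolding radon_sets[OF r] by (intro image_subsetI borel_closed finite_imp_closed) simp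
      show "incseq ?F" by (auto simp: incseq_def)
    qed
    ultimately have "emeasure \<Lambda> S = (SUP n. emeasure \<Lambda> (?F n))" by simp
    also have "\<dots> \<le> (\<Sum>\<^sub>\<infinity>x\<in>A. emeasure \<Lambda> {x})"
    proof (rule SUP_least)
      fix n
      have "?F n \<subseteq> A" using from_nat_into[OF False] by (auto simp: S_def)
      then show "emeasure \<Lambda> (?F n) \<le> (\<Sum>\<^sub>\<infinity>x\<in>A. emeasure \<Lambda> {x})"
        unfolding inf by (subst fin[symmetric]) (auto intro!: SUP_upper)
    qed
    finally show ?thesis .
  qed simp
  finally show "emeasure \<Lambda> A \<le> (\<Sum>\<^sub>\<infinity>x\<in>A. emeasure \<Lambda> {x})" .
qed

subsection \<open>Integrating the weight against translation bounded measures\<close>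

text \<open>Up to a constant, the weight at \<open>x\<close> is at most its average over the unit ball at \<open>x\<close>; Tonelli
  then trades the integral against \<open>m\<close> for the masses of unit balls.\<close>

lemma nn_integral_weight_bound:
  "\<exists>K::real. \<forall>(m :: 'a::euclidean_space measure) C. radon m \<longrightarrow>
    (\<forall>a. emeasure m (ball a 1) \<le> ennreal C) \<longrightarrow> 0 \<le> C \<longrightarrow> (\<integral>\<^sup>+x. weight x \<partial>m) \<le> ennreal (K * C)"
proof -
  \<comment> \<open>The final constant is \<open>3 ^ DIM('a) * I / V\<close>: the factor
    \<open>3 ^ DIM('a)\<close> compares the weight at two points less than 1 apart, \<open>I\<close>
    is the Lebesgue integral of the weight and \<open>V\<close> the volume of the unit ball.\<close>
  define V where "V = measure lborel (ball (0::'a) 1)"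
  have V: "0 < V" unfolding V_def using content_ball_pos[of 1 "0::'a"] by simp
  have V_eq: "emeasure lborel (ball a 1) = ennreal V" for a :: 'a
    unfolding V_def
    using content_ball_conv_unit_ball[of 1 a] emeasure_eq_ennreal_measure[of lborel "ball a 1"] emeasure_lborel_ball_finite[of a 1]
    by (simp add: less_top)
  obtain I where I: "(\<integral>\<^sup>+x. weight (x::'a) \<partial>lborel) = ennreal I" "0 \<le> I"
    using nn_integral_weight_lborel[where 'a='a] by (metis less_top_ennreal infinity_ennreal_def)
  have "(\<integral>\<^sup>+x. weight x \<partial>m) \<le> ennreal (3 ^ DIM('a) * I / V * C)"
    if m: "radon m" and C: "\<And>a. emeasure m (ball a 1) \<le> ennreal C" "0 \<le> C" for m :: "'a measure" and C
  proof -
    interpret m: sigma_finite_measure m by (rule radon_sigma_finite[OF m])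
    interpret P: pair_sigma_finite m lborel ..
    have [measurable_cong]: "sets m = sets borel" by (rule radon_sets[OF m])
    have ind: "indicator (ball x 1) y = (if dist x y < 1 then 1 else 0 :: ennreal)" for x y :: 'a
      by (simp add: indicator_def)
    have "ennreal V * (\<integral>\<^sup>+x. weight x \<partial>m) = (\<integral>\<^sup>+x. ennreal V * weight x \<partial>m)"
      by (intro nn_integral_cmult[symmetric]) measurable
    also have "\<dots> = (\<integral>\<^sup>+x. (\<integral>\<^sup>+y. indicator (ball x 1) y * ennreal (weight x) \<partial>lborel) \<partial>m)"
      by (intro nn_integral_cong, subst nn_integral_multc) (auto simp: V_eq intro!: borel_measurable_indicator)
    \<comment> \<open>The moving ball is rewritten as the condition \<open>dist x y < 1\<close>,
      which is symmetric and visibly jointly measurable, as the exchange of order requires.\<close>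
    also have "\<dots> \<le> (\<integral>\<^sup>+x. (\<integral>\<^sup>+y. (if dist x y < 1 then 1 else 0) * ennreal (3 ^ DIM('a) * weight y) \<partial>lborel) \<partial>m)"
    proof (intro nn_integral_mono)
      fix x y :: 'a
      have "weight x \<le> 3 ^ DIM('a) * weight y" if "dist x y < 1"
        using weight_translate[of "y - x" x] that by (simp add: dist_norm norm_minus_commute)
      then show "indicator (ball x 1) y * ennreal (weight x) \<le> (if dist x y < 1 then 1 else 0) * ennreal (3 ^ DIM('a) * weight y)"
        by (auto simp: indicator_def intro!: ennreal_leI)
    qed
    also have "\<dots> = (\<integral>\<^sup>+y. (\<integral>\<^sup>+x. (if dist x y < 1 then 1 else 0) * ennreal (3 ^ DIM('a) * weight y) \<partial>m) \<partial>lborel)"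
      by (rule P.Fubini'[symmetric]) measurable
    also have "\<dots> = (\<integral>\<^sup>+y. emeasure m (ball y 1) * ennreal (3 ^ DIM('a) * weight y) \<partial>lborel)"
    proof (intro nn_integral_cong)
      fix y :: 'a
      have "(\<integral>\<^sup>+x. (if dist x y < 1 then 1 else 0) * ennreal (3 ^ DIM('a) * weight y) \<partial>m)
          = (\<integral>\<^sup>+x. indicator (ball y 1) x * ennreal (3 ^ DIM('a) * weight y) \<partial>m)"
        by (intro nn_integral_cong) (simp add: indicator_def dist_commute)
      also have "\<dots> = emeasure m (ball y 1) * ennreal (3 ^ DIM('a) * weight y)"
        by (subst nn_integral_multc) (auto intro!: borel_measurable_indicator simp: radon_sets[OF m])
      finally show "(\<integral>\<^sup>+x. (if dist x y < 1 then 1 else 0) * ennreal (3 ^ DIM('a) * weight y) \<partial>m)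
          = emeasure m (ball y 1) * ennreal (3 ^ DIM('a) * weight y)" .
    qed
    also have "\<dots> \<le> (\<integral>\<^sup>+y. ennreal (C * 3 ^ DIM('a)) * ennreal (weight (y::'a)) \<partial>lborel)"
    proof (intro nn_integral_mono)
      fix y :: 'a
      have "emeasure m (ball y 1) * ennreal (3 ^ DIM('a) * weight y) \<le> ennreal C * ennreal (3 ^ DIM('a) * weight y)"
        using C by (intro mult_right_mono) auto
      also have "\<dots> = ennreal (C * 3 ^ DIM('a)) * ennreal (weight y)"
        using C weight_pos[of y] by (simp add: ennreal_mult[symmetric] mult.assoc)
      finally show "emeasure m (ball y 1) * ennreal (3 ^ DIM('a) * weight y) \<le> ennreal (C * 3 ^ DIM('a)) * ennreal (weight y)" .
    qed
    also have "\<dots> = ennreal (C * 3 ^ DIM('a) * I)"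
      using I C(2) by (simp add: nn_integral_cmult ennreal_mult)
    finally have "ennreal (1 / V) * (ennreal V * (\<integral>\<^sup>+x. weight x \<partial>m)) \<le> ennreal (1 / V) * ennreal (C * 3 ^ DIM('a) * I)"
      by (intro mult_left_mono) auto
    moreover have "ennreal (1 / V) * (ennreal V * (\<integral>\<^sup>+x. weight x \<partial>m)) = (\<integral>\<^sup>+x. weight x \<partial>m)"
      using V by (simp add: mult.assoc[symmetric] ennreal_mult[symmetric])
    ultimately show ?thesis
      using V I C(2) by (simp add: ennreal_mult[symmetric] mult_ac)
  qed
  then show ?thesis by blast
qed

lemma translation_bounded_weight:
  assumes m: "radon m" and b: "translation_bounded (m :: 'a::euclidean_space measure)"
  shows "(\<integral>\<^sup>+x. weight x \<partial>m) < \<infinity>"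
proof -
  obtain K :: real where K: "\<And>m :: 'a measure. \<And>C. radon m \<Longrightarrow>
    (\<And>a. emeasure m (ball a 1) \<le> ennreal C) \<Longrightarrow> 0 \<le> C \<Longrightarrow> (\<integral>\<^sup>+x. weight x \<partial>m) \<le> ennreal (K * C)"
    using nn_integral_weight_bound[where 'a='a] by blast
  obtain C where C: "\<And>a. emeasure m ((+) a ` cball 0 1) \<le> ennreal C"
    using b unfolding translation_bounded_def by (meson compact_cball)
  have "emeasure m (ball a 1) \<le> ennreal (max C 0)" for a
  proof -
    have "emeasure m (ball a 1) \<le> emeasure m ((+) a ` cball 0 1)"
    proof (rule emeasure_mono)
      show "ball a 1 \<subseteq> (+) a ` cball 0 1"
        using cball_translation[of a 0 1] by auto
      show "(+) a ` cball 0 1 \<in> sets m"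
        unfolding radon_sets[OF m] by (rule sets_borel_translate_image) auto
    qed
    also have "\<dots> \<le> ennreal (max C 0)" using C by (auto intro: order_trans ennreal_leI)
    finally show ?thesis .
  qed
  from K[OF m this] show ?thesis by (auto intro: le_less_trans)
qed

lemma cube_open: "open (cube r :: 'a::euclidean_space set)"
proof -
  have "cube r = box (- (r / 2) *\<^sub>R One) ((r / 2) *\<^sub>R One :: 'a)"
  proof (intro set_eqI)
    fix x :: 'a
    show "x \<in> cube r \<longleftrightarrow> x \<in> box (- (r / 2) *\<^sub>R One) ((r / 2) *\<^sub>R One)"
      unfolding cube_def mem_box mem_Collect_eq by (intro ball_cong refl) (simp, arith)
  qed
  then show ?thesis by (simp only: open_box)
qed

text \<open>Finitely many translates of the cube cover the unit ball and each carries mass at most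
  1, so every unit ball has mass at most \<open>card P\<close>, a number independent of the
  configuration.\<close>

lemma hard_core_weight:
  assumes "r > 0"
  obtains C where "\<And>\<Lambda> :: 'a::euclidean_space measure. \<Lambda> \<in> hard_core r \<Longrightarrow> (\<integral>\<^sup>+x. weight x \<partial>\<Lambda>) \<le> ennreal C"
proof -
  obtain K :: real where K: "\<And>m :: 'a measure. \<And>C. radon m \<Longrightarrow>
    (\<And>a. emeasure m (ball a 1) \<le> ennreal C) \<Longrightarrow> 0 \<le> C \<Longrightarrow> (\<integral>\<^sup>+x. weight x \<partial>m) \<le> ennreal (K * C)"
    using nn_integral_weight_bound[where 'a='a] by blast
  have "cball (0::'a) 1 \<subseteq> (\<Union>p\<in>cball 0 1. (+) p ` cube r)"
  proof
    fix x :: 'a assume "x \<in> cball 0 1"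
    moreover have "x \<in> (+) x ` cube r" using assms by (auto simp: cube_def image_iff)
    ultimately show "x \<in> (\<Union>p\<in>cball 0 1. (+) p ` cube r)" by blast
  qed
  moreover have "open ((+) p ` cube r)" for p :: 'a by (intro open_translation cube_open)
  ultimately obtain P where P: "P \<subseteq> cball (0::'a) 1" "finite P" "cball 0 1 \<subseteq> (\<Union>p\<in>P. (+) p ` cube r)"
    using compactE_image[of "cball (0::'a) 1" "cball 0 1" "\<lambda>p. (+) p ` cube r"] by auto
  have "(\<integral>\<^sup>+x. weight x \<partial>\<Lambda>) \<le> ennreal (K * real (card P))" if L: "\<Lambda> \<in> hard_core r" for \<Lambda> :: "'a measure"
  proof (rule K)
    show r: "radon \<Lambda>" using L by (auto simp: hard_core_def intro: point_measures_radon)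
    fix a :: 'a
    have cubes: "(+) (a + p) ` cube r \<in> sets \<Lambda>" for p
      unfolding radon_sets[OF r] by (intro sets_borel_translate_image borel_open cube_open)
    have "ball a 1 \<subseteq> (\<Union>p\<in>P. (+) (a + p) ` cube r)"
    proof
      fix x assume "x \<in> ball a 1"
      then have "x - a \<in> cball 0 1" by (simp add: dist_norm norm_minus_commute)
      then obtain p c where "p \<in> P" "c \<in> cube r" "x - a = p + c" using P(3) by blast
      then have "x = (a + p) + c" by (simp add: algebra_simps)
      then show "x \<in> (\<Union>p\<in>P. (+) (a + p) ` cube r)" using \<open>p \<in> P\<close> \<open>c \<in> cube r\<close> by blast
    qed
    then have "emeasure \<Lambda> (ball a 1) \<le> emeasure \<Lambda> (\<Union>p\<in>P. (+) (a + p) ` cube r)"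
      using cubes P(2) by (intro emeasure_mono sets.finite_UN) auto
    also have "\<dots> \<le> (\<Sum>p\<in>P. emeasure \<Lambda> ((+) (a + p) ` cube r))"
      using cubes P(2) by (intro emeasure_subadditive_finite) auto
    also have "\<dots> \<le> (\<Sum>p\<in>P. 1)"
      using L by (intro sum_mono) (auto simp: hard_core_def)
    also have "\<dots> = ennreal (real (card P))" by (simp add: ennreal_of_nat_eq_real_of_nat)
    finally show "emeasure \<Lambda> (ball a 1) \<le> ennreal (real (card P))" .
  qed simp
  then show ?thesis by (rule that)
qed

subsection \<open>The process on its support\<close>

context ud_ergodic_process
begin

text \<open>\<open>X\<close> has full measure, so the restriction is again a probability measure,
  and now every configuration, not almost every one, obeys the uniform bounds.\<close>

abbreviation \<nu> :: "'a measure measure" where "\<nu> \<equiv> restrict_space \<mu> X"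

lemma space_\<mu>: "space \<mu> = point_measures"
proof -
  have "space \<mu> = space vague_borel" by (rule sets_eq_imp_space_eq[OF sets_eq])
  then show ?thesis unfolding vague_borel_def by (simp add: space_measure_of_conv)
qed

lemma vague_opens_Pow: "{U. openin vague_topology U} \<subseteq> Pow point_measures"
  using openin_subset[of vague_topology] by auto

lemma sets_\<mu>: "sets \<mu> = sigma_sets point_measures {U. openin vague_topology U}"
  unfolding sets_eq vague_borel_def by (rule sets_measure_of[OF vague_opens_Pow])

lemma vague_open_sets: "openin vague_topology U \<Longrightarrow> U \<in> sets \<mu>"
  unfolding sets_\<mu> by (rule sigma_sets.Basic) simp

lemma X_closed: "closedin vague_topology X"
  using support by (simp add: is_support_def)

lemma X_sets [measurable]: "X \<in> sets \<mu>"
proof -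
  have "openin vague_topology (point_measures - X)"
    using X_closed by (simp add: closedin_def)
  then have "space \<mu> - (point_measures - X) \<in> sets \<mu>" by (intro sets.compl_sets vague_open_sets)
  moreover have "X \<subseteq> point_measures" using closedin_subset[OF X_closed] by simp
  ultimately show ?thesis unfolding space_\<mu> by (simp add: double_diff)
qed

lemma X_point_measures: "\<Lambda> \<in> X \<Longrightarrow> \<Lambda> \<in> point_measures"
  using closedin_subset[OF X_closed] by auto

lemma X_radon: "\<Lambda> \<in> X \<Longrightarrow> radon \<Lambda>"
  by (intro point_measures_radon X_point_measures)

lemma space_\<nu> [simp]: "space \<nu> = X"
  by (rule space_restrict_space2[OF X_sets])

lemma measurable_\<nu>_cong:
  "(\<And>\<Lambda>. \<Lambda> \<in> X \<Longrightarrow> f \<Lambda> = g \<Lambda>) \<Longrightarrow> g \<in> \<nu> \<rightarrow>\<^sub>M L \<Longrightarrow> f \<in> \<nu> \<rightarrow>\<^sub>M L"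
  by (subst measurable_cong[of \<nu> f g]) auto

lemma prob_space_\<nu>: "prob_space \<nu>"
proof
  show "emeasure \<nu> (space \<nu>) = 1"
    using support by (simp add: emeasure_restrict_space is_support_def)
qed

lemma sets_\<nu>_iff: "D \<in> sets \<nu> \<longleftrightarrow> D \<in> sets \<mu> \<and> D \<subseteq> X"
  using sets_restrict_space_iff[of X \<mu> D] sets.sets_into_space X_sets by auto

lemma continuous_translate: "continuous_map vague_topology vague_topology (translate (t::'a))"
proof -
  have "continuous_map vague_topology (prod_topology euclidean vague_topology) (\<lambda>\<Lambda>. (t, \<Lambda>))"
    by (simp add: continuous_map_pairedI)
  from continuous_map_compose[OF this continuous_map_translate] show ?thesis
    by (simp add: comp_def)
qed

text \<open>The preimage of \<open>X\<close> under a translation is closed by continuity and of full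
  measure by invariance, so it contains the support.\<close>

lemma X_translate: assumes "\<Lambda> \<in> X" shows "translate t \<Lambda> \<in> X"
proof -
  let ?Y = "{\<Lambda> \<in> point_measures. translate t \<Lambda> \<in> X}"
  have "closedin vague_topology ?Y"
    using closedin_continuous_map_preimage[OF continuous_translate X_closed] by simp
  moreover have "emeasure \<mu> ?Y = 1"
  proof -
    have "?Y = translate t -` X \<inter> space \<mu>" by (auto simp: space_\<mu>)
    then have "emeasure \<mu> ?Y = emeasure (distr \<mu> \<mu> (translate t)) X"
      by (simp add: emeasure_distr[OF translate_measurable X_sets])
    then show ?thesis using support by (simp add: invariant is_support_def)
  qed
  ultimately have "X \<subseteq> ?Y" using support unfolding is_support_def by blast
  then show ?thesis using assms by blast
qed

lemma translate_\<nu> [measurable]: "translate t \<in> \<nu> \<rightarrow>\<^sub>M \<nu>"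
  using X_translate by (intro measurable_restrict_space3 translate_measurable) auto

lemma distr_\<nu>: "distr \<nu> \<nu> (translate t) = \<nu>"
proof (rule measure_eqI)
  fix D assume "D \<in> sets (distr \<nu> \<nu> (translate t))"
  then have D: "D \<in> sets \<mu>" "D \<subseteq> X" "D \<in> sets \<nu>" by (auto simp: sets_\<nu>_iff)
  have eq: "translate t -` D \<inter> X = translate t -` D \<inter> space \<mu>"
  proof -
    have "\<Lambda> \<in> X" if "\<Lambda> \<in> point_measures" "translate t \<Lambda> \<in> D" for \<Lambda>
      using X_translate[of "translate t \<Lambda>" "- t"] that D(2) translate_translate[of \<Lambda> "- t" t]
        translate_0[of \<Lambda>] point_measures_radon[of \<Lambda>] by auto
    then show ?thesis using X_point_measures by (auto simp: space_\<mu>)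
  qed
  have "emeasure (distr \<nu> \<nu> (translate t)) D = emeasure \<nu> (translate t -` D \<inter> X)"
    using D(3) by (simp add: emeasure_distr)
  also have "\<dots> = emeasure \<mu> (translate t -` D \<inter> space \<mu>)"
    unfolding eq[symmetric] by (intro emeasure_restrict_space) auto
  also have "\<dots> = emeasure (distr \<mu> \<mu> (translate t)) D"
    by (rule emeasure_distr[OF translate_measurable D(1), symmetric])
  also have "\<dots> = emeasure \<nu> D"
    using D by (simp add: invariant emeasure_restrict_space)
  finally show "emeasure (distr \<nu> \<nu> (translate t)) D = emeasure \<nu> D" .
qed simp

lemma X_weight:
  obtains C where "C \<ge> 0" "\<And>\<Lambda>. \<Lambda> \<in> X \<Longrightarrow> (\<integral>\<^sup>+x. weight x \<partial>\<Lambda>) \<le> ennreal C"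
proof -
  obtain r where "r > 0" "X \<subseteq> hard_core r" using uniformly_discrete by blast
  moreover obtain C where "\<And>\<Lambda> :: 'a measure. \<Lambda> \<in> hard_core r \<Longrightarrow> (\<integral>\<^sup>+x. weight x \<partial>\<Lambda>) \<le> ennreal C"
    using hard_core_weight[OF \<open>r > 0\<close>] by blast
  ultimately have "\<And>\<Lambda>. \<Lambda> \<in> X \<Longrightarrow> (\<integral>\<^sup>+x. weight x \<partial>\<Lambda>) \<le> ennreal (max C 0)"
    by (auto intro: order_trans ennreal_leI)
  then show ?thesis by (intro that[of "max C 0"]) auto
qed

text \<open>On a ball containing \<open>A\<close> the weight is at least \<open>1 / p\<close>, so
  the uniform bound on its integral bounds the mass of \<open>A\<close>.\<close>

lemma X_bounded:
  assumes A: "bounded A"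
  obtains C where "C \<ge> 0" "\<And>\<Lambda>. \<Lambda> \<in> X \<Longrightarrow> emeasure \<Lambda> A \<le> ennreal C"
proof -
  obtain C where C: "C \<ge> 0" "\<And>\<Lambda>. \<Lambda> \<in> X \<Longrightarrow> (\<integral>\<^sup>+x. weight x \<partial>\<Lambda>) \<le> ennreal C" using X_weight by blast
  obtain R where R: "\<And>x. x \<in> A \<Longrightarrow> norm x \<le> R" using A by (auto simp: bounded_iff)
  define p where "p = (1 + max R 0) ^ (2 * DIM('a))"
  have p: "p > 0" by (simp add: p_def)
  have "emeasure \<Lambda> A \<le> ennreal (p * C)" if L: "\<Lambda> \<in> X" for \<Lambda>
  proof -
    note s = radon_sets[OF X_radon[OF L]]
    have "1 \<le> p * weight x" if "norm x \<le> max R 0" for x :: 'a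
    proof -
      have "(1 + norm x) ^ (2 * DIM('a)) \<le> p" unfolding p_def using that by (intro power_mono) auto
      then have "inverse p \<le> inverse ((1 + norm x) ^ (2 * DIM('a)))"
        by (intro le_imp_inverse_le) (auto simp: add_pos_nonneg)
      also have "\<dots> \<le> weight x" by (rule weight_ge)
      finally show ?thesis using p by (simp add: field_simps)
    qed
    then have le: "indicator (cball 0 (max R 0)) x \<le> ennreal p * ennreal (weight x)" for x :: 'a
      using p weight_pos[of x] by (auto simp: indicator_def ennreal_mult[symmetric] less_imp_le ennreal_1[symmetric] simp del: ennreal_1 intro!: ennreal_leI)
    have "emeasure \<Lambda> A \<le> emeasure \<Lambda> (cball 0 (max R 0))"
      using R s by (intro emeasure_mono) (auto simp: le_max_iff_disj)
    also have "\<dots> = (\<integral>\<^sup>+x. indicator (cball 0 (max R 0)) x \<partial>\<Lambda>)" using s by simp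
    also have "\<dots> \<le> (\<integral>\<^sup>+x. ennreal p * weight x \<partial>\<Lambda>)" by (intro nn_integral_mono le)
    also have "\<dots> = ennreal p * (\<integral>\<^sup>+x. weight x \<partial>\<Lambda>)"
      by (intro nn_integral_cmult) (simp add: radon_measurable[OF X_radon[OF L]])
    also have "\<dots> \<le> ennreal p * ennreal C" using C(2)[OF L] by (intro mult_left_mono) auto
    also have "\<dots> = ennreal (p * C)" using p C by (simp add: ennreal_mult)
    finally show ?thesis .
  qed
  then show ?thesis using p C by (intro that[of "p * C"]) auto
qed

lemma openin_translate_window:
  assumes D: "openin vague_topology D" and G: "open G"
  shows "openin (prod_topology euclidean vague_topology) {(x, \<Lambda>). x \<in> G \<and> \<Lambda> \<in> point_measures \<and> translate (- x) \<Lambda> \<in> (D :: 'a measure set)}"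
proof -
  have "continuous_map euclidean euclidean (uminus :: 'a \<Rightarrow> 'a)"
    using continuous_on_minus[OF continuous_on_id, of UNIV] by simp
  from continuous_map_compose[OF continuous_map_fst this]
  have "continuous_map (prod_topology euclidean (vague_topology :: 'a measure topology)) euclidean (\<lambda>p. - fst p :: 'a)"
    by (simp add: comp_def)
  from continuous_map_pairedI[OF this continuous_map_snd]
  have "continuous_map (prod_topology euclidean vague_topology) (prod_topology euclidean (vague_topology :: 'a measure topology))
      (\<lambda>p. (- fst p :: 'a, snd p))" by simp
  from continuous_map_compose[OF this continuous_map_translate]
  have c: "continuous_map (prod_topology euclidean vague_topology) vague_topology (\<lambda>p. translate (- fst p) (snd p :: 'a measure))"
    by (simp add: comp_def split_beta)
  have "openin (prod_topology euclidean vague_topology) (G \<times> (point_measures :: 'a measure set))"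
    using G openin_topspace[of vague_topology] by (auto simp: openin_prod_Times_iff)
  note openin_Int[OF this openin_continuous_map_preimage[OF c D]]
  moreover have "G \<times> point_measures \<inter> {p \<in> topspace (prod_topology euclidean vague_topology). translate (- fst p) (snd p) \<in> D}
      = {(x, \<Lambda>). x \<in> G \<and> \<Lambda> \<in> point_measures \<and> translate (- x) \<Lambda> \<in> D}"
    by auto
  ultimately show ?thesis by simp
qed

text \<open>For a fixed configuration only sections of open sets have to be examined, because the
  open sets generate \<open>sets \<mu>\<close>.\<close>

lemma section_borel:
  assumes L: "\<Lambda> \<in> point_measures" and D: "D \<in> sets \<mu>"
  shows "{x. translate (- x) \<Lambda> \<in> D} \<in> sets borel"
proof -
  have "(\<lambda>x. translate (- x) \<Lambda>) \<in> borel \<rightarrow>\<^sub>M \<mu>"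
  proof (rule measurable_sigma_sets[OF sets_\<mu> vague_opens_Pow])
    show "(\<lambda>x. translate (- x) \<Lambda>) \<in> space borel \<rightarrow> point_measures"
      using translate_point_measures[OF L] by auto
    fix U assume "U \<in> {U. openin (vague_topology :: 'a measure topology) U}"
    then have "openin vague_topology U" by simp
    from open_section[OF openin_translate_window[OF this open_UNIV], of \<Lambda>] show "(\<lambda>x. translate (- x) \<Lambda>) -` U \<inter> space borel \<in> sets borel"
      using L by (intro borel_open) (simp add: vimage_def)
  qed
  from measurable_sets[OF this D] show ?thesis by (simp add: vimage_def)
qed

text \<open>Two Dynkin arguments extend the semicontinuity from open sets to Borel sets, first in the
  window and then in the set of configurations.\<close>

lemma emeasure_section_open_measurable:
  assumes D: "openin vague_topology D" and A: "A \<in> sets borel" and R: "bounded A"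
  shows "(\<lambda>\<Lambda>. emeasure \<Lambda> (A \<inter> {x. translate (- x) \<Lambda> \<in> D})) \<in> borel_measurable \<nu>"
proof -
  obtain R where R: "A \<subseteq> ball 0 R" using bounded_subset_ballD[OF R] by blast
  \<comment> \<open>Semicontinuity asks for an open window and complements ask for finite mass. The
    ball around \<open>A\<close> provides both; \<open>A\<close> itself enters as the set over which
    the Dynkin induction runs.\<close>
  let ?S = "\<lambda>\<Lambda>. ball 0 R \<inter> {x. translate (- x) \<Lambda> \<in> D}"
  have S: "?S \<Lambda> \<in> sets borel" "emeasure \<Lambda> (?S \<Lambda>) < \<infinity>" if "\<Lambda> \<in> X" for \<Lambda>
    using section_borel[OF X_point_measures[OF that] vague_open_sets[OF D]] radon_finite[OF X_radon[OF that], of "?S \<Lambda>"]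
    by (auto simp: bounded_Int)
  have open_case: "(\<lambda>\<Lambda>. emeasure \<Lambda> (G \<inter> ?S \<Lambda>)) \<in> borel_measurable \<nu>" if "open G" for G
  proof -
    have G: "open (G \<inter> ball 0 R)" using that by auto
    let ?W = "{(x, \<Lambda>). x \<in> G \<inter> ball 0 R \<and> \<Lambda> \<in> point_measures \<and> translate (- x) \<Lambda> \<in> D}"
    have "(\<lambda>\<Lambda>. emeasure \<Lambda> {x. (x, \<Lambda>) \<in> ?W}) \<in> borel_measurable \<mu>"
      using vague_open_sets[OF vague_section_lower[OF openin_translate_window[OF D G]]]
      by (intro borel_measurableI_greater) (simp add: space_\<mu>)
    then have m: "(\<lambda>\<Lambda>. emeasure \<Lambda> {x. (x, \<Lambda>) \<in> ?W}) \<in> borel_measurable \<nu>" by (rule measurable_restrict_space1)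
    have "emeasure \<Lambda> (G \<inter> ?S \<Lambda>) = emeasure \<Lambda> {x. (x, \<Lambda>) \<in> ?W}" if "\<Lambda> \<in> space \<nu>" for \<Lambda>
    proof -
      have "{x. (x, \<Lambda>) \<in> ?W} = G \<inter> ?S \<Lambda>" using that X_point_measures by auto
      then show ?thesis by (simp only:)
    qed
    from measurable_cong[OF this, THEN iffD2, OF _ m] show ?thesis by simp
  qed
  have "Int_stable (Collect open :: 'a set set)" "Collect open \<subseteq> Pow (UNIV :: 'a set)" "A \<in> sigma_sets UNIV (Collect open)"
    using A by (auto simp: Int_stable_def borel_def)
  then have "(\<lambda>\<Lambda>. emeasure \<Lambda> (A \<inter> ?S \<Lambda>)) \<in> borel_measurable \<nu>"
  proof (induction rule: sigma_sets_induct_disjoint)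
    case (basic G)
    then show ?case using open_case by simp
  next
    case empty
    then show ?case by simp
  next
    case (compl A)
    then have A: "A \<in> sets borel" by (simp add: borel_def)
    have [measurable]: "(\<lambda>\<Lambda>. emeasure \<Lambda> (?S \<Lambda>)) \<in> borel_measurable \<nu>"
      using open_case[OF open_UNIV] by simp
    have "emeasure \<Lambda> ((UNIV - A) \<inter> ?S \<Lambda>) = emeasure \<Lambda> (?S \<Lambda>) - emeasure \<Lambda> (A \<inter> ?S \<Lambda>)" if "\<Lambda> \<in> X" for \<Lambda>
    proof -
      have "(UNIV - A) \<inter> ?S \<Lambda> = ?S \<Lambda> - A \<inter> ?S \<Lambda>" by auto
      moreover have "emeasure \<Lambda> (A \<inter> ?S \<Lambda>) \<noteq> \<infinity>"
        using le_less_trans[OF emeasure_mono[OF Int_lower2] S(2)[OF that], of A] S(1)[OF that] radon_sets[OF X_radon[OF that]] by simp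
      ultimately show ?thesis
        using S[OF that] A radon_sets[OF X_radon[OF that]] by (simp only:) (intro emeasure_Diff; auto)
    qed
    then show ?case using compl by - (rule measurable_\<nu>_cong, assumption, measurable)
  next
    case (union A)
    have A: "A i \<in> sets borel" for i using union by (auto simp: borel_def)
    have "emeasure \<Lambda> (\<Union> (range A) \<inter> ?S \<Lambda>) = (\<Sum>i. emeasure \<Lambda> (A i \<inter> ?S \<Lambda>))" if "\<Lambda> \<in> X" for \<Lambda>
    proof -
      have "\<Union> (range A) \<inter> ?S \<Lambda> = (\<Union>i. A i \<inter> ?S \<Lambda>)" by auto
      moreover have "disjoint_family (\<lambda>i. A i \<inter> ?S \<Lambda>)"
        using union(1) unfolding disjoint_family_on_def by blast
      moreover have "range (\<lambda>i. A i \<inter> ?S \<Lambda>) \<subseteq> sets \<Lambda>"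
        unfolding radon_sets[OF X_radon[OF that]] by (intro image_subsetI sets.Int[OF A S(1)] that)
      ultimately show ?thesis by (simp only: suminf_emeasure)
    qed
    then show ?case using union by - (rule measurable_\<nu>_cong, assumption, measurable)
  qed
  moreover have "A \<inter> ?S \<Lambda> = A \<inter> {x. translate (- x) \<Lambda> \<in> D}" for \<Lambda> using R by auto
  ultimately show ?thesis by simp
qed

text \<open>The special case in which the condition on the translated configuration always holds,
  followed by an exhaustion by balls to drop boundedness.\<close>

lemma emeasure_measurable:
  assumes A: "A \<in> sets borel"
  shows "(\<lambda>\<Lambda>. emeasure \<Lambda> A) \<in> borel_measurable \<nu>"
proof -
  have m: "(\<lambda>\<Lambda>. emeasure \<Lambda> (A \<inter> ball 0 (real n))) \<in> borel_measurable \<nu>" for n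
  proof (rule measurable_\<nu>_cong)
    have "openin vague_topology (point_measures :: 'a measure set)"
      using openin_topspace[of vague_topology] by simp
    then show "(\<lambda>\<Lambda>. emeasure \<Lambda> (A \<inter> ball 0 (real n) \<inter> {x. translate (- x) \<Lambda> \<in> point_measures})) \<in> borel_measurable \<nu>"
      using A by (intro emeasure_section_open_measurable) (auto simp: bounded_Int)
    show "emeasure \<Lambda> (A \<inter> ball 0 (real n))
        = emeasure \<Lambda> (A \<inter> ball 0 (real n) \<inter> {x. translate (- x) \<Lambda> \<in> point_measures})" if "\<Lambda> \<in> X" for \<Lambda>
      using translate_point_measures[OF X_point_measures[OF that]] by simp
  qed
  have eq: "emeasure \<Lambda> A = (SUP n. emeasure \<Lambda> (A \<inter> ball 0 (real n)))" if "\<Lambda> \<in> X" for \<Lambda>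
  proof -
    have "(\<Union>n. A \<inter> ball 0 (real n)) = A"
    proof -
      have "\<exists>n::nat. x \<in> ball 0 (real n)" for x :: 'a using reals_Archimedean2[of "norm x"] by simp
      then show ?thesis by blast
    qed
    moreover have "(SUP n. emeasure \<Lambda> (A \<inter> ball 0 (real n))) = emeasure \<Lambda> (\<Union>n. A \<inter> ball 0 (real n))"
    proof (rule SUP_emeasure_incseq)
      show "range (\<lambda>n. A \<inter> ball 0 (real n)) \<subseteq> sets \<Lambda>"
        unfolding radon_sets[OF X_radon[OF that]] by (intro image_subsetI sets.Int A borel_open open_ball)
    qed (auto simp: incseq_def)
    ultimately show ?thesis by simp
  qed
  show ?thesis by (rule measurable_\<nu>_cong[OF eq]) (use m in measurable)
qed

lemma emeasure_section_measurable:
  assumes D: "D \<in> sets \<mu>" and A: "A \<in> sets borel" "bounded A"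
  shows "(\<lambda>\<Lambda>. emeasure \<Lambda> (A \<inter> {x. translate (- x) \<Lambda> \<in> D})) \<in> borel_measurable \<nu>"
proof -
  let ?S = "\<lambda>D \<Lambda>. A \<inter> {x. translate (- x) \<Lambda> \<in> D}"
  have S: "?S D \<Lambda> \<in> sets \<Lambda>" if "\<Lambda> \<in> X" "D \<in> sets \<mu>" for \<Lambda> D
    using section_borel[OF X_point_measures[OF that(1)] that(2)] A(1) radon_sets[OF X_radon[OF that(1)]] by auto
  have fin: "emeasure \<Lambda> (A \<inter> T) \<noteq> \<infinity>" if "\<Lambda> \<in> X" for \<Lambda> T
    using radon_finite[OF X_radon[OF that], of "A \<inter> T"] A(2) by (auto simp: bounded_Int)
  have \<mu>_iff: "T \<in> sigma_sets point_measures {U. openin vague_topology U} \<Longrightarrow> T \<in> sets \<mu>" for T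
    by (simp add: sets_\<mu>)
  have "Int_stable {U. openin vague_topology (U :: 'a measure set)}" by (auto simp: Int_stable_def)
  from this vague_opens_Pow D[unfolded sets_\<mu>]
  show "(\<lambda>\<Lambda>. emeasure \<Lambda> (?S D \<Lambda>)) \<in> borel_measurable \<nu>"
  proof (induction rule: sigma_sets_induct_disjoint)
    case (basic U)
    then show ?case using emeasure_section_open_measurable[OF _ A] by simp
  next
    case empty
    then show ?case by simp
  next
    case (compl T)
    have "emeasure \<Lambda> (?S (point_measures - T) \<Lambda>) = emeasure \<Lambda> A - emeasure \<Lambda> (?S T \<Lambda>)" if "\<Lambda> \<in> X" for \<Lambda>
    proof -
      have "?S (point_measures - T) \<Lambda> = A - ?S T \<Lambda>"
        using translate_point_measures[OF X_point_measures[OF that]] by auto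
      then show ?thesis
        using fin[OF that] S[OF that \<mu>_iff[OF compl(1)]] A(1) radon_sets[OF X_radon[OF that]]
        by (simp only:) (intro emeasure_Diff; auto)
    qed
    note eq = this
    show ?case
    proof (rule measurable_\<nu>_cong)
      show "(\<lambda>\<Lambda>. emeasure \<Lambda> A - emeasure \<Lambda> (?S T \<Lambda>)) \<in> borel_measurable \<nu>"
        by (intro borel_measurable_minus_ennreal emeasure_measurable A(1) compl(2))
    qed (rule eq)
  next
    case (union T)
    have "emeasure \<Lambda> (?S (\<Union> (range T)) \<Lambda>) = (\<Sum>i. emeasure \<Lambda> (?S (T i) \<Lambda>))" if "\<Lambda> \<in> X" for \<Lambda>
    proof -
      have "?S (\<Union> (range T)) \<Lambda> = (\<Union>i. ?S (T i) \<Lambda>)" by auto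
      moreover have "disjoint_family (\<lambda>i. ?S (T i) \<Lambda>)"
        using union(1) unfolding disjoint_family_on_def by blast
      moreover have "range (\<lambda>i. ?S (T i) \<Lambda>) \<subseteq> sets \<Lambda>"
        using S[OF that \<mu>_iff] union(2) by blast
      ultimately show ?thesis by (simp only: suminf_emeasure)
    qed
    then show ?case using union by - (rule measurable_\<nu>_cong, assumption, measurable)
  qed
qed

end

context ud_ergodic_process
begin

subsection \<open>The Palm measure and its first moment\<close>

text \<open>One constant fixed for the whole context, so that it can be a parameter when
  \<open>weighted_kernel\<close> is instantiated.\<close>

definition weight_bound :: real where
  "weight_bound = (SOME C. C \<ge> 0 \<and> (\<forall>\<Lambda>\<in>X. (\<integral>\<^sup>+x. weight x \<partial>\<Lambda>) \<le> ennreal C))"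

lemma weight_bound: "weight_bound \<ge> 0" "\<Lambda> \<in> X \<Longrightarrow> (\<integral>\<^sup>+x. weight x \<partial>\<Lambda>) \<le> ennreal weight_bound"
proof -
  have "\<exists>C. C \<ge> 0 \<and> (\<forall>\<Lambda>\<in>X. (\<integral>\<^sup>+x. weight x \<partial>\<Lambda>) \<le> ennreal C)"
    using X_weight by metis
  from someI_ex[OF this]
  show "weight_bound \<ge> 0" "\<Lambda> \<in> X \<Longrightarrow> (\<integral>\<^sup>+x. weight x \<partial>\<Lambda>) \<le> ennreal weight_bound"
    unfolding weight_bound_def by blast+
qed

lemma weighted_kernel_\<nu>:
  assumes k: "k \<in> L \<rightarrow>\<^sub>M \<nu>"
  shows "weighted_kernel L borel k weight weight_bound"
proof
  have kX: "k l \<in> X" if "l \<in> space L" for l using measurable_space[OF k that] by simp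
  show "sets (k l) = sets borel" if "l \<in> space L" for l using radon_sets[OF X_radon[OF kX[OF that]]] .
  show "(\<lambda>l. emeasure (k l) A) \<in> borel_measurable L" if "A \<in> sets borel" for A
    using measurable_compose[OF k emeasure_measurable[OF that]] .
  show "(\<integral>\<^sup>+x. weight x \<partial>k l) \<le> ennreal weight_bound" if "l \<in> space L" for l
    using weight_bound(2)[OF kX[OF that]] .
qed (auto simp: weight_pos)

lemma nn_integral_configuration:
  assumes "k \<in> L \<rightarrow>\<^sub>M \<nu>" "(\<lambda>(l, x). f l x) \<in> borel_measurable (L \<Otimes>\<^sub>M borel)"
  shows "(\<lambda>l. \<integral>\<^sup>+x. f l x \<partial>k l) \<in> borel_measurable L"
  using weighted_kernel.nn_integral_kernel2[OF weighted_kernel_\<nu>[OF assms(1)] assms(2)] .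

lemma translate_vector_measurable:
  assumes "\<Lambda> \<in> X" shows "(\<lambda>x. translate (- x) \<Lambda>) \<in> borel \<rightarrow>\<^sub>M \<nu>"
proof (rule measurableI)
  show "translate (- x) \<Lambda> \<in> space \<nu>" for x using X_translate[OF assms] by simp
  fix D assume "D \<in> sets \<nu>"
  then have "D \<in> sets \<mu>" by (simp add: sets_\<nu>_iff)
  from section_borel[OF X_point_measures[OF assms] this]
  show "(\<lambda>x. translate (- x) \<Lambda>) -` D \<inter> space borel \<in> sets borel" by (simp add: vimage_def)
qed

lemma integrable_configuration:
  assumes "\<Lambda> \<in> X" "f \<in> borel_measurable borel" "\<And>x. cmod (f x) \<le> C * weight x"
  shows "integrable \<Lambda> f"
proof (rule integrable_le_weight[OF radon_sets[OF X_radon[OF assms(1)]] _ assms(2,3)])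
  show "(\<integral>\<^sup>+x. weight x \<partial>\<Lambda>) < \<infinity>" using weight_bound(2)[OF assms(1)] by (auto intro: le_less_trans)
qed

lemma schwartz_integrable_configuration:
  assumes "\<Lambda> \<in> X" "f \<in> schwartz" shows "integrable \<Lambda> f"
  using rapid_le_weight[OF schwartz_rapid[OF assms(2)]] integrable_configuration[OF assms(1) schwartz_measurable[OF assms(2)]]
  by blast

lemma counting_schwartz_measurable:
  assumes f: "f \<in> schwartz" shows "counting f \<in> borel_measurable \<nu>"
proof -
  have id: "(\<lambda>\<Lambda>. \<Lambda>) \<in> \<nu> \<rightarrow>\<^sub>M \<nu>" by simp
  show ?thesis
    unfolding counting_def[abs_def]
    by (rule weighted_kernel.integral_kernel[OF weighted_kernel_\<nu>[OF id] schwartz_measurable[OF f]])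
      (simp add: schwartz_integrable_configuration f)
qed

text \<open>Boundedness over all of \<open>X\<close> places the counting functions in
  \<open>L2 \<nu>\<close>, since \<open>\<nu>\<close> is a probability measure.\<close>

lemma counting_schwartz_bounded:
  assumes f: "f \<in> schwartz" shows "\<exists>C. \<forall>\<Lambda>\<in>X. cmod (counting f \<Lambda>) \<le> C"
proof -
  obtain C where C: "C \<ge> 0" "\<And>x. cmod (f x) \<le> C * weight x"
    using rapid_le_weight[OF schwartz_rapid[OF f]] by blast
  have "cmod (counting f \<Lambda>) \<le> C * weight_bound" if L: "\<Lambda> \<in> X" for \<Lambda>
  proof -
    have wm: "weight \<in> borel_measurable \<Lambda>" by (rule radon_measurable[OF X_radon[OF L] weight_measurable])
    have wb: "(\<integral>\<^sup>+x. weight x \<partial>\<Lambda>) \<le> ennreal weight_bound" by (rule weight_bound(2)[OF L])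
    then have "integrable \<Lambda> weight"
      using wm by (intro integrableI_nonneg AE_I2 less_imp_le weight_pos) (auto intro: le_less_trans)
    moreover from this have "(\<integral>\<^sup>+x. weight x \<partial>\<Lambda>) = ennreal (\<integral>x. weight x \<partial>\<Lambda>)"
      by (intro nn_integral_eq_integral AE_I2 less_imp_le weight_pos)
    ultimately have i: "integrable \<Lambda> weight" "(\<integral>x. weight x \<partial>\<Lambda>) \<le> weight_bound"
      using wb weight_bound(1) by auto
    have "cmod (counting f \<Lambda>) \<le> (\<integral>x. cmod (f x) \<partial>\<Lambda>)" unfolding counting_def by (rule integral_norm_bound)
    also have "\<dots> \<le> (\<integral>x. C * weight x \<partial>\<Lambda>)"
      using C i schwartz_integrable_configuration[OF L f] by (intro integral_mono) auto
    also have "\<dots> \<le> C * weight_bound" using i(2) C(1) by (simp add: mult_left_mono)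
    finally show ?thesis .
  qed
  then show ?thesis by blast
qed

end

locale palm = ud_ergodic_process X \<mu> for X :: "'a::euclidean_space measure set" and \<mu> +
  fixes B :: "'a set"
  assumes B: "B \<in> sets borel" "bounded B" "emeasure lborel B > 0"
begin

abbreviation b :: ennreal where "b \<equiv> emeasure lborel B"

lemma b: "b \<noteq> 0" "b \<noteq> \<infinity>"
  using B emeasure_bounded_finite[of B] by auto

lemma b_cancel: "b * (c / b) = c"
  using b by (simp add: ennreal_times_divide mult.commute[of b] ennreal_mult_divide_eq)

text \<open>The contribution of a single configuration: each of its points in \<open>B\<close> is
  moved to the origin, with the normalisation \<open>1 / b\<close> included.\<close>

definition palm_kernel :: "'a measure \<Rightarrow> 'a measure measure" where
  "palm_kernel \<Lambda> = distr (density \<Lambda> (\<lambda>x. indicator B x / b)) \<nu> (\<lambda>x. translate (- x) \<Lambda>)"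

lemma sets_palm_kernel [simp]: "sets (palm_kernel \<Lambda>) = sets \<nu>"
  by (simp add: palm_kernel_def)

lemma nn_integral_palm_kernel:
  assumes L: "\<Lambda> \<in> X" and F: "F \<in> borel_measurable \<nu>"
  shows "(\<integral>\<^sup>+N. F N \<partial>palm_kernel \<Lambda>) = (\<integral>\<^sup>+x. indicator B x / b * F (translate (- x) \<Lambda>) \<partial>\<Lambda>)"
proof -
  have [measurable_cong]: "sets \<Lambda> = sets borel" by (rule radon_sets[OF X_radon[OF L]])
  note translate_vector_measurable[OF L, measurable] F[measurable] B(1)[measurable]
  show ?thesis
    unfolding palm_kernel_def
    by (subst nn_integral_distr, measurable, subst nn_integral_density) auto
qed

lemma emeasure_palm_kernel:
  assumes L: "\<Lambda> \<in> X" and D: "D \<in> sets \<nu>"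
  shows "emeasure (palm_kernel \<Lambda>) D = emeasure \<Lambda> (B \<inter> {x. translate (- x) \<Lambda> \<in> D}) / b"
proof -
  have S: "B \<inter> {x. translate (- x) \<Lambda> \<in> D} \<in> sets \<Lambda>"
    using section_borel[OF X_point_measures[OF L], of D] D B(1) radon_sets[OF X_radon[OF L]]
    by (auto simp: sets_\<nu>_iff)
  have "emeasure (palm_kernel \<Lambda>) D = (\<integral>\<^sup>+N. indicator D N \<partial>palm_kernel \<Lambda>)"
    using D by simp
  also have "\<dots> = (\<integral>\<^sup>+x. indicator B x / b * indicator D (translate (- x) \<Lambda>) \<partial>\<Lambda>)"
    using D by (intro nn_integral_palm_kernel L) simp
  also have "\<dots> = (\<integral>\<^sup>+x. indicator (B \<inter> {x. translate (- x) \<Lambda> \<in> D}) x / b \<partial>\<Lambda>)"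
    by (intro nn_integral_cong) (auto simp: indicator_def)
  also have "\<dots> = emeasure \<Lambda> (B \<inter> {x. translate (- x) \<Lambda> \<in> D}) / b"
    using S by (simp add: nn_integral_divide)
  finally show ?thesis .
qed

lemma palm_kernel_bounded:
  obtains C where "C \<ge> 0" "\<And>\<Lambda>. \<Lambda> \<in> X \<Longrightarrow> emeasure (palm_kernel \<Lambda>) X \<le> ennreal C"
proof -
  obtain C where C: "C \<ge> 0" "\<And>\<Lambda>. \<Lambda> \<in> X \<Longrightarrow> emeasure \<Lambda> B \<le> ennreal C" using X_bounded[OF B(2)] by blast
  have fin: "ennreal C / b < \<infinity>" using b by (simp add: ennreal_divide_eq_top_iff less_top[symmetric])
  then obtain D where D: "ennreal C / b = ennreal D" "D \<ge> 0" by (cases "ennreal C / b") auto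
  have "emeasure (palm_kernel \<Lambda>) X \<le> ennreal D" if L: "\<Lambda> \<in> X" for \<Lambda>
  proof -
    have "X \<in> sets \<nu>" using X_sets by (simp add: sets_\<nu>_iff)
    then have "emeasure (palm_kernel \<Lambda>) X = emeasure \<Lambda> B / b"
      using X_translate[OF L] by (simp add: emeasure_palm_kernel[OF L])
    also have "\<dots> \<le> ennreal C / b" using C(2)[OF L] by (rule divide_right_mono_ennreal)
    finally show ?thesis by (simp add: D)
  qed
  then show ?thesis using that D(2) by blast
qed

text \<open>The constant 1 serves as weight because the mass of the bounded window \<open>B\<close>
  is uniformly bounded over \<open>X\<close>.\<close>

lemma weighted_palm_kernel: "\<exists>C. weighted_kernel \<nu> \<nu> palm_kernel (\<lambda>_. 1) C"
proof -
  obtain C where C: "C \<ge> 0" "\<And>\<Lambda>. \<Lambda> \<in> X \<Longrightarrow> emeasure (palm_kernel \<Lambda>) X \<le> ennreal C"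
    using palm_kernel_bounded by blast
  have "weighted_kernel \<nu> \<nu> palm_kernel (\<lambda>_. 1) C"
  proof
    fix D assume D: "D \<in> sets \<nu>"
    then have "(\<lambda>\<Lambda>. emeasure \<Lambda> (B \<inter> {x. translate (- x) \<Lambda> \<in> D}) / b) \<in> borel_measurable \<nu>"
      using emeasure_section_measurable[of D B] B by (intro borel_measurable_divide_ennreal) (auto simp: sets_\<nu>_iff)
    then show "(\<lambda>\<Lambda>. emeasure (palm_kernel \<Lambda>) D) \<in> borel_measurable \<nu>"
      using emeasure_palm_kernel[OF _ D] by - (rule measurable_\<nu>_cong, auto)
  next
    fix \<Lambda> assume "\<Lambda> \<in> space \<nu>"
    then show "(\<integral>\<^sup>+N. ennreal 1 \<partial>palm_kernel \<Lambda>) \<le> ennreal C"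
      using C(2)[of \<Lambda>] sets_eq_imp_space_eq[OF sets_palm_kernel[of \<Lambda>]] by simp
  next
    show "space \<nu> \<noteq> {}" using prob_space.not_empty[OF prob_space_\<nu>] .
  qed auto
  then show ?thesis by blast
qed

definition P :: "'a measure measure" where "P = palm_measure B X \<mu>"

text \<open>The sum over points collapses to a mass because configurations are purely atomic, so
  both measures come from the same set function. The mixture is known to take the expected values,
  hence so does \<open>palm_measure\<close>.\<close>

lemma P_eq: "P = weighted_kernel.mixture \<nu> \<nu> palm_kernel"
proof -
  obtain C where "weighted_kernel \<nu> \<nu> palm_kernel (\<lambda>_. 1) C" using weighted_palm_kernel by blast
  then interpret K: weighted_kernel \<nu> \<nu> palm_kernel "\<lambda>_. 1" C .
  show ?thesis
    unfolding P_def palm_measure_def K.mixture_def space_\<nu>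
  proof (rule measure_of_eq)
    show "sets \<nu> \<subseteq> Pow X" using sets_\<nu>_iff by auto
    fix D assume "D \<in> sigma_sets X (sets \<nu>)"
    then have D: "D \<in> sets \<nu>" using sets.sigma_sets_eq[of \<nu>] by simp
    have sum: "(\<Sum>\<^sub>\<infinity>x\<in>B. emeasure \<Lambda> {x} * indicator D (translate (- x) \<Lambda>))
        = emeasure \<Lambda> (B \<inter> {x. translate (- x) \<Lambda> \<in> D})" if L: "\<Lambda> \<in> X" for \<Lambda>
    proof -
      have "(\<Sum>\<^sub>\<infinity>x\<in>B. emeasure \<Lambda> {x} * indicator D (translate (- x) \<Lambda>))
          = (\<Sum>\<^sub>\<infinity>x\<in>B \<inter> {x. translate (- x) \<Lambda> \<in> D}. emeasure \<Lambda> {x})"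
        by (rule infsum_cong_neutral) auto
      also have "\<dots> = emeasure \<Lambda> (B \<inter> {x. translate (- x) \<Lambda> \<in> D})"
        using section_borel[OF X_point_measures[OF L], of D] D B(1)
        by (intro point_measure_atomic X_point_measures L) (auto simp: sets_\<nu>_iff)
      finally show ?thesis .
    qed
    have "(\<integral>\<^sup>+\<Lambda>. (\<Sum>\<^sub>\<infinity>x\<in>B. emeasure \<Lambda> {x} * indicator D (translate (- x) \<Lambda>)) \<partial>\<nu>) / b
        = (\<integral>\<^sup>+\<Lambda>. emeasure \<Lambda> (B \<inter> {x. translate (- x) \<Lambda> \<in> D}) \<partial>\<nu>) / b"
      by (intro arg_cong2[where f="(/)"] refl nn_integral_cong) (simp add: sum)
    also have "\<dots> = (\<integral>\<^sup>+\<Lambda>. emeasure \<Lambda> (B \<inter> {x. translate (- x) \<Lambda> \<in> D}) / b \<partial>\<nu>)"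
      using emeasure_section_measurable[of D B] D B
      by (intro nn_integral_divide[symmetric]) (auto simp: sets_\<nu>_iff)
    also have "\<dots> = (\<integral>\<^sup>+\<Lambda>. emeasure (palm_kernel \<Lambda>) D \<partial>\<nu>)"
      by (intro nn_integral_cong) (simp add: emeasure_palm_kernel D)
    finally show "(\<integral>\<^sup>+\<Lambda>. (\<Sum>\<^sub>\<infinity>x\<in>B. emeasure \<Lambda> {x} * indicator D (translate (- x) \<Lambda>)) \<partial>\<nu>) / b
        = (\<integral>\<^sup>+\<Lambda>. emeasure (palm_kernel \<Lambda>) D \<partial>\<nu>)" .
  qed
qed

lemma sets_P: "sets P = sets \<nu>" and space_P: "space P = X"
proof -
  obtain C where "weighted_kernel \<nu> \<nu> palm_kernel (\<lambda>_. 1) C" using weighted_palm_kernel by blast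
  then interpret K: weighted_kernel \<nu> \<nu> palm_kernel "\<lambda>_. 1" C .
  show "sets P = sets \<nu>" "space P = X" unfolding P_eq by simp_all
qed

lemma nn_integral_P:
  assumes "F \<in> borel_measurable \<nu>"
  shows "(\<integral>\<^sup>+\<Lambda>. F \<Lambda> \<partial>P) = (\<integral>\<^sup>+\<Lambda>. \<integral>\<^sup>+x. indicator B x / b * F (translate (- x) \<Lambda>) \<partial>\<Lambda> \<partial>\<nu>)"
proof -
  obtain C where "weighted_kernel \<nu> \<nu> palm_kernel (\<lambda>_. 1) C" using weighted_palm_kernel by blast
  then interpret K: weighted_kernel \<nu> \<nu> palm_kernel "\<lambda>_. 1" C .
  show ?thesis
    unfolding P_eq K.nn_integral_mixture[OF assms]
    by (intro nn_integral_cong nn_integral_palm_kernel assms) simp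
qed

lemma emeasure_P_finite: "emeasure P X < \<infinity>"
proof -
  obtain C where "weighted_kernel \<nu> \<nu> palm_kernel (\<lambda>_. 1) C" using weighted_palm_kernel by blast
  then interpret K: weighted_kernel \<nu> \<nu> palm_kernel "\<lambda>_. 1" C .
  obtain C where C: "C \<ge> 0" "\<And>\<Lambda>. \<Lambda> \<in> X \<Longrightarrow> emeasure (palm_kernel \<Lambda>) X \<le> ennreal C"
    using palm_kernel_bounded by blast
  interpret N: prob_space \<nu> by (rule prob_space_\<nu>)
  have "X \<in> sets \<nu>" using X_sets by (simp add: sets_\<nu>_iff)
  then have "emeasure P X = (\<integral>\<^sup>+\<Lambda>. emeasure (palm_kernel \<Lambda>) X \<partial>\<nu>)"
    unfolding P_eq by (rule K.emeasure_mixture)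
  also have "\<dots> \<le> (\<integral>\<^sup>+\<Lambda>. ennreal C \<partial>\<nu>)" using C by (intro nn_integral_mono) simp
  also have "\<dots> = ennreal C" using N.emeasure_space_1 by simp
  finally show ?thesis by (auto intro: le_less_trans)
qed

lemma weighted_kernel_P: "weighted_kernel P borel (\<lambda>\<Lambda>. \<Lambda>) weight weight_bound"
  by (rule weighted_kernel_\<nu>) (rule measurable_ident_sets[OF sets_P])

text \<open>An explicit candidate for the first moment; \<open>first_moment_P\<close> identifies it
  with the definite description.\<close>

definition m1 :: "'a measure" where "m1 = weighted_kernel.mixture P borel (\<lambda>\<Lambda>. \<Lambda>)"

lemma sets_m1 [measurable_cong]: "sets m1 = sets borel"
  unfolding m1_def by (rule weighted_kernel.sets_mixture[OF weighted_kernel_P])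

lemma nn_integral_m1_P:
  assumes "H \<in> borel_measurable borel"
  shows "(\<integral>\<^sup>+x. H x \<partial>m1) = (\<integral>\<^sup>+\<Lambda>. \<integral>\<^sup>+x. H x \<partial>\<Lambda> \<partial>P)"
  unfolding m1_def by (rule weighted_kernel.nn_integral_mixture[OF weighted_kernel_P assms])

lemma radon_m1: "radon m1"
  unfolding radon_def
proof (intro conjI allI impI)
  show "sets m1 = sets borel" by (rule sets_m1)
  fix K :: "'a set" assume K: "compact K"
  obtain C where C: "C \<ge> 0" "\<And>\<Lambda>. \<Lambda> \<in> X \<Longrightarrow> emeasure \<Lambda> K \<le> ennreal C"
    using X_bounded[OF compact_imp_bounded[OF K]] by blast
  have "emeasure m1 K = (\<integral>\<^sup>+\<Lambda>. emeasure \<Lambda> K \<partial>P)"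
    unfolding m1_def by (rule weighted_kernel.emeasure_mixture[OF weighted_kernel_P]) (rule borel_compact[OF K])
  also have "\<dots> \<le> (\<integral>\<^sup>+\<Lambda>. ennreal C \<partial>P)" using C by (intro nn_integral_mono) (simp add: space_P)
  also have "\<dots> = ennreal C * emeasure P X" by (simp add: space_P)
  also have "\<dots> < \<infinity>" using emeasure_P_finite by (simp add: ennreal_mult_less_top)
  finally show "emeasure m1 K < \<infinity>" .
qed

text \<open>Existence is Fubini for the mixture, uniqueness is \<open>radon_eqI\<close>. The
  candidate is Radon because the Palm measure is finite and local masses are uniformly
  bounded.\<close>

lemma first_moment_P: "first_moment P = m1"
  unfolding first_moment_def
proof (rule the_equality)
  have m1: "(\<integral>x. f x \<partial>m1) = (\<integral>\<Lambda>. counting f \<Lambda> \<partial>P)" if "f \<in> Cc" for f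
    unfolding counting_def m1_def
  proof (rule weighted_kernel.integral_mixture[OF weighted_kernel_P])
    show "integrable (weighted_kernel.mixture P borel (\<lambda>\<Lambda>. \<Lambda>)) f"
      using Cc_integrable[OF radon_m1 that] by (simp add: m1_def)
    show "integrable \<Lambda> f" if "\<Lambda> \<in> space P" for \<Lambda>
      using Cc_integrable[OF X_radon \<open>f \<in> Cc\<close>] that by (simp add: space_P)
  qed
  then show "radon m1 \<and> (\<forall>f\<in>Cc. (\<integral>x. f x \<partial>m1) = (\<integral>\<Lambda>. counting f \<Lambda> \<partial>P))"
    using radon_m1 by blast
  fix m assume m: "radon m \<and> (\<forall>f\<in>Cc. (\<integral>x. f x \<partial>m) = (\<integral>\<Lambda>. counting f \<Lambda> \<partial>P))"
  then show "m = m1"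
    by (intro radon_eqI radon_m1) (auto simp: m1 counting_def)
qed

text \<open>The translation by \<open>- x\<close> is carried over to the integrand, which produces
  the difference \<open>y - x\<close>. Multiplying by \<open>b\<close> keeps division in
  \<open>ennreal\<close> out of the computations that follow.\<close>

lemma nn_integral_m1:
  assumes H: "H \<in> borel_measurable borel"
  shows "b * (\<integral>\<^sup>+x. H x \<partial>m1) = (\<integral>\<^sup>+\<Lambda>. \<integral>\<^sup>+x. \<integral>\<^sup>+y. indicator B x * H (y - x) \<partial>\<Lambda> \<partial>\<Lambda> \<partial>\<nu>)"
proof -
  have id: "(\<lambda>\<Lambda>. \<Lambda>) \<in> \<nu> \<rightarrow>\<^sub>M \<nu>" by simp
  have F: "(\<lambda>\<Lambda>. \<integral>\<^sup>+x. H x \<partial>\<Lambda>) \<in> borel_measurable \<nu>"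
    by (rule weighted_kernel.nn_integral_kernel[OF weighted_kernel_\<nu>[OF id] H])
  let ?F = "\<lambda>\<Lambda>. \<integral>\<^sup>+x. indicator B x / b * (\<integral>\<^sup>+y. H y \<partial>translate (- x) \<Lambda>) \<partial>\<Lambda>"
  have inner: "b * ?F \<Lambda> = (\<integral>\<^sup>+x. \<integral>\<^sup>+y. indicator B x * H (y - x) \<partial>\<Lambda> \<partial>\<Lambda>)" if L: "\<Lambda> \<in> X" for \<Lambda>
  proof -
    have [measurable_cong]: "sets \<Lambda> = sets borel" by (rule radon_sets[OF X_radon[OF L]])
    note B(1)[measurable] H[measurable]
    have [measurable]: "(\<lambda>x. \<integral>\<^sup>+y. H y \<partial>translate (- x) \<Lambda>) \<in> borel_measurable borel"
      using measurable_compose[OF translate_vector_measurable[OF L] F] .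
    have "b * ?F \<Lambda> = (\<integral>\<^sup>+x. b * (indicator B x / b * (\<integral>\<^sup>+y. H y \<partial>translate (- x) \<Lambda>)) \<partial>\<Lambda>)"
      by (intro nn_integral_cmult[symmetric]) measurable
    also have "\<dots> = (\<integral>\<^sup>+x. indicator B x * (\<integral>\<^sup>+y. H (- x + y) \<partial>\<Lambda>) \<partial>\<Lambda>)"
      by (intro nn_integral_cong) (simp add: mult.assoc[symmetric] b_cancel nn_integral_translate[OF X_radon[OF L] H])
    also have "\<dots> = (\<integral>\<^sup>+x. \<integral>\<^sup>+y. indicator B x * H (y - x) \<partial>\<Lambda> \<partial>\<Lambda>)"
      by (intro nn_integral_cong) (simp add: nn_integral_cmult)
    finally show ?thesis .
  qed
  have Fm: "?F \<in> borel_measurable \<nu>"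
  proof -
    obtain C where "weighted_kernel \<nu> \<nu> palm_kernel (\<lambda>_. 1) C" using weighted_palm_kernel by blast
    then interpret K: weighted_kernel \<nu> \<nu> palm_kernel "\<lambda>_. 1" C .
    show ?thesis
      using K.nn_integral_kernel[OF F] nn_integral_palm_kernel[OF _ F] by - (rule measurable_\<nu>_cong, auto)
  qed
  have "b * (\<integral>\<^sup>+x. H x \<partial>m1) = b * (\<integral>\<^sup>+\<Lambda>. ?F \<Lambda> \<partial>\<nu>)"
    by (simp add: nn_integral_m1_P[OF H] nn_integral_P[OF F])
  also have "\<dots> = (\<integral>\<^sup>+\<Lambda>. b * ?F \<Lambda> \<partial>\<nu>)"
    by (rule nn_integral_cmult[OF Fm, symmetric])
  also have "\<dots> = (\<integral>\<^sup>+\<Lambda>. \<integral>\<^sup>+x. \<integral>\<^sup>+y. indicator B x * H (y - x) \<partial>\<Lambda> \<partial>\<Lambda> \<partial>\<nu>)"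
    by (intro nn_integral_cong) (simp add: inner)
  finally show ?thesis .
qed

end

subsection \<open>The second moment measure\<close>

context ud_ergodic_process
begin

lemma sets_pair_configuration:
  "\<Lambda> \<in> X \<Longrightarrow> sets (\<Lambda> \<Otimes>\<^sub>M \<Lambda>) = sets (borel \<Otimes>\<^sub>M borel)"
  by (intro sets_pair_measure_cong radon_sets X_radon)

lemma nn_integral_pair_configuration:
  assumes L: "\<Lambda> \<in> X" and f: "f \<in> borel_measurable (borel \<Otimes>\<^sub>M borel)"
  shows "(\<integral>\<^sup>+p. f p \<partial>(\<Lambda> \<Otimes>\<^sub>M \<Lambda>)) = (\<integral>\<^sup>+x. \<integral>\<^sup>+y. f (x, y) \<partial>\<Lambda> \<partial>\<Lambda>)"
proof -
  interpret L: sigma_finite_measure \<Lambda> by (rule radon_sigma_finite[OF X_radon[OF L]])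
  have "f \<in> borel_measurable (\<Lambda> \<Otimes>\<^sub>M \<Lambda>)"
    using f measurable_cong_sets[OF sets_pair_configuration[OF L] refl] by blast
  then show ?thesis by (rule L.nn_integral_fst[symmetric])
qed

text \<open>The measurability result for one integral is used twice; for the inner one the pair
  \<open>(\<Lambda>, x)\<close> is the parameter and \<open>fst\<close> the kernel.\<close>

lemma pair_integral_measurable:
  assumes f: "f \<in> borel_measurable (borel \<Otimes>\<^sub>M borel)"
  shows "(\<lambda>\<Lambda>. \<integral>\<^sup>+x. \<integral>\<^sup>+y. f (x, y) \<partial>\<Lambda> \<partial>\<Lambda>) \<in> borel_measurable \<nu>"
proof (rule nn_integral_configuration)
  show "(\<lambda>\<Lambda>. \<Lambda>) \<in> \<nu> \<rightarrow>\<^sub>M \<nu>" by simp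
  have "(\<lambda>p. \<integral>\<^sup>+y. f (snd p, y) \<partial>fst p) \<in> borel_measurable (\<nu> \<Otimes>\<^sub>M borel)"
  proof (rule nn_integral_configuration)
    show "fst \<in> \<nu> \<Otimes>\<^sub>M borel \<rightarrow>\<^sub>M \<nu>" by simp
    show "(\<lambda>(p, y). f (snd p, y)) \<in> borel_measurable ((\<nu> \<Otimes>\<^sub>M borel) \<Otimes>\<^sub>M borel)"
      unfolding split_beta by (rule measurable_compose[OF _ f]) measurable
  qed
  then show "(\<lambda>(\<Lambda>, x). \<integral>\<^sup>+y. f (x, y) \<partial>\<Lambda>) \<in> borel_measurable (\<nu> \<Otimes>\<^sub>M borel)"
    by (simp add: split_beta)
qed

lemma weighted_kernel_pair:
  "weighted_kernel \<nu> (borel \<Otimes>\<^sub>M borel) (\<lambda>\<Lambda>. \<Lambda> \<Otimes>\<^sub>M \<Lambda>) (\<lambda>p. weight (fst p) * weight (snd p)) (weight_bound * weight_bound)"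
proof
  show "sets (\<Lambda> \<Otimes>\<^sub>M \<Lambda>) = sets (borel \<Otimes>\<^sub>M borel)" if "\<Lambda> \<in> space \<nu>" for \<Lambda>
    using that by (simp add: sets_pair_configuration)
  show "(\<lambda>\<Lambda>. emeasure (\<Lambda> \<Otimes>\<^sub>M \<Lambda>) A) \<in> borel_measurable \<nu>" if A: "A \<in> sets (borel \<Otimes>\<^sub>M borel)" for A
  proof (rule measurable_\<nu>_cong)
    have ind: "indicator A \<in> borel_measurable (borel \<Otimes>\<^sub>M borel)" using A by simp
    show "(\<lambda>\<Lambda>. \<integral>\<^sup>+x. \<integral>\<^sup>+y. indicator A (x, y) \<partial>\<Lambda> \<partial>\<Lambda>) \<in> borel_measurable \<nu>"
      by (rule pair_integral_measurable[OF ind])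
    show "emeasure (\<Lambda> \<Otimes>\<^sub>M \<Lambda>) A = (\<integral>\<^sup>+x. \<integral>\<^sup>+y. indicator A (x, y) \<partial>\<Lambda> \<partial>\<Lambda>)" if "\<Lambda> \<in> X" for \<Lambda>
      using nn_integral_pair_configuration[OF that ind] A sets_pair_configuration[OF that] by simp
  qed
  show "(\<integral>\<^sup>+p. ennreal (weight (fst p) * weight (snd p)) \<partial>(\<Lambda> \<Otimes>\<^sub>M \<Lambda>)) \<le> ennreal (weight_bound * weight_bound)"
    if "\<Lambda> \<in> space \<nu>" for \<Lambda>
  proof -
    have L: "\<Lambda> \<in> X" using that by simp
    have wm: "weight \<in> borel_measurable \<Lambda>" by (rule radon_measurable[OF X_radon[OF L] weight_measurable])
    have "(\<integral>\<^sup>+p. ennreal (weight (fst p) * weight (snd p)) \<partial>(\<Lambda> \<Otimes>\<^sub>M \<Lambda>))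
        = (\<integral>\<^sup>+x. \<integral>\<^sup>+y. ennreal (weight x) * ennreal (weight y) \<partial>\<Lambda> \<partial>\<Lambda>)"
      by (subst nn_integral_pair_configuration[OF L]) (auto simp: ennreal_mult weight_pos less_imp_le)
    also have "\<dots> = (\<integral>\<^sup>+x. weight x \<partial>\<Lambda>) * (\<integral>\<^sup>+y. weight y \<partial>\<Lambda>)"
      using wm by (simp add: nn_integral_cmult nn_integral_multc)
    also have "\<dots> \<le> ennreal weight_bound * ennreal weight_bound"
      using weight_bound(2)[OF L] by (intro mult_mono) auto
    finally show ?thesis using weight_bound(1) by (simp add: ennreal_mult)
  qed
qed (auto simp: weight_pos space_pair_measure)

text \<open>The second moment measure, that is, the mean of
  \<open>\<Lambda> \<Otimes>\<^sub>M \<Lambda>\<close>; correlations of counting functions are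
  integrals against it.\<close>

definition M2 :: "('a \<times> 'a) measure" where
  "M2 = weighted_kernel.mixture \<nu> (borel \<Otimes>\<^sub>M borel) (\<lambda>\<Lambda>. \<Lambda> \<Otimes>\<^sub>M \<Lambda>)"

lemma sets_M2 [measurable_cong]: "sets M2 = sets (borel \<Otimes>\<^sub>M borel)"
  unfolding M2_def by (rule weighted_kernel.sets_mixture[OF weighted_kernel_pair])

lemma nn_integral_M2:
  assumes f: "f \<in> borel_measurable (borel \<Otimes>\<^sub>M borel)"
  shows "(\<integral>\<^sup>+p. f p \<partial>M2) = (\<integral>\<^sup>+\<Lambda>. \<integral>\<^sup>+x. \<integral>\<^sup>+y. f (x, y) \<partial>\<Lambda> \<partial>\<Lambda> \<partial>\<nu>)"
  unfolding M2_def weighted_kernel.nn_integral_mixture[OF weighted_kernel_pair f]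
  by (intro nn_integral_cong) (simp add: nn_integral_pair_configuration f)

lemma sigma_finite_M2: "sigma_finite_measure M2"
proof
  let ?A = "\<lambda>n::nat. cball (0::'a) (real n) \<times> cball (0::'a) (real n)"
  interpret N: prob_space \<nu> by (rule prob_space_\<nu>)
  have A: "?A n \<in> sets (borel \<Otimes>\<^sub>M borel)" for n by (intro pair_measureI) auto
  have fin: "emeasure M2 (?A n) < \<infinity>" for n
  proof -
    obtain C where C: "C \<ge> 0" "\<And>\<Lambda>. \<Lambda> \<in> X \<Longrightarrow> emeasure \<Lambda> (cball 0 (real n)) \<le> ennreal C"
      using X_bounded[OF bounded_cball, of 0 "real n"] by blast
    have "emeasure M2 (?A n) = (\<integral>\<^sup>+p. indicator (?A n) p \<partial>M2)" using A sets_M2 by simp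
    also have "\<dots> = (\<integral>\<^sup>+\<Lambda>. \<integral>\<^sup>+x. \<integral>\<^sup>+y. indicator (?A n) (x, y) \<partial>\<Lambda> \<partial>\<Lambda> \<partial>\<nu>)"
      using A by (intro nn_integral_M2) simp
    also have "\<dots> \<le> (\<integral>\<^sup>+\<Lambda>. ennreal C * ennreal C \<partial>\<nu>)"
    proof (intro nn_integral_mono)
      fix \<Lambda> assume "\<Lambda> \<in> space \<nu>"
      then have L: "\<Lambda> \<in> X" by simp
      have s: "cball 0 (real n) \<in> sets \<Lambda>" unfolding radon_sets[OF X_radon[OF L]] by auto
      have "(\<integral>\<^sup>+x. \<integral>\<^sup>+y. indicator (?A n) (x, y) \<partial>\<Lambda> \<partial>\<Lambda>)
          = (\<integral>\<^sup>+x. \<integral>\<^sup>+y. indicator (cball 0 (real n)) x * indicator (cball 0 (real n)) y \<partial>\<Lambda> \<partial>\<Lambda>)"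
        by (intro nn_integral_cong) (simp add: indicator_times)
      also have "\<dots> = emeasure \<Lambda> (cball 0 (real n)) * emeasure \<Lambda> (cball 0 (real n))"
        using s by (simp add: nn_integral_cmult nn_integral_multc)
      also have "\<dots> \<le> ennreal C * ennreal C" using C(2)[OF L] by (intro mult_mono) auto
      finally show "(\<integral>\<^sup>+x. \<integral>\<^sup>+y. indicator (?A n) (x, y) \<partial>\<Lambda> \<partial>\<Lambda>) \<le> ennreal C * ennreal C" .
    qed
    also have "\<dots> < \<infinity>" using N.emeasure_space_1 by (simp add: ennreal_mult_less_top)
    finally show ?thesis .
  qed
  have "\<exists>n. p \<in> ?A n" for p :: "'a \<times> 'a"
  proof -
    obtain n :: nat where "max (norm (fst p)) (norm (snd p)) \<le> real n" using real_arch_simple by blast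
    then show ?thesis by (intro exI[of _ n]) (auto simp: mem_Times_iff)
  qed
  then have U: "(\<Union>n. ?A n) = space M2"
    using sets_eq_imp_space_eq[OF sets_M2] by (auto simp: space_pair_measure)
  show "\<exists>A. countable A \<and> A \<subseteq> sets M2 \<and> \<Union> A = space M2 \<and> (\<forall>a\<in>A. emeasure M2 a \<noteq> \<infinity>)"
  proof (intro exI conjI)
    show "countable (range ?A)" by simp
    show "range ?A \<subseteq> sets M2" unfolding sets_M2 using A by blast
    show "\<Union> (range ?A) = space M2" by (rule U)
    show "\<forall>a\<in>range ?A. emeasure M2 a \<noteq> \<infinity>"
      using fin by (metis (no_types, lifting) imageE less_irrefl)
  qed
qed

text \<open>Shifting both coordinates amounts to translating the configuration, under which
  \<open>\<nu>\<close> is invariant.\<close>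

lemma M2_stationary:
  assumes f: "f \<in> borel_measurable (borel \<Otimes>\<^sub>M borel)"
  shows "(\<integral>\<^sup>+p. f (fst p + t, snd p + t) \<partial>M2) = (\<integral>\<^sup>+p. f p \<partial>M2)"
proof -
  let ?\<Phi> = "\<lambda>\<Lambda>. \<integral>\<^sup>+x. \<integral>\<^sup>+y. f (x, y) \<partial>\<Lambda> \<partial>\<Lambda>"
  have \<Phi>: "?\<Phi> \<in> borel_measurable \<nu>" by (rule pair_integral_measurable[OF f])
  note f[measurable]
  have "(\<integral>\<^sup>+p. f p \<partial>M2) = (\<integral>\<^sup>+\<Lambda>. ?\<Phi> \<Lambda> \<partial>distr \<nu> \<nu> (translate t))"
    by (simp add: nn_integral_M2[OF f] distr_\<nu>)
  also have "\<dots> = (\<integral>\<^sup>+\<Lambda>. ?\<Phi> (translate t \<Lambda>) \<partial>\<nu>)"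
    using \<Phi> by (intro nn_integral_distr) auto
  also have "\<dots> = (\<integral>\<^sup>+\<Lambda>. \<integral>\<^sup>+x. \<integral>\<^sup>+y. f (x + t, y + t) \<partial>\<Lambda> \<partial>\<Lambda> \<partial>\<nu>)"
  proof (intro nn_integral_cong)
    fix \<Lambda> assume "\<Lambda> \<in> space \<nu>"
    then have L: "\<Lambda> \<in> X" "translate t \<Lambda> \<in> X" using X_translate by auto
    interpret T: sigma_finite_measure "translate t \<Lambda>" by (rule radon_sigma_finite[OF X_radon[OF L(2)]])
    have "(\<lambda>x. \<integral>\<^sup>+y. f (x, y) \<partial>translate t \<Lambda>) \<in> borel_measurable borel"
      by (rule T.borel_measurable_nn_integral) (simp add: split_beta measurable_cong_sets[OF sets_pair_measure_cong[OF refl translate_space_sets(1)] refl])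
    then have "?\<Phi> (translate t \<Lambda>) = (\<integral>\<^sup>+x. \<integral>\<^sup>+y. f (t + x, y) \<partial>translate t \<Lambda> \<partial>\<Lambda>)"
      by (rule nn_integral_translate[OF X_radon[OF L(1)]])
    also have "\<dots> = (\<integral>\<^sup>+x. \<integral>\<^sup>+y. f (t + x, t + y) \<partial>\<Lambda> \<partial>\<Lambda>)"
      by (intro nn_integral_cong nn_integral_translate X_radon L) measurable
    finally show "?\<Phi> (translate t \<Lambda>) = (\<integral>\<^sup>+x. \<integral>\<^sup>+y. f (x + t, y + t) \<partial>\<Lambda> \<partial>\<Lambda>)"
      by (simp add: add.commute)
  qed
  also have "\<dots> = (\<integral>\<^sup>+p. f (fst p + t, snd p + t) \<partial>M2)"
    by (subst nn_integral_M2) auto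
  finally show ?thesis ..
qed

end

lemma lborel_nn_translate:
  fixes f :: "'a::euclidean_space \<Rightarrow> ennreal"
  assumes [measurable]: "f \<in> borel_measurable borel"
  shows "(\<integral>\<^sup>+s. f (x + s) \<partial>lborel) = (\<integral>\<^sup>+s. f s \<partial>lborel)"
proof -
  have "(\<integral>\<^sup>+s. f s \<partial>lborel) = (\<integral>\<^sup>+s. f s \<partial>distr lborel borel ((+) x))" by (simp add: lborel_distr_plus)
  also have "\<dots> = (\<integral>\<^sup>+s. f (x + s) \<partial>lborel)" by (intro nn_integral_distr) auto
  finally show ?thesis ..
qed

lemma lborel_nn_reflect:
  fixes f :: "'a::euclidean_space \<Rightarrow> ennreal"
  assumes [measurable]: "f \<in> borel_measurable borel"
  shows "(\<integral>\<^sup>+s. f (x - s) \<partial>lborel) = (\<integral>\<^sup>+s. f s \<partial>lborel)"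
proof -
  have eq: "lborel = density (distr lborel borel (\<lambda>s. x - s)) (\<lambda>_. 1)"
    using lborel_affine[of "- 1" x] by simp
  have "(\<integral>\<^sup>+s. f s \<partial>lborel) = (\<integral>\<^sup>+s. f s \<partial>density (distr lborel borel (\<lambda>s. x - s)) (\<lambda>_. 1))"
    by (simp flip: eq)
  also have "\<dots> = (\<integral>\<^sup>+s. f (x - s) \<partial>lborel)"
    by (simp add: density_1 nn_integral_distr)
  finally show ?thesis ..
qed

context palm
begin

text \<open>Write \<open>b = (\<integral>\<^sup>+s. indicator B (x + s) \<partial>lborel)\<close> inside the integral, exchange the order, and
  translate the configuration by \<open>s\<close>.\<close>

theorem campbell:
  assumes G: "G \<in> borel_measurable (borel \<Otimes>\<^sub>M borel)"
  shows "(\<integral>\<^sup>+p. G (fst p, snd p - fst p) \<partial>M2) = (\<integral>\<^sup>+z. \<integral>\<^sup>+s. G (s, z) \<partial>lborel \<partial>m1)"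
proof -
  note G[measurable] B(1)[measurable]
  interpret M2: sigma_finite_measure M2 by (rule sigma_finite_M2)
  interpret pair: pair_sigma_finite lborel M2 ..
  define H where "H z = (\<integral>\<^sup>+s. G (s, z) \<partial>lborel)" for z
  have [measurable]: "H \<in> borel_measurable borel" unfolding H_def by measurable
  let ?I = "indicator B :: 'a \<Rightarrow> ennreal"
  have "b * (\<integral>\<^sup>+p. G (fst p, snd p - fst p) \<partial>M2) = (\<integral>\<^sup>+p. b * G (fst p, snd p - fst p) \<partial>M2)"
    by (intro nn_integral_cmult[symmetric]) measurable
  also have "\<dots> = (\<integral>\<^sup>+p. \<integral>\<^sup>+s. ?I (fst p + s) * G (fst p, snd p - fst p) \<partial>lborel \<partial>M2)"
  proof (intro nn_integral_cong)
    fix p :: "'a \<times> 'a"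
    have "b = (\<integral>\<^sup>+s. ?I (fst p + s) \<partial>lborel)" using B(1) by (simp add: lborel_nn_translate)
    then show "b * G (fst p, snd p - fst p) = (\<integral>\<^sup>+s. ?I (fst p + s) * G (fst p, snd p - fst p) \<partial>lborel)"
      by (simp add: nn_integral_multc)
  qed
  also have "\<dots> = (\<integral>\<^sup>+s. \<integral>\<^sup>+p. ?I (fst p + s) * G (fst p, snd p - fst p) \<partial>M2 \<partial>lborel)"
    by (rule pair.Fubini') measurable
  \<comment> \<open>Stationarity turns \<open>fst p + s\<close> into \<open>fst p\<close>. The
    difference of the coordinates does not change, so \<open>s\<close> survives only in the first
    argument of \<open>G\<close>.\<close>
  also have "\<dots> = (\<integral>\<^sup>+s. \<integral>\<^sup>+p. ?I (fst p) * G (fst p - s, snd p - fst p) \<partial>M2 \<partial>lborel)"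
  proof (rule nn_integral_cong)
    fix s :: 'a
    have "(\<lambda>p. ?I (fst p) * G (fst p - s, snd p - fst p)) \<in> borel_measurable (borel \<Otimes>\<^sub>M borel)" by measurable
    from M2_stationary[OF this, of s]
    show "(\<integral>\<^sup>+p. ?I (fst p + s) * G (fst p, snd p - fst p) \<partial>M2) = (\<integral>\<^sup>+p. ?I (fst p) * G (fst p - s, snd p - fst p) \<partial>M2)"
      by simp
  qed
  also have "\<dots> = (\<integral>\<^sup>+p. \<integral>\<^sup>+s. ?I (fst p) * G (fst p - s, snd p - fst p) \<partial>lborel \<partial>M2)"
    by (rule pair.Fubini'[symmetric]) measurable
  also have "\<dots> = (\<integral>\<^sup>+p. ?I (fst p) * H (snd p - fst p) \<partial>M2)"
  proof (intro nn_integral_cong)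
    fix p :: "'a \<times> 'a"
    have [measurable]: "(\<lambda>s. G (s, snd p - fst p)) \<in> borel_measurable borel" by measurable
    have "(\<integral>\<^sup>+s. ?I (fst p) * G (fst p - s, snd p - fst p) \<partial>lborel) = ?I (fst p) * (\<integral>\<^sup>+s. G (fst p - s, snd p - fst p) \<partial>lborel)"
      by (intro nn_integral_cmult) measurable
    also have "(\<integral>\<^sup>+s. G (fst p - s, snd p - fst p) \<partial>lborel) = H (snd p - fst p)"
      unfolding H_def by (rule lborel_nn_reflect) measurable
    finally show "(\<integral>\<^sup>+s. ?I (fst p) * G (fst p - s, snd p - fst p) \<partial>lborel) = ?I (fst p) * H (snd p - fst p)" .
  qed
  also have "\<dots> = (\<integral>\<^sup>+\<Lambda>. \<integral>\<^sup>+x. \<integral>\<^sup>+y. ?I x * H (y - x) \<partial>\<Lambda> \<partial>\<Lambda> \<partial>\<nu>)"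
    by (subst nn_integral_M2) auto
  also have "\<dots> = b * (\<integral>\<^sup>+z. H z \<partial>m1)" by (rule nn_integral_m1[symmetric]) measurable
  finally have "b * (\<integral>\<^sup>+p. G (fst p, snd p - fst p) \<partial>M2) = b * (\<integral>\<^sup>+z. H z \<partial>m1)" .
  then show ?thesis using b unfolding H_def by (simp add: ennreal_mult_cancel_left)
qed

text \<open>Campbell's formula tested on indicators gives an identity of measures, along which
  complex integrands can be transported without splitting them into nonnegative parts.\<close>

lemma distr_M2: "distr M2 (borel \<Otimes>\<^sub>M borel) (\<lambda>p. (fst p, snd p - fst p)) = lborel \<Otimes>\<^sub>M m1"
proof (rule measure_eqI)
  interpret m1: sigma_finite_measure m1 by (rule radon_sigma_finite[OF radon_m1])
  interpret pair: pair_sigma_finite lborel m1 ..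
  show s: "sets (distr M2 (borel \<Otimes>\<^sub>M borel) (\<lambda>p. (fst p, snd p - fst p))) = sets (lborel \<Otimes>\<^sub>M m1)"
    by (simp only: sets_distr sets_pair_measure_cong[OF sets_lborel sets_m1])
  fix A assume "A \<in> sets (distr M2 (borel \<Otimes>\<^sub>M borel) (\<lambda>p. (fst p, snd p - fst p)))"
  then have A: "A \<in> sets (borel \<Otimes>\<^sub>M borel)" by simp
  then have A': "A \<in> sets (lborel \<Otimes>\<^sub>M m1)" using s by simp
  have m: "(\<lambda>p. (fst p, snd p - fst p)) \<in> M2 \<rightarrow>\<^sub>M borel \<Otimes>\<^sub>M borel" by measurable
  have ind: "indicator A \<in> borel_measurable (borel \<Otimes>\<^sub>M borel)" using A by simp
  have "emeasure (distr M2 (borel \<Otimes>\<^sub>M borel) (\<lambda>p. (fst p, snd p - fst p))) A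
      = (\<integral>\<^sup>+q. indicator A q \<partial>distr M2 (borel \<Otimes>\<^sub>M borel) (\<lambda>p. (fst p, snd p - fst p)))"
    using A by simp
  also have "\<dots> = (\<integral>\<^sup>+p. indicator A (fst p, snd p - fst p) \<partial>M2)"
    by (rule nn_integral_distr[OF m]) (use ind in simp)
  also have "\<dots> = (\<integral>\<^sup>+z. \<integral>\<^sup>+s. indicator A (s, z) \<partial>lborel \<partial>m1)" by (rule campbell[OF ind])
  also have "\<dots> = (\<integral>\<^sup>+q. indicator A q \<partial>(lborel \<Otimes>\<^sub>M m1))"
    using A' by (intro pair.nn_integral_snd) (simp add: split_beta)
  also have "\<dots> = emeasure (lborel \<Otimes>\<^sub>M m1) A" using A' by simp
  finally show "emeasure (distr M2 (borel \<Otimes>\<^sub>M borel) (\<lambda>p. (fst p, snd p - fst p))) A = emeasure (lborel \<Otimes>\<^sub>M m1) A" .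
qed

subsection \<open>Correlations of counting functions\<close>

text \<open>Integrability for \<open>M2\<close> is accompanied by integrability for every single
  \<open>\<Lambda> \<Otimes>\<^sub>M \<Lambda>\<close>, because \<open>integral_mixture\<close> asks
  for both.\<close>

lemma integrable_M2:
  fixes F :: "'a \<times> 'a \<Rightarrow> complex"
  assumes F: "F \<in> borel_measurable (borel \<Otimes>\<^sub>M borel)" and C: "C \<ge> 0"
    and le: "\<And>x y. cmod (F (x, y)) \<le> C * (weight x * weight y)"
  shows "integrable M2 F" "\<And>\<Lambda>. \<Lambda> \<in> X \<Longrightarrow> integrable (\<Lambda> \<Otimes>\<^sub>M \<Lambda>) F"
proof -
  interpret N: prob_space \<nu> by (rule prob_space_\<nu>)
  interpret K: weighted_kernel \<nu> "borel \<Otimes>\<^sub>M borel" "\<lambda>\<Lambda>. \<Lambda> \<Otimes>\<^sub>M \<Lambda>" "\<lambda>p. weight (fst p) * weight (snd p)" "weight_bound * weight_bound"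
    by (rule weighted_kernel_pair)
  have Fm: "F \<in> borel_measurable (\<Lambda> \<Otimes>\<^sub>M \<Lambda>)" if "\<Lambda> \<in> X" for \<Lambda>
    by (rule K.kernel_measurable[OF _ F]) (use that in simp)
  have bnd: "(\<integral>\<^sup>+p. norm (F p) \<partial>(\<Lambda> \<Otimes>\<^sub>M \<Lambda>)) \<le> ennreal C * ennreal (weight_bound * weight_bound)" if L: "\<Lambda> \<in> X" for \<Lambda>
  proof -
    have "(\<integral>\<^sup>+p. norm (F p) \<partial>(\<Lambda> \<Otimes>\<^sub>M \<Lambda>)) \<le> (\<integral>\<^sup>+p. ennreal C * ennreal (weight (fst p) * weight (snd p)) \<partial>(\<Lambda> \<Otimes>\<^sub>M \<Lambda>))"
      using le C by (intro nn_integral_mono) (auto simp: ennreal_mult'[symmetric] intro!: ennreal_leI)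
    also have "\<dots> = ennreal C * (\<integral>\<^sup>+p. ennreal (weight (fst p) * weight (snd p)) \<partial>(\<Lambda> \<Otimes>\<^sub>M \<Lambda>))"
    proof (rule nn_integral_cmult)
      show "(\<lambda>p. ennreal (weight (fst p) * weight (snd p))) \<in> borel_measurable (\<Lambda> \<Otimes>\<^sub>M \<Lambda>)"
        by (rule K.kernel_measurable) (use L in \<open>simp, measurable\<close>)
    qed
    also have "\<dots> \<le> ennreal C * ennreal (weight_bound * weight_bound)"
      using L K.w_bound[of \<Lambda>] by (intro mult_left_mono) auto
    finally show ?thesis .
  qed
  show "integrable (\<Lambda> \<Otimes>\<^sub>M \<Lambda>) F" if "\<Lambda> \<in> X" for \<Lambda>
    using bnd[OF that] by (intro integrableI_bounded Fm that) (auto simp: ennreal_mult_less_top intro: le_less_trans)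
  show "integrable M2 F"
  proof (rule integrableI_bounded)
    show "F \<in> borel_measurable M2" using F by measurable
    have "(\<integral>\<^sup>+p. norm (F p) \<partial>M2) = (\<integral>\<^sup>+\<Lambda>. \<integral>\<^sup>+p. norm (F p) \<partial>(\<Lambda> \<Otimes>\<^sub>M \<Lambda>) \<partial>\<nu>)"
      unfolding M2_def using F by (intro K.nn_integral_mixture) measurable
    also have "\<dots> \<le> (\<integral>\<^sup>+\<Lambda>. ennreal C * ennreal (weight_bound * weight_bound) \<partial>\<nu>)"
      using bnd by (intro nn_integral_mono) simp
    also have "\<dots> < \<infinity>" using N.emeasure_space_1 by (simp add: ennreal_mult_less_top)
    finally show "(\<integral>\<^sup>+p. norm (F p) \<partial>M2) < \<infinity>" .
  qed
qed

text \<open>A product of counting functions is an integral over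
  \<open>\<Lambda> \<Otimes>\<^sub>M \<Lambda>\<close>, so its mean is an integral over
  \<open>M2\<close>. In the coordinates \<open>(s, z) = (x, y - x)\<close> the integral over
  \<open>s\<close> is a convolution evaluated at \<open>- t - z\<close>, and integrating over
  \<open>z\<close> gives \<open>conv_measure\<close> at \<open>- t\<close>.\<close>

lemma counting_correlation:
  assumes g: "g \<in> schwartz" and h: "h \<in> schwartz"
  shows "L2_inner \<nu> (T_rep t (counting g)) (counting h) = conv_measure (conv g (tilde h)) m1 (- t)"
proof -
  let ?g = "\<lambda>x. g (x - t)"
  have g': "?g \<in> schwartz" by (rule schwartz_translate[OF g])
  note [measurable] = schwartz_measurable[OF g] schwartz_measurable[OF h]
  interpret K: weighted_kernel \<nu> "borel \<Otimes>\<^sub>M borel" "\<lambda>\<Lambda>. \<Lambda> \<Otimes>\<^sub>M \<Lambda>" "\<lambda>p. weight (fst p) * weight (snd p)" "weight_bound * weight_bound"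
    by (rule weighted_kernel_pair)
  interpret m1: sigma_finite_measure m1 by (rule radon_sigma_finite[OF radon_m1])
  interpret pair: pair_sigma_finite lborel m1 ..
  define F where "F p = ?g (fst p) * cnj (h (snd p))" for p :: "'a \<times> 'a"
  have Fm [measurable]: "F \<in> borel_measurable (borel \<Otimes>\<^sub>M borel)" unfolding F_def by measurable
  obtain C where C: "C \<ge> 0" "\<And>x. cmod (?g x) \<le> C * weight x"
    using rapid_le_weight[OF schwartz_rapid[OF g']] by blast
  obtain D where D: "D \<ge> 0" "\<And>x. cmod (h x) \<le> D * weight x"
    using rapid_le_weight[OF schwartz_rapid[OF h]] by blast
  have le: "cmod (F (x, y)) \<le> (C * D) * (weight x * weight y)" for x y
    using mult_mono[OF C(2)[of x] D(2)[of y]] C(1) weight_pos[of x]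
    by (simp add: F_def norm_mult mult_ac less_imp_le)
  have CD: "C * D \<ge> 0" using C D by simp
  note int = integrable_M2[OF Fm CD le]
  have inner: "T_rep t (counting g) \<Lambda> * cnj (counting h \<Lambda>) = (\<integral>p. F p \<partial>(\<Lambda> \<Otimes>\<^sub>M \<Lambda>))" if L: "\<Lambda> \<in> X" for \<Lambda>
  proof -
    interpret L: sigma_finite_measure \<Lambda> by (rule radon_sigma_finite[OF X_radon[OF L]])
    interpret P: pair_sigma_finite \<Lambda> \<Lambda> ..
    have "(\<integral>p. F p \<partial>(\<Lambda> \<Otimes>\<^sub>M \<Lambda>)) = (\<integral>x. \<integral>y. F (x, y) \<partial>\<Lambda> \<partial>\<Lambda>)"
      using int(2)[OF L] by (rule P.integral_fst'[symmetric])
    also have "\<dots> = counting ?g \<Lambda> * cnj (counting h \<Lambda>)"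
      by (simp add: F_def counting_def)
    also have "counting ?g \<Lambda> = T_rep t (counting g) \<Lambda>"
      unfolding T_rep_def using counting_translate[OF X_radon[OF L], of g "- t"] by simp
    finally show ?thesis ..
  qed
  have "L2_inner \<nu> (T_rep t (counting g)) (counting h) = (\<integral>\<Lambda>. \<integral>p. F p \<partial>(\<Lambda> \<Otimes>\<^sub>M \<Lambda>) \<partial>\<nu>)"
    unfolding L2_inner_def by (intro Bochner_Integration.integral_cong) (simp_all add: inner)
  also have "\<dots> = (\<integral>p. F p \<partial>M2)"
    unfolding M2_def using int by (intro K.integral_mixture[symmetric]) (auto simp: M2_def)
  also have "\<dots> = (\<integral>q. F (fst q, fst q + snd q) \<partial>distr M2 (borel \<Otimes>\<^sub>M borel) (\<lambda>p. (fst p, snd p - fst p)))"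
    by (subst integral_distr) auto
  also have "\<dots> = (\<integral>q. F (fst q, fst q + snd q) \<partial>(lborel \<Otimes>\<^sub>M m1))" unfolding distr_M2 ..
  also have "\<dots> = (\<integral>z. \<integral>s. F (s, s + z) \<partial>lborel \<partial>m1)"
  proof -
    have "integrable (distr M2 (borel \<Otimes>\<^sub>M borel) (\<lambda>p. (fst p, snd p - fst p))) (\<lambda>q. F (fst q, fst q + snd q))"
      using int(1) by (subst integrable_distr_eq) auto
    then have "integrable (lborel \<Otimes>\<^sub>M m1) (\<lambda>(s, z). F (s, s + z))" unfolding distr_M2 split_beta .
    from pair.integral_snd[OF this] show ?thesis by (simp only: case_prod_unfold)
  qed
  also have "\<dots> = (\<integral>z. conv g (tilde h) (- t - z) \<partial>m1)"
  proof (intro Bochner_Integration.integral_cong refl)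
    fix z
    \<comment> \<open>Shifting the variable by \<open>- t\<close> makes the integrand
      \<open>g (s - t)\<close> times the conjugate of \<open>h (s + z)\<close>, which is
      \<open>F (s, s + z)\<close>.\<close>
    have "conv g (tilde h) (- t - z) = (\<integral>s. g (s + (- t)) * tilde h (- t - z - (s + (- t))) \<partial>lborel)"
      unfolding conv_def tilde_def by (rule lborel_integral_translate[symmetric]) measurable
    then show "(\<integral>s. F (s, s + z) \<partial>lborel) = conv g (tilde h) (- t - z)"
      by (simp add: F_def tilde_def algebra_simps)
  qed
  finally show ?thesis unfolding conv_measure_def .
qed

end

subsection \<open>Smooth bump functions\<close>

definition smooth :: "('a::euclidean_space \<Rightarrow> complex) set" where
  "smooth = {f. \<forall>bs. set bs \<subseteq> Basis \<longrightarrow> (\<forall>x. foldr partial_deriv bs f differentiable (at x))}"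

text \<open>The exterior of the ball is open, so all derivatives vanish there; on the compact ball
  they are continuous, hence bounded together with any power of the norm.\<close>

lemma smooth_vanishing_schwartz:
  fixes f :: "'a::euclidean_space \<Rightarrow> complex"
  assumes f: "f \<in> smooth" and zero: "\<And>x. norm x > r \<Longrightarrow> f x = 0"
  shows "f \<in> schwartz"
proof -
  have pd_zero: "partial_deriv b g x = 0" if "\<And>x. norm x > r \<Longrightarrow> g x = 0" "norm x > r" for g :: "'a \<Rightarrow> complex" and b x
  proof -
    have "open {x::'a. r < norm x}" by (intro open_Collect_less continuous_intros)
    then have "(g has_derivative (\<lambda>_. 0)) (at x)"
      by (rule has_derivative_transform_within_open[OF has_derivative_const[of 0]]) (use that in auto)
    from frechet_derivative_at[OF this] show ?thesis by (simp add: partial_deriv_def fun_eq_iff)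
  qed
  have fz: "foldr partial_deriv bs f x = 0" if "norm x > r" for bs x
    using that by (induction bs arbitrary: x) (auto simp: zero pd_zero)
  have "bounded (range (\<lambda>x. norm x ^ k *\<^sub>R foldr partial_deriv bs f x))" if bs: "set bs \<subseteq> Basis" for bs k
  proof -
    let ?g = "\<lambda>x. norm x ^ k *\<^sub>R foldr partial_deriv bs f x"
    have "foldr partial_deriv bs f differentiable (at x)" for x using f bs by (auto simp: smooth_def)
    then have "continuous_on UNIV (foldr partial_deriv bs f)"
      by (simp add: continuous_at_imp_continuous_on differentiable_imp_continuous_within)
    then have "continuous_on (cball 0 r) ?g"
      by (intro continuous_intros) (auto intro: continuous_on_subset)
    then have "bounded (?g ` cball 0 r)"
      by (intro compact_imp_bounded compact_continuous_image) auto
    then have "bounded (insert 0 (?g ` cball 0 r))" by simp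
    moreover have "range ?g \<subseteq> insert 0 (?g ` cball 0 r)"
    proof
      fix y assume "y \<in> range ?g"
      then obtain x where x: "y = ?g x" by blast
      show "y \<in> insert 0 (?g ` cball 0 r)"
        using fz[of x bs] by (cases "norm x \<le> r") (auto simp: x)
    qed
    ultimately show ?thesis by (rule bounded_subset)
  qed
  then show ?thesis using f by (auto simp: schwartz_def smooth_def)
qed

text \<open>The classical flat function \<open>exp (- 1 / x)\<close>, with negative powers included
  so that derivatives are linear combinations of members of the same family.\<close>

definition flat :: "nat \<Rightarrow> real \<Rightarrow> real" where
  "flat k x = (if x > 0 then exp (- 1 / x) / x ^ k else 0)"

lemma flat_deriv: "(flat k has_real_derivative flat (k + 2) x - real k * flat (k + 1) x) (at x)"
proof -
  consider "x > 0" | "x < 0" | "x = 0" by linarith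
  then show ?thesis
  proof cases
    case 1
    have "((\<lambda>x. exp (- 1 / x) / x ^ k) has_real_derivative
        exp (- 1 / x) / x ^ (k + 2) - real k * (exp (- 1 / x) / x ^ (k + 1))) (at x)"
    proof -
      have "((\<lambda>x. exp (- 1 / x) / x ^ k) has_real_derivative
        ((exp (- 1 / x) * (1 / x ^ 2)) * x ^ k - exp (- 1 / x) * (real k * x ^ (k - 1))) / (x ^ k * x ^ k)) (at x)"
        using 1 by (auto intro!: derivative_eq_intros simp: power2_eq_square field_simps)
      moreover have "((exp (- 1 / x) * (1 / x ^ 2)) * x ^ k - exp (- 1 / x) * (real k * x ^ (k - 1))) / (x ^ k * x ^ k)
          = exp (- 1 / x) / x ^ (k + 2) - real k * (exp (- 1 / x) / x ^ (k + 1))"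
        using 1 by (cases k) (auto simp: field_simps power2_eq_square)
      ultimately show ?thesis by simp
    qed
    then have "(flat k has_real_derivative
        exp (- 1 / x) / x ^ (k + 2) - real k * (exp (- 1 / x) / x ^ (k + 1))) (at x)"
      by (rule has_field_derivative_transform_within_open[where S="{0<..}"]) (use 1 in \<open>auto simp: flat_def\<close>)
    then show ?thesis using 1 by (simp add: flat_def)
  next
    case 2
    have "(flat k has_real_derivative 0) (at x)"
      by (rule has_field_derivative_transform_within_open[where S="{..<0}" and f="\<lambda>_. 0"]) (use 2 in \<open>auto simp: flat_def\<close>)
    then show ?thesis using 2 by (simp add: flat_def)
  next
    case 3
    \<comment> \<open>From the right the difference quotient at 0 tends to 0 because
      \<open>exp (- 1 / h)\<close> beats every power of \<open>h\<close>; from the left it vanishes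
      identically.\<close>
    have "((\<lambda>h::real. exp (- 1 / h) / h ^ k / h) \<longlongrightarrow> 0) (at_right 0)" by real_asymp
    then have r: "((\<lambda>h. flat k h / h) \<longlongrightarrow> 0) (at_right 0)"
      by (rule Lim_transform_eventually) (auto simp: flat_def eventually_at_right_less intro!: eventually_mono[OF eventually_at_right_less[of 0]])
    have l: "((\<lambda>h. flat k h / h) \<longlongrightarrow> 0) (at_left 0)"
      by (rule Lim_transform_eventually[OF tendsto_const])
        (auto simp: flat_def intro!: eventually_mono[OF eventually_at_left_real[of "-1" 0]])
    have "((\<lambda>h. flat k h / h) \<longlongrightarrow> 0) (at 0)" using l r by (simp add: filterlim_split_at)
    moreover have "flat j 0 = 0" for j by (simp add: flat_def)
    ultimately show ?thesis using 3 by (simp add: DERIV_def)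
  qed
qed

lemma flat_0_bounds: "0 \<le> flat 0 x" "flat 0 x \<le> 1"
  by (auto simp: flat_def)

text \<open>The algebra generated by constants and flat functions of affine coordinates. It is
  closed under partial derivatives by the product and chain rules, which gives smoothness without
  computing higher derivatives.\<close>

inductive_set bumps :: "('a::euclidean_space \<Rightarrow> complex) set" where
  const: "(\<lambda>x. c) \<in> bumps"
| flat: "b \<in> Basis \<Longrightarrow> (\<lambda>x. of_real (flat k (s * (x \<bullet> b) + d))) \<in> bumps"
| add: "f \<in> bumps \<Longrightarrow> g \<in> bumps \<Longrightarrow> (\<lambda>x. f x + g x) \<in> bumps"
| mult: "f \<in> bumps \<Longrightarrow> g \<in> bumps \<Longrightarrow> (\<lambda>x. f x * g x) \<in> bumps"

lemma flat_has_derivative: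
  "((\<lambda>x. complex_of_real (flat k (s * (x \<bullet> b) + d))) has_derivative
    (\<lambda>h. of_real ((flat (k + 2) (s * (x \<bullet> b) + d) - real k * flat (k + 1) (s * (x \<bullet> b) + d)) * (s * (h \<bullet> b))))) (at x)"
proof -
  have "((\<lambda>x. flat k (s * (x \<bullet> b) + d)) has_derivative
    (\<lambda>h. (flat (k + 2) (s * (x \<bullet> b) + d) - real k * flat (k + 1) (s * (x \<bullet> b) + d)) * (s * (h \<bullet> b)))) (at x)"
    by (rule has_derivative_compose[OF _ flat_deriv[unfolded has_field_derivative_def]])
      (auto intro!: derivative_eq_intros)
  then show ?thesis by (rule has_derivative_of_real)
qed

lemma bumps_differentiable: "f \<in> bumps \<Longrightarrow> f differentiable (at x)"
proof (induction rule: bumps.induct)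
  case (flat b k s d)
  show ?case by (rule differentiableI[OF flat_has_derivative])
qed (auto intro: differentiable_add differentiable_mult)

lemma bumps_partial_deriv:
  fixes f :: "'a::euclidean_space \<Rightarrow> complex"
  assumes "f \<in> bumps" "v \<in> Basis"
  shows "partial_deriv v f \<in> bumps"
  using assms(1)
proof induction
  case (const c)
  have "partial_deriv v (\<lambda>x. c) = (\<lambda>x. 0)" by (rule partial_deriv_eq) simp
  then show ?case using bumps.const[of 0] by simp
next
  case (flat b k s d)
  have "partial_deriv v (\<lambda>x. complex_of_real (flat k (s * (x \<bullet> b) + d)))
      = (\<lambda>x. (of_real (flat (k + 2) (s * (x \<bullet> b) + d)) + of_real (- real k) * of_real (flat (k + 1) (s * (x \<bullet> b) + d))) * of_real (s * (v \<bullet> b)))"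
    by (subst partial_deriv_eq[OF flat_has_derivative]) simp
  moreover have "(\<lambda>x. (of_real (flat (k + 2) (s * (x \<bullet> b) + d)) + of_real (- real k) * of_real (flat (k + 1) (s * (x \<bullet> b) + d))) * of_real (s * (v \<bullet> b))) \<in> bumps"
    by (intro bumps.mult bumps.add bumps.flat bumps.const flat)
  ultimately show ?case by (simp only:)
next
  case (add f g)
  then show ?case
    using bumps.add[OF add.IH] by (subst partial_deriv_add) (auto intro: bumps_differentiable)
next
  case (mult f g)
  then show ?case
    using bumps.add[OF bumps.mult[OF mult.hyps(1) mult.IH(2)] bumps.mult[OF mult.IH(1) mult.hyps(2)]]
    by (subst partial_deriv_mult) (auto intro: bumps_differentiable)
qed

lemma bumps_smooth: "bumps \<subseteq> smooth"
  unfolding smooth_def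
  using foldr_partial_deriv_mem[of _ bumps] bumps_partial_deriv bumps_differentiable by blast

lemma bumps_prod: "finite I \<Longrightarrow> (\<And>i. i \<in> I \<Longrightarrow> f i \<in> bumps) \<Longrightarrow> (\<lambda>x. \<Prod>i\<in>I. f i x) \<in> bumps"
  by (induction I rule: finite_induct) (auto intro: bumps.const bumps.mult)

text \<open>In each coordinate a product \<open>flat 0 (n * (x - a)) * flat 0 (n * (c - x))\<close>
  vanishes outside the open interval and tends to 1 inside, as \<open>exp (- 1 / (n * d))\<close>
  does for \<open>d > 0\<close>. Boxes are enough because they generate the Borel sets.\<close>

lemma box_bump:
  fixes a c :: "'a::euclidean_space"
  obtains f :: "nat \<Rightarrow> 'a \<Rightarrow> complex" where
    "\<And>n. f n \<in> schwartz" "\<And>n x. cmod (f n x) \<le> indicator (box a c) x"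
    "\<And>x. (\<lambda>n. f n x) \<longlonglongrightarrow> indicator (box a c) x"
proof
  \<comment> \<open>Written in the affine form \<open>s * (x \<bullet> b) + d\<close> that the rule
    \<open>bumps.flat\<close> expects.\<close>
  define u where "u n x b = flat 0 (real n * (x \<bullet> b) + - real n * (a \<bullet> b)) * flat 0 (- real n * (x \<bullet> b) + real n * (c \<bullet> b))"
    for n x and b :: 'a
  define f where "f n x = complex_of_real (\<Prod>b\<in>Basis. u n x b)" for n x
  have u0: "0 \<le> u n x b" "u n x b \<le> 1" for n x b
    unfolding u_def using flat_0_bounds by (auto intro!: mult_le_one mult_nonneg_nonneg)
  have uz: "u n x b = 0" if "\<not> (a \<bullet> b < x \<bullet> b \<and> x \<bullet> b < c \<bullet> b)" for n x b
  proof -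
    have "real n * (x \<bullet> b) + - real n * (a \<bullet> b) = real n * (x \<bullet> b - a \<bullet> b)"
      "- real n * (x \<bullet> b) + real n * (c \<bullet> b) = real n * (c \<bullet> b - x \<bullet> b)" by (auto simp: algebra_simps)
    then show ?thesis using that unfolding u_def flat_def
      by (auto simp: zero_less_mult_iff)
  qed
  have out: "f n x = 0" if x: "x \<notin> box a c" for n x
  proof -
    obtain b where "b \<in> Basis" "\<not> (a \<bullet> b < x \<bullet> b \<and> x \<bullet> b < c \<bullet> b)" using x unfolding mem_box by blast
    then show ?thesis unfolding f_def by (auto intro!: prod_zero uz simp del: of_real_prod)
  qed
  show le: "cmod (f n x) \<le> indicator (box a c) x" for n x
  proof (cases "x \<in> box a c")
    case True
    have "\<bar>\<Prod>b\<in>Basis. u n x b\<bar> \<le> 1"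
      using u0 by (simp add: abs_prod prod_le_1)
    then show ?thesis using True by (simp add: f_def del: of_real_prod)
  qed (simp add: out)
  show "f n \<in> schwartz" for n
  proof -
    have "(\<lambda>x. \<Prod>b\<in>Basis. of_real (flat 0 (real n * (x \<bullet> b) + - real n * (a \<bullet> b))) * of_real (flat 0 (- real n * (x \<bullet> b) + real n * (c \<bullet> b)))) \<in> (bumps :: ('a \<Rightarrow> complex) set)"
      by (intro bumps_prod bumps.mult bumps.flat) auto
    then have "f n \<in> bumps" unfolding f_def[abs_def] u_def by simp
    moreover obtain r where r: "\<forall>x\<in>box a c. norm x \<le> r"
      using bounded_box unfolding bounded_iff by blast
    have "f n x = 0" if "norm x > r" for x using that r by (intro out) auto
    ultimately show ?thesis using bumps_smooth by (intro smooth_vanishing_schwartz[of _ r]) auto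
  qed
  show "(\<lambda>n. f n x) \<longlonglongrightarrow> indicator (box a c) x" for x
  proof (cases "x \<in> box a c")
    case True
    have flat_lim: "(\<lambda>n. flat 0 (real n * d)) \<longlonglongrightarrow> 1" if "d > 0" for d
    proof -
      have "(\<lambda>n::nat. exp (- 1 / (real n * d))) \<longlonglongrightarrow> 1" using that by real_asymp
      then show ?thesis
        by (rule Lim_transform_eventually)
          (use that in \<open>auto simp: flat_def intro!: eventually_mono[OF eventually_gt_at_top[of 0]]\<close>)
    qed
    have "(\<lambda>n. u n x b) \<longlonglongrightarrow> 1 * 1" if b: "b \<in> Basis" for b
    proof -
      have eq: "u n x b = flat 0 (real n * (x \<bullet> b - a \<bullet> b)) * flat 0 (real n * (c \<bullet> b - x \<bullet> b))" for n
        unfolding u_def by (simp add: algebra_simps)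
      have "0 < x \<bullet> b - a \<bullet> b" "0 < c \<bullet> b - x \<bullet> b" using True b by (auto simp: mem_box)
      then show ?thesis unfolding eq by (intro tendsto_mult flat_lim)
    qed
    then have "(\<lambda>n. \<Prod>b\<in>Basis. u n x b) \<longlonglongrightarrow> (\<Prod>b\<in>(Basis::'a set). 1)"
      by (intro tendsto_prod) auto
    then have "(\<lambda>n. f n x) \<longlonglongrightarrow> of_real 1"
      unfolding f_def by (intro tendsto_of_real) simp
    then show ?thesis using True by simp
  qed (simp add: out)
qed

subsection \<open>Square-integrable functions\<close>

lemma L2_measurable: "f \<in> L2 M \<Longrightarrow> f \<in> borel_measurable M"
  by (simp add: L2_def)

lemma L2_integrable: "f \<in> L2 M \<Longrightarrow> integrable M (\<lambda>x. (cmod (f x))\<^sup>2)"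
  by (simp add: L2_def)

lemma L2_bound:
  assumes "f \<in> borel_measurable M" "integrable M w" "\<And>x. x \<in> space M \<Longrightarrow> (cmod (f x))\<^sup>2 \<le> w x"
  shows "f \<in> L2 M"
proof -
  have "integrable M (\<lambda>x. (cmod (f x))\<^sup>2)"
    by (rule Bochner_Integration.integrable_bound[OF assms(2)])
      (use assms(1) in measurable, use assms(3) in \<open>auto intro!: AE_I2 order_trans[OF assms(3)]\<close>)
  then show ?thesis using assms(1) by (simp add: L2_def)
qed

lemma L2_add: assumes "f \<in> L2 M" "g \<in> L2 M" shows "(\<lambda>x. f x + g x) \<in> L2 M"
proof (rule L2_bound)
  show "integrable M (\<lambda>x. 2 * (cmod (f x))\<^sup>2 + 2 * (cmod (g x))\<^sup>2)"
    using assms by (intro Bochner_Integration.integrable_add integrable_mult_right L2_integrable)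
  show "(\<lambda>x. f x + g x) \<in> borel_measurable M"
    using assms[THEN L2_measurable] by measurable
  show "(cmod (f x + g x))\<^sup>2 \<le> 2 * (cmod (f x))\<^sup>2 + 2 * (cmod (g x))\<^sup>2" for x
  proof -
    have "(cmod (f x + g x))\<^sup>2 \<le> (cmod (f x) + cmod (g x))\<^sup>2" by (intro power_mono norm_triangle_ineq) auto
    also have "\<dots> \<le> 2 * (cmod (f x))\<^sup>2 + 2 * (cmod (g x))\<^sup>2"
      using zero_le_power2[of "cmod (f x) - cmod (g x)"] unfolding power2_diff power2_sum by linarith
    finally show ?thesis .
  qed
qed

lemma L2_cmult: assumes "f \<in> L2 M" shows "(\<lambda>x. c * f x) \<in> L2 M"
  by (rule L2_bound[where w="\<lambda>x. (cmod c)\<^sup>2 * (cmod (f x))\<^sup>2"])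
    (use assms in \<open>auto dest: L2_measurable L2_integrable simp: norm_mult power_mult_distrib\<close>)

lemma L2_diff: "f \<in> L2 M \<Longrightarrow> g \<in> L2 M \<Longrightarrow> (\<lambda>x. f x - g x) \<in> L2 M"
  using L2_add[OF _ L2_cmult[of g M "- 1"], of f] by simp

lemma L2_norm_nonneg: "0 \<le> L2_norm M f"
  by (simp add: L2_norm_def)

lemma L2_norm_power2: "(L2_norm M f)\<^sup>2 = (\<integral>x. (cmod (f x))\<^sup>2 \<partial>M)"
  by (simp add: L2_norm_def)

lemma L2_norm_cmult: "L2_norm M (\<lambda>x. c * f x) = cmod c * L2_norm M f"
  by (simp add: L2_norm_def norm_mult power_mult_distrib real_sqrt_mult)

lemma L2_norm_minus_commute: "L2_norm M (\<lambda>x. f x - g x) = L2_norm M (\<lambda>x. g x - f x)"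
  by (simp add: L2_norm_def norm_minus_commute)

lemma L2_Cauchy_Schwarz:
  assumes f: "f \<in> L2 M" and g: "g \<in> L2 M"
  shows "integrable M (\<lambda>x. cmod (f x) * cmod (g x))"
    and "(\<integral>x. cmod (f x) * cmod (g x) \<partial>M) \<le> L2_norm M f * L2_norm M g"
proof -
  note L2_measurable[OF f, measurable] L2_measurable[OF g, measurable]
  show i: "integrable M (\<lambda>x. cmod (f x) * cmod (g x))"
  proof (rule Bochner_Integration.integrable_bound)
    show "integrable M (\<lambda>x. (cmod (f x))\<^sup>2 + (cmod (g x))\<^sup>2)"
      using f g by (intro Bochner_Integration.integrable_add L2_integrable)
    have "cmod (f x) * cmod (g x) \<le> (cmod (f x))\<^sup>2 + (cmod (g x))\<^sup>2" for x
    proof -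
      have "0 \<le> (cmod (f x) - cmod (g x))\<^sup>2" "0 \<le> cmod (f x) * cmod (g x)" by auto
      then show ?thesis unfolding power2_diff by linarith
    qed
    then show "AE x in M. norm (cmod (f x) * cmod (g x)) \<le> norm ((cmod (f x))\<^sup>2 + (cmod (g x))\<^sup>2)"
      by (auto simp: abs_mult)
  qed measurable
  have nn: "(\<integral>\<^sup>+x. (ennreal (cmod (h x)))\<^sup>2 \<partial>M) = ennreal ((L2_norm M h)\<^sup>2)" if "h \<in> L2 M" for h
    unfolding L2_norm_power2 using L2_integrable[OF that]
    by (subst nn_integral_eq_integral[symmetric]) (auto simp: ennreal_power)
  have "(\<integral>\<^sup>+x. ennreal (cmod (f x)) * ennreal (cmod (g x)) \<partial>M) = ennreal (\<integral>x. cmod (f x) * cmod (g x) \<partial>M)"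
    using i by (subst nn_integral_eq_integral[symmetric]) (auto simp: ennreal_mult)
  then have "ennreal ((\<integral>x. cmod (f x) * cmod (g x) \<partial>M)\<^sup>2) \<le> ennreal ((L2_norm M f)\<^sup>2) * ennreal ((L2_norm M g)\<^sup>2)"
    using Cauchy_Schwarz_nn_integral[of "\<lambda>x. ennreal (cmod (f x))" M "\<lambda>x. ennreal (cmod (g x))"]
    unfolding nn[OF f] nn[OF g] by (simp add: ennreal_power)
  then have "(\<integral>x. cmod (f x) * cmod (g x) \<partial>M)\<^sup>2 \<le> (L2_norm M f * L2_norm M g)\<^sup>2"
    by (simp add: ennreal_mult[symmetric] power_mult_distrib)
  then show "(\<integral>x. cmod (f x) * cmod (g x) \<partial>M) \<le> L2_norm M f * L2_norm M g"
    by (rule power2_le_imp_le) (simp add: L2_norm_nonneg)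
qed

lemma L2_norm_triangle:
  assumes f: "f \<in> L2 M" and g: "g \<in> L2 M"
  shows "L2_norm M (\<lambda>x. f x + g x) \<le> L2_norm M f + L2_norm M g"
proof (rule power2_le_imp_le)
  have "(L2_norm M (\<lambda>x. f x + g x))\<^sup>2 \<le> (\<integral>x. (cmod (f x))\<^sup>2 + 2 * (cmod (f x) * cmod (g x)) + (cmod (g x))\<^sup>2 \<partial>M)"
    unfolding L2_norm_power2
  proof (rule integral_mono)
    show "(cmod (f x + g x))\<^sup>2 \<le> (cmod (f x))\<^sup>2 + 2 * (cmod (f x) * cmod (g x)) + (cmod (g x))\<^sup>2" for x
      using power_mono[OF norm_triangle_ineq[of "f x" "g x"] norm_ge_zero, of 2] unfolding power2_sum by linarith
    show "integrable M (\<lambda>x. (cmod (f x + g x))\<^sup>2)" by (intro L2_integrable L2_add f g)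
    show "integrable M (\<lambda>x. (cmod (f x))\<^sup>2 + 2 * (cmod (f x) * cmod (g x)) + (cmod (g x))\<^sup>2)"
      by (intro Bochner_Integration.integrable_add integrable_mult_right L2_integrable L2_Cauchy_Schwarz f g)
  qed
  also have "\<dots> = (L2_norm M f)\<^sup>2 + 2 * (\<integral>x. cmod (f x) * cmod (g x) \<partial>M) + (L2_norm M g)\<^sup>2"
    unfolding L2_norm_power2
    using L2_integrable[OF f] L2_integrable[OF g] L2_Cauchy_Schwarz(1)[OF f g] by simp
  also have "\<dots> \<le> (L2_norm M f + L2_norm M g)\<^sup>2"
    unfolding power2_sum using L2_Cauchy_Schwarz(2)[OF f g] by linarith
  finally show "(L2_norm M (\<lambda>x. f x + g x))\<^sup>2 \<le> (L2_norm M f + L2_norm M g)\<^sup>2" .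
qed (simp add: L2_norm_nonneg)

lemma L2_norm_triangle_diff:
  assumes "f \<in> L2 M" "g \<in> L2 M" "h \<in> L2 M"
  shows "L2_norm M (\<lambda>x. f x - h x) \<le> L2_norm M (\<lambda>x. f x - g x) + L2_norm M (\<lambda>x. g x - h x)"
  using L2_norm_triangle[OF L2_diff[OF assms(1,2)] L2_diff[OF assms(2,3)]] by simp

lemma L2_norm_eq_0:
  assumes f: "f \<in> L2 M" and 0: "L2_norm M f = 0" shows "AE x in M. f x = 0"
proof -
  have "(\<integral>x. (cmod (f x))\<^sup>2 \<partial>M) = 0" using 0 L2_norm_power2[of M f] by simp
  then have "AE x in M. (cmod (f x))\<^sup>2 = 0"
    using integral_nonneg_eq_0_iff_AE[OF L2_integrable[OF f]] by simp
  then show ?thesis by simp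
qed

lemma L2_norm_cong_AE:
  assumes "f \<in> L2 M" "g \<in> L2 M" "AE x in M. f x = g x" shows "L2_norm M f = L2_norm M g"
proof -
  have "(\<integral>x. (cmod (f x))\<^sup>2 \<partial>M) = (\<integral>x. (cmod (g x))\<^sup>2 \<partial>M)"
    using assms by (intro integral_cong_AE) (auto dest: L2_measurable)
  then show ?thesis by (simp add: L2_norm_def)
qed

lemma L2_dominated_limit:
  assumes f: "\<And>n. f n \<in> L2 M" and g: "g \<in> borel_measurable M"
    and w: "integrable M (\<lambda>x. (w x)\<^sup>2)" and le: "\<And>n x. x \<in> space M \<Longrightarrow> cmod (f n x) \<le> w x"
    and lim: "\<And>x. x \<in> space M \<Longrightarrow> (\<lambda>n. f n x) \<longlonglongrightarrow> g x"
  shows "g \<in> L2 M" "(\<lambda>n. L2_norm M (\<lambda>x. g x - f n x)) \<longlonglongrightarrow> 0"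
proof -
  have gw: "cmod (g x) \<le> w x" if "x \<in> space M" for x
    by (rule LIMSEQ_le_const2[OF tendsto_norm[OF lim[OF that]]]) (use le[OF that] in auto)
  show g2: "g \<in> L2 M"
    by (rule L2_bound[OF g w]) (intro power_mono gw norm_ge_zero)
  have "(\<lambda>n. \<integral>x. (cmod (g x - f n x))\<^sup>2 \<partial>M) \<longlonglongrightarrow> (\<integral>x. 0 \<partial>M)"
  proof (rule integral_dominated_convergence)
    \<comment> \<open>The limit inherits the bound \<open>w\<close>, so the differences are bounded
      by \<open>2 * w\<close>.\<close>
    show "integrable M (\<lambda>x. 4 * (w x)\<^sup>2)" using w by simp
    show "AE x in M. (\<lambda>n. (cmod (g x - f n x))\<^sup>2) \<longlonglongrightarrow> 0"
    proof (rule AE_I2)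
      fix x assume "x \<in> space M"
      from tendsto_power[OF tendsto_norm[OF tendsto_diff[OF tendsto_const lim[OF this]]], of "g x" 2]
      show "(\<lambda>n. (cmod (g x - f n x))\<^sup>2) \<longlonglongrightarrow> 0" by simp
    qed
    show "AE x in M. norm ((cmod (g x - f n x))\<^sup>2) \<le> 4 * (w x)\<^sup>2" for n
    proof (rule AE_I2)
      fix x assume x: "x \<in> space M"
      have "cmod (g x - f n x) \<le> 2 * w x"
        using norm_triangle_ineq4[of "g x" "f n x"] le[OF x, of n] gw[OF x] by linarith
      then have "(cmod (g x - f n x))\<^sup>2 \<le> (2 * w x)\<^sup>2" by (intro power_mono) auto
      then show "norm ((cmod (g x - f n x))\<^sup>2) \<le> 4 * (w x)\<^sup>2" by (simp add: power_mult_distrib)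
    qed
  next
    note L2_measurable[OF f, measurable] g[measurable]
    show "(\<lambda>x. (cmod (g x - f n x))\<^sup>2) \<in> borel_measurable M" for n by measurable
  qed simp
  then have "(\<lambda>n. sqrt (\<integral>x. (cmod (g x - f n x))\<^sup>2 \<partial>M)) \<longlonglongrightarrow> sqrt 0"
    by (intro tendsto_real_sqrt) simp
  then show "(\<lambda>n. L2_norm M (\<lambda>x. g x - f n x)) \<longlonglongrightarrow> 0" by (simp add: L2_norm_def)
qed

text \<open>Riesz-Fischer for a sequence with geometric rate. Cauchy-Schwarz against the constant 1,
  of norm 1 on a probability space, makes the increments summable almost everywhere; Fatou's lemma
  returns the same rate for the limit.\<close>

lemma (in prob_space) L2_complete:
  assumes F: "\<And>n. F n \<in> L2 M" and Cauchy: "\<And>m n. n \<le> m \<Longrightarrow> L2_norm M (\<lambda>x. F m x - F n x) \<le> (1 / 2) ^ n"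
  obtains G where "G \<in> L2 M" "\<And>n. L2_norm M (\<lambda>x. G x - F n x) \<le> (1 / 2) ^ n"
proof -
  note L2_measurable[OF F, measurable]
  \<comment> \<open>At points of divergence \<open>lim\<close> is an unspecified value; these points
    turn out to form a null set, and \<open>G\<close> is measurable in any case.\<close>
  define G where "G x = lim (\<lambda>n. F n x)" for x
  have [measurable]: "G \<in> borel_measurable M" unfolding G_def by measurable
  define D where "D n x = F (Suc n) x - F n x" for n x
  have D: "D n \<in> L2 M" for n unfolding D_def[abs_def] by (intro L2_diff F)
  note L2_measurable[OF D, measurable]
  have one: "(\<lambda>x. 1) \<in> L2 M" "L2_norm M (\<lambda>x. 1) = 1" by (auto simp: L2_def L2_norm_def prob_space)
  have D1: "(\<integral>\<^sup>+x. cmod (D n x) \<partial>M) \<le> ennreal ((1 / 2) ^ n)" for n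
  proof -
    have "(\<integral>x. cmod (D n x) \<partial>M) \<le> (1 / 2) ^ n"
      using L2_Cauchy_Schwarz(2)[OF D one(1), of n] Cauchy[of n "Suc n"] one(2) by (simp add: D_def[abs_def])
    moreover have "(\<integral>\<^sup>+x. cmod (D n x) \<partial>M) = ennreal (\<integral>x. cmod (D n x) \<partial>M)"
      using L2_Cauchy_Schwarz(1)[OF D one(1), of n] by (intro nn_integral_eq_integral) auto
    ultimately show ?thesis by (simp add: ennreal_leI)
  qed
  have "(\<integral>\<^sup>+x. (\<Sum>n. ennreal (cmod (D n x))) \<partial>M) = (\<Sum>n. \<integral>\<^sup>+x. cmod (D n x) \<partial>M)"
    by (intro nn_integral_suminf) measurable
  also have "\<dots> \<le> (\<Sum>n. ennreal ((1 / 2) ^ n))" by (intro suminf_le D1) auto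
  also have "\<dots> < \<infinity>" by (subst suminf_ennreal2) (auto intro: summable_geometric)
  finally have "AE x in M. (\<Sum>n. ennreal (cmod (D n x))) \<noteq> \<infinity>"
    by (intro nn_integral_PInf_AE) auto
  then have lim: "AE x in M. (\<lambda>n. F n x) \<longlonglongrightarrow> G x"
  proof eventually_elim
    case (elim x)
    then have "summable (\<lambda>n. cmod (D n x))" by (intro summable_suminf_not_top) auto
    then have "summable (\<lambda>n. D n x)" by (rule summable_norm_cancel)
    then have "convergent (\<lambda>n. F n x - F 0 x)"
      by (simp add: summable_iff_convergent D_def sum_lessThan_telescope[of "\<lambda>n. F n x"])
    from convergent_add[OF this convergent_const[of "F 0 x"]]
    have "convergent (\<lambda>n. F n x)" by simp
    then show ?case unfolding G_def by (simp add: convergent_LIMSEQ_iff)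
  qed
  have bound: "(\<integral>\<^sup>+x. ennreal ((cmod (G x - F n x))\<^sup>2) \<partial>M) \<le> ennreal (((1 / 2) ^ n)\<^sup>2)" for n
  proof -
    have "(\<integral>\<^sup>+x. ennreal ((cmod (G x - F n x))\<^sup>2) \<partial>M) = (\<integral>\<^sup>+x. liminf (\<lambda>m. ennreal ((cmod (F m x - F n x))\<^sup>2)) \<partial>M)"
    proof (rule nn_integral_cong_AE)
      show "AE x in M. ennreal ((cmod (G x - F n x))\<^sup>2) = liminf (\<lambda>m. ennreal ((cmod (F m x - F n x))\<^sup>2))"
        using lim
      proof eventually_elim
        case (elim x)
        then have "(\<lambda>m. ennreal ((cmod (F m x - F n x))\<^sup>2)) \<longlonglongrightarrow> ennreal ((cmod (G x - F n x))\<^sup>2)"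
          by (intro tendsto_intros) auto
        then show ?case by (intro lim_imp_Liminf[symmetric]) auto
      qed
    qed
    also have "\<dots> \<le> liminf (\<lambda>m. \<integral>\<^sup>+x. ennreal ((cmod (F m x - F n x))\<^sup>2) \<partial>M)"
      by (intro nn_integral_liminf) measurable
    also have "\<dots> \<le> limsup (\<lambda>m. \<integral>\<^sup>+x. ennreal ((cmod (F m x - F n x))\<^sup>2) \<partial>M)"
      by (intro Liminf_le_Limsup) simp
    also have "\<dots> \<le> ennreal (((1 / 2) ^ n)\<^sup>2)"
    proof (rule Limsup_bounded)
      show "\<forall>\<^sub>F m in sequentially. (\<integral>\<^sup>+x. ennreal ((cmod (F m x - F n x))\<^sup>2) \<partial>M) \<le> ennreal (((1 / 2) ^ n)\<^sup>2)"
        using eventually_ge_at_top[of n]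
      proof eventually_elim
        case (elim m)
        have "(\<integral>\<^sup>+x. ennreal ((cmod (F m x - F n x))\<^sup>2) \<partial>M) = ennreal ((L2_norm M (\<lambda>x. F m x - F n x))\<^sup>2)"
          unfolding L2_norm_power2 by (intro nn_integral_eq_integral L2_integrable L2_diff F) auto
        also have "\<dots> \<le> ennreal (((1 / 2) ^ n)\<^sup>2)"
          by (intro ennreal_leI power_mono Cauchy elim L2_norm_nonneg)
        finally show ?case .
      qed
    qed
    finally show ?thesis .
  qed
  have diff: "(\<lambda>x. G x - F n x) \<in> L2 M" for n
    unfolding L2_def mem_Collect_eq
  proof
    show "integrable M (\<lambda>x. (cmod (G x - F n x))\<^sup>2)"
      by (rule integrableI_nonneg) (auto intro: le_less_trans[OF bound])
  qed measurable
  have "(\<lambda>x. (G x - F 0 x) + F 0 x) \<in> L2 M" by (intro L2_add diff F)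
  then have "G \<in> L2 M" by simp
  moreover have "L2_norm M (\<lambda>x. G x - F n x) \<le> (1 / 2) ^ n" for n
  proof (rule power2_le_imp_le)
    have "ennreal ((L2_norm M (\<lambda>x. G x - F n x))\<^sup>2) = (\<integral>\<^sup>+x. ennreal ((cmod (G x - F n x))\<^sup>2) \<partial>M)"
      unfolding L2_norm_power2 by (intro nn_integral_eq_integral[symmetric] L2_integrable diff) auto
    then have "ennreal ((L2_norm M (\<lambda>x. G x - F n x))\<^sup>2) \<le> ennreal (((1 / 2) ^ n)\<^sup>2)" using bound[of n] by simp
    then show "(L2_norm M (\<lambda>x. G x - F n x))\<^sup>2 \<le> ((1 / 2) ^ n)\<^sup>2" by (subst (asm) ennreal_le_iff) auto
  qed simp
  ultimately show ?thesis by (rule that)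
qed

lemma L2_norm_cong:
  "(\<And>x. x \<in> space M \<Longrightarrow> f x = g x) \<Longrightarrow> L2_norm M f = L2_norm M g"
  unfolding L2_norm_def by (intro arg_cong[where f=sqrt] Bochner_Integration.integral_cong) auto

lemma L2_inner_self: "L2_inner M f f = of_real ((L2_norm M f)\<^sup>2)"
proof -
  have "f x * cnj (f x) = of_real ((cmod (f x))\<^sup>2)" for x
    by (simp add: complex_norm_square[symmetric])
  then show ?thesis unfolding L2_inner_def L2_norm_power2 by (simp del: of_real_power)
qed

subsection \<open>Schwartz functions are dense in L2\<close>

locale tempered =
  fixes \<sigma> :: "'a::euclidean_space measure"
  assumes radon_\<sigma>: "radon \<sigma>" and weight_\<sigma>: "(\<integral>\<^sup>+x. weight x \<partial>\<sigma>) < \<infinity>"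
begin

lemma sets_\<sigma> [measurable_cong]: "sets \<sigma> = sets borel"
  by (rule radon_sets[OF radon_\<sigma>])

lemma space_\<sigma> [simp]: "space \<sigma> = UNIV"
  by (rule radon_space[OF radon_\<sigma>])

lemma schwartz_L2:
  assumes f: "f \<in> schwartz" shows "f \<in> L2 \<sigma>"
proof -
  note schwartz_measurable[OF f, measurable]
  obtain C where C: "C \<ge> 0" "\<And>x. cmod (f x) \<le> C * weight x"
    using rapid_le_weight[OF schwartz_rapid[OF f]] by blast
  show ?thesis
  proof (rule L2_bound)
    have "integrable \<sigma> weight"
      using weight_\<sigma> by (intro integrableI_nonneg AE_I2 less_imp_le weight_pos) auto
    then show "integrable \<sigma> (\<lambda>x. C\<^sup>2 * weight x)" by (rule integrable_mult_right)
    show "(cmod (f x))\<^sup>2 \<le> C\<^sup>2 * weight x" for x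
    proof -
      have "(cmod (f x))\<^sup>2 \<le> (C * weight x)\<^sup>2" by (intro power_mono C) auto
      also have "\<dots> \<le> C\<^sup>2 * (weight x * 1)"
        unfolding power_mult_distrib power2_eq_square[of "weight x"]
        by (rule mult_left_mono[OF mult_left_mono[OF weight_le_1 less_imp_le[OF weight_pos]] zero_le_power2])
      finally show ?thesis by simp
    qed
  qed measurable
qed

definition approximable :: "('a \<Rightarrow> complex) set" where
  "approximable = {f \<in> L2 \<sigma>. \<forall>e>0. \<exists>g\<in>schwartz. L2_norm \<sigma> (\<lambda>x. f x - g x) < e}"

lemma approximable_schwartz: "f \<in> schwartz \<Longrightarrow> f \<in> approximable"
  unfolding approximable_def using schwartz_L2 by (auto intro!: bexI[of _ f] simp: L2_norm_def)

lemma approximable_L2: "f \<in> approximable \<Longrightarrow> f \<in> L2 \<sigma>"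
  by (simp add: approximable_def)

lemma approximable_limit:
  assumes f: "\<And>n. f n \<in> approximable" and g: "g \<in> L2 \<sigma>"
    and lim: "(\<lambda>n. L2_norm \<sigma> (\<lambda>x. g x - f n x)) \<longlonglongrightarrow> 0"
  shows "g \<in> approximable"
  unfolding approximable_def
proof (intro CollectI conjI g allI impI)
  fix e :: real assume e: "e > 0"
  then have "\<forall>\<^sub>F n in sequentially. L2_norm \<sigma> (\<lambda>x. g x - f n x) < e / 2"
    using lim by (intro order_tendstoD(2)) auto
  then obtain n where n: "L2_norm \<sigma> (\<lambda>x. g x - f n x) < e / 2"
    by (auto simp: eventually_sequentially)
  obtain h where h: "h \<in> schwartz" "L2_norm \<sigma> (\<lambda>x. f n x - h x) < e / 2"
    using f[of n] e unfolding approximable_def by (auto dest!: spec[of _ "e / 2"])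
  have "L2_norm \<sigma> (\<lambda>x. g x - h x) < e"
    using L2_norm_triangle_diff[OF g approximable_L2[OF f] schwartz_L2[OF h(1)], of n] n h(2) by linarith
  then show "\<exists>h\<in>schwartz. L2_norm \<sigma> (\<lambda>x. g x - h x) < e" using h(1) by blast
qed

lemma approximable_dominated:
  assumes "\<And>n. f n \<in> approximable" "g \<in> borel_measurable borel" "integrable \<sigma> (\<lambda>x. (w x)\<^sup>2)"
    "\<And>n x. cmod (f n x) \<le> w x" "\<And>x. (\<lambda>n. f n x) \<longlonglongrightarrow> g x"
  shows "g \<in> approximable"
proof (rule approximable_limit[OF assms(1)])
  have "g \<in> borel_measurable \<sigma>" using assms(2) by measurable
  note lim = L2_dominated_limit[OF approximable_L2[OF assms(1)] this assms(3) assms(4) assms(5)]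
  show "g \<in> L2 \<sigma>" "(\<lambda>n. L2_norm \<sigma> (\<lambda>x. g x - f n x)) \<longlonglongrightarrow> 0" by (rule lim)+
qed

lemma approximable_add:
  assumes "f \<in> approximable" "g \<in> approximable" shows "(\<lambda>x. f x + g x) \<in> approximable"
  unfolding approximable_def
proof (intro CollectI conjI allI impI)
  show "(\<lambda>x. f x + g x) \<in> L2 \<sigma>" using assms by (intro L2_add approximable_L2)
  fix e :: real assume e: "e > 0"
  obtain u where u: "u \<in> schwartz" "L2_norm \<sigma> (\<lambda>x. f x - u x) < e / 2"
    using assms(1) e unfolding approximable_def by (auto dest!: spec[of _ "e / 2"])
  obtain v where v: "v \<in> schwartz" "L2_norm \<sigma> (\<lambda>x. g x - v x) < e / 2"
    using assms(2) e unfolding approximable_def by (auto dest!: spec[of _ "e / 2"])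
  have "L2_norm \<sigma> (\<lambda>x. (f x - u x) + (g x - v x)) \<le> L2_norm \<sigma> (\<lambda>x. f x - u x) + L2_norm \<sigma> (\<lambda>x. g x - v x)"
    using assms u v by (intro L2_norm_triangle L2_diff approximable_L2 schwartz_L2)
  then have "L2_norm \<sigma> (\<lambda>x. f x + g x - (u x + v x)) < e"
    using u(2) v(2) by (simp add: algebra_simps)
  then show "\<exists>h\<in>schwartz. L2_norm \<sigma> (\<lambda>x. f x + g x - h x) < e"
    using schwartz_add[OF u(1) v(1)] by (intro bexI[of _ "\<lambda>x. u x + v x"])
qed

lemma approximable_cmult:
  assumes "f \<in> approximable" shows "(\<lambda>x. c * f x) \<in> approximable"
  unfolding approximable_def
proof (intro CollectI conjI allI impI)
  show "(\<lambda>x. c * f x) \<in> L2 \<sigma>" using assms by (intro L2_cmult approximable_L2)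
  fix e :: real assume e: "e > 0"
  have p: "cmod c + 1 > 0" by (simp add: add_nonneg_pos)
  then have "e / (cmod c + 1) > 0" using e by simp
  then obtain u where u: "u \<in> schwartz" "L2_norm \<sigma> (\<lambda>x. f x - u x) < e / (cmod c + 1)"
    using assms unfolding approximable_def by blast
  have "L2_norm \<sigma> (\<lambda>x. c * f x - c * u x) = cmod c * L2_norm \<sigma> (\<lambda>x. f x - u x)"
    unfolding right_diff_distrib[symmetric] by (rule L2_norm_cmult)
  also have "\<dots> \<le> (cmod c + 1) * L2_norm \<sigma> (\<lambda>x. f x - u x)"
    by (intro mult_right_mono L2_norm_nonneg) auto
  also have "\<dots> < e" using u(2) p by (simp add: field_simps)
  finally show "\<exists>h\<in>schwartz. L2_norm \<sigma> (\<lambda>x. c * f x - h x) < e"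
    using schwartz_cmult[OF u(1)] by (intro bexI[of _ "\<lambda>x. c * u x"])
qed

lemma approximable_sum:
  "finite I \<Longrightarrow> (\<And>i. i \<in> I \<Longrightarrow> f i \<in> approximable) \<Longrightarrow> (\<lambda>x. \<Sum>i\<in>I. f i x) \<in> approximable"
proof (induction I rule: finite_induct)
  case empty
  \<comment> \<open>The zero function arises by scaling some Schwartz function, here one supplied by
    \<open>box_bump\<close>.\<close>
  have "(\<lambda>x. 0 * f x) \<in> schwartz" if "f \<in> schwartz" for f :: "'a \<Rightarrow> complex" using that by (rule schwartz_cmult)
  moreover obtain f :: "'a \<Rightarrow> complex" where "f \<in> schwartz" using box_bump[of 0 0] by metis
  ultimately show ?case using approximable_schwartz by fastforce
qed (auto intro: approximable_add)

lemma integrable_indicator_square: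
  assumes "A \<in> sets borel" "emeasure \<sigma> A < \<infinity>"
  shows "integrable \<sigma> (\<lambda>x. (indicator A x :: real)\<^sup>2)"
proof -
  have "(indicator A x :: real)\<^sup>2 = indicator A x" for x by (simp add: indicator_def)
  then show ?thesis using assms by (simp add: sets_\<sigma>)
qed

lemma approximable_box: "indicator (box a c) \<in> approximable"
proof -
  obtain f :: "nat \<Rightarrow> 'a \<Rightarrow> complex" where f: "\<And>n. f n \<in> schwartz" "\<And>n x. cmod (f n x) \<le> indicator (box a c) x"
    "\<And>x. (\<lambda>n. f n x) \<longlonglongrightarrow> indicator (box a c) x"
    using box_bump[of a c] by metis
  show ?thesis
    by (rule approximable_dominated[OF approximable_schwartz[OF f(1)] _ integrable_indicator_square f(2,3)])
      (use radon_finite[OF radon_\<sigma> bounded_box, of a c] in auto)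
qed

text \<open>A Dynkin argument over boxes. Intersecting with one fixed box keeps all masses finite
  and supplies the dominating function for countable disjoint unions.\<close>

lemma approximable_bounded_borel:
  assumes A: "A \<in> sets borel"
  shows "indicator (A \<inter> box a c) \<in> approximable"
proof -
  let ?Q = "box a c"
  have finQ: "emeasure \<sigma> ?Q < \<infinity>" by (rule radon_finite[OF radon_\<sigma> bounded_box])
  have "Int_stable (range (\<lambda>(a, b). box a b :: 'a set))" "range (\<lambda>(a, b). box a b) \<subseteq> Pow (UNIV :: 'a set)"
    "A \<in> sigma_sets UNIV (range (\<lambda>(a, b). box a b))"
    using A by (auto simp: Int_stable_def box_Int_box borel_eq_box)
  then show ?thesis
  proof (induction rule: sigma_sets_induct_disjoint)
    case (basic G)
    then obtain p q where "G = box p q" by auto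
    then show ?case using approximable_box by (simp add: box_Int_box)
  next
    case empty
    then show ?case using approximable_sum[of "{}" "\<lambda>_ _. 0"] by simp
  next
    case (compl A)
    have "(indicator ((UNIV - A) \<inter> ?Q) :: 'a \<Rightarrow> complex) = (\<lambda>x. indicator ?Q x + (- 1) * indicator (A \<inter> ?Q) x)"
      by (auto simp: indicator_def)
    moreover have "\<dots> \<in> approximable"
      by (intro approximable_add approximable_cmult approximable_box compl)
    ultimately show ?case by (simp only:)
  next
    case (union A)
    have Am: "A i \<in> sets borel" for i using union(2) by (auto simp: borel_eq_box)
    show ?case
    proof (rule approximable_dominated[where f="\<lambda>n x. \<Sum>i<n. indicator (A i \<inter> ?Q) x" and w="indicator ?Q"])
      show "(\<lambda>x. \<Sum>i<n. indicator (A i \<inter> ?Q) x) \<in> approximable" for n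
        using union by (intro approximable_sum) auto
      have part: "(\<Sum>i<n. indicator (A i \<inter> ?Q) x) = (indicator ((\<Union>i<n. A i) \<inter> ?Q) x :: complex)" for n x
      proof -
        have "disjoint_family_on (\<lambda>i. A i \<inter> ?Q) {..<n}"
          using union(1) unfolding disjoint_family_on_def by blast
        then have "(indicator (\<Union>i<n. A i \<inter> ?Q) x :: complex) = (\<Sum>i<n. indicator (A i \<inter> ?Q) x)"
          by (intro indicator_UN_disjoint) auto
        moreover have "(\<Union>i<n. A i \<inter> ?Q) = (\<Union>i<n. A i) \<inter> ?Q" by auto
        ultimately show ?thesis by simp
      qed
      show "cmod (\<Sum>i<n. indicator (A i \<inter> ?Q) x) \<le> indicator ?Q x" for n x
        unfolding part by (simp add: indicator_def)
      show "(\<lambda>n. \<Sum>i<n. indicator (A i \<inter> ?Q) x) \<longlonglongrightarrow> (indicator (\<Union> (range A) \<inter> ?Q) x :: complex)" for x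
      proof (cases "x \<in> \<Union> (range A) \<inter> ?Q")
        case True
        then obtain k where k: "x \<in> A k" "x \<in> ?Q" by auto
        have "\<forall>\<^sub>F n in sequentially. (\<Sum>i<n. indicator (A i \<inter> ?Q) x) = (1 :: complex)"
          using eventually_gt_at_top[of k] unfolding part
          by eventually_elim (use k in \<open>auto simp: indicator_def\<close>)
        then have "(\<lambda>n. \<Sum>i<n. indicator (A i \<inter> ?Q) x) \<longlonglongrightarrow> (1 :: complex)" by (rule tendsto_eventually)
        then show ?thesis using True by (simp only: indicator_simps(1))
      next
        case False
        then show ?thesis unfolding part by (auto simp: indicator_def)
      qed
    qed (use Am finQ in \<open>auto intro!: integrable_indicator_square borel_measurable_indicator\<close>)
  qed
qed

lemma approximable_indicator:
  assumes A: "A \<in> sets borel" and fin: "emeasure \<sigma> A < \<infinity>"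
  shows "indicator A \<in> approximable"
proof (rule approximable_dominated[where f="\<lambda>n. indicator (A \<inter> box (- real n *\<^sub>R One) (real n *\<^sub>R One))" and w="indicator A"])
  show "indicator (A \<inter> box (- real n *\<^sub>R One) (real n *\<^sub>R One)) \<in> approximable" for n
    by (rule approximable_bounded_borel[OF A])
  show "(\<lambda>n. indicator (A \<inter> box (- real n *\<^sub>R One) (real n *\<^sub>R One)) x) \<longlonglongrightarrow> (indicator A x :: complex)" for x
  proof -
    obtain k :: nat where k: "norm x < real k" using reals_Archimedean2 by blast
    have "x \<in> box (- real n *\<^sub>R One) (real n *\<^sub>R One)" if "k \<le> n" for n
    proof -
      have "\<bar>x \<bullet> b\<bar> < real n" if "b \<in> Basis" for b
        using Basis_le_norm[OF that, of x] k \<open>k \<le> n\<close> by linarith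
      then show ?thesis by (auto simp: mem_box abs_less_iff) (smt (verit) abs_less_iff)
    qed
    then have "\<forall>\<^sub>F n in sequentially. indicator (A \<inter> box (- real n *\<^sub>R One) (real n *\<^sub>R One)) x = (indicator A x :: complex)"
      unfolding eventually_sequentially by (intro exI[of _ k]) (simp add: indicator_def)
    then show ?thesis by (rule tendsto_eventually)
  qed
  show "indicator A \<in> borel_measurable borel" using A by simp
  show "integrable \<sigma> (\<lambda>x. (indicator A x :: real)\<^sup>2)" by (rule integrable_indicator_square[OF A fin])
  show "cmod (indicator (A \<inter> box (- real n *\<^sub>R One) (real n *\<^sub>R One)) x) \<le> indicator A x" for n x
    by (simp add: indicator_def)
qed

text \<open>Simple functions bounded by \<open>2 * cmod (f x)\<close> converge to \<open>f\<close>,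
  so it remains to approximate the indicators of their level sets.\<close>

lemma L2_approximable:
  assumes f: "f \<in> L2 \<sigma>" shows "f \<in> approximable"
proof -
  have fm: "f \<in> borel_measurable \<sigma>" by (rule L2_measurable[OF f])
  obtain F where F: "\<And>i. simple_function \<sigma> (F i)" "\<And>x. (\<lambda>i. F i x) \<longlonglongrightarrow> f x" "\<And>i x. cmod (F i x) \<le> 2 * cmod (f x)"
    using borel_measurable_implies_sequence_metric[OF fm, of 0] by (auto simp: dist_norm)
  have "F i \<in> approximable" for i
  proof -
    have fin: "finite (F i ` UNIV)" using F(1)[of i] by (simp add: simple_function_def)
    have Fm: "F i \<in> borel_measurable \<sigma>" by (rule borel_measurable_simple_function[OF F(1)])
    have ind: "(\<lambda>x. y * indicator (F i -` {y}) x) \<in> approximable" for y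
    proof (cases "y = 0")
      case True
      then show ?thesis using approximable_sum[of "{}" "\<lambda>_ _. 0"] by simp
    next
      case False
      have S: "F i -` {y} \<in> sets borel" using measurable_sets[OF Fm, of "{y}"] by (simp add: sets_\<sigma>)
      \<comment> \<open>Chebyshev's inequality: where the simple function takes a value
        \<open>y \<noteq> 0\<close>, the modulus of \<open>f\<close> is at least
        \<open>cmod y / 2\<close>, so this level set has finite mass.\<close>
      have "ennreal ((cmod y)\<^sup>2) * emeasure \<sigma> (F i -` {y}) = (\<integral>\<^sup>+x. ennreal ((cmod y)\<^sup>2) * indicator (F i -` {y}) x \<partial>\<sigma>)"
        using S by (simp add: nn_integral_cmult_indicator sets_\<sigma>)
      also have "\<dots> \<le> (\<integral>\<^sup>+x. ennreal (4 * (cmod (f x))\<^sup>2) \<partial>\<sigma>)"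
      proof (intro nn_integral_mono)
        fix x
        have "(cmod (F i x))\<^sup>2 \<le> (2 * cmod (f x))\<^sup>2" by (intro power_mono F) auto
        then show "ennreal ((cmod y)\<^sup>2) * indicator (F i -` {y}) x \<le> ennreal (4 * (cmod (f x))\<^sup>2)"
          by (auto simp: indicator_def power_mult_distrib intro!: ennreal_leI)
      qed
      also have "\<dots> = ennreal (\<integral>x. 4 * (cmod (f x))\<^sup>2 \<partial>\<sigma>)"
        using L2_integrable[OF f] by (intro nn_integral_eq_integral) auto
      also have "\<dots> < \<infinity>" by simp
      finally have "emeasure \<sigma> (F i -` {y}) < \<infinity>"
        using False by (auto simp: ennreal_mult_less_top)
      then show ?thesis by (intro approximable_cmult approximable_indicator S)
    qed
    have "F i = (\<lambda>x. \<Sum>y\<in>F i ` UNIV. y * indicator (F i -` {y}) x)"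
    proof
      fix x
      have "(\<Sum>y\<in>F i ` UNIV. y * indicator (F i -` {y}) x) = (\<Sum>y\<in>F i ` UNIV. if y = F i x then y else 0)"
        by (intro sum.cong) (auto simp: indicator_def)
      then show "F i x = (\<Sum>y\<in>F i ` UNIV. y * indicator (F i -` {y}) x)" using fin by simp
    qed
    moreover have "(\<lambda>x. \<Sum>y\<in>F i ` UNIV. y * indicator (F i -` {y}) x) \<in> approximable"
      by (intro approximable_sum fin ind)
    ultimately show ?thesis by (simp only:)
  qed
  then show ?thesis
  proof (rule approximable_dominated)
    show "f \<in> borel_measurable borel" using fm by measurable
    show "integrable \<sigma> (\<lambda>x. (2 * cmod (f x))\<^sup>2)" using L2_integrable[OF f] by (simp add: power_mult_distrib)
  qed (rule F)+
qed

end

section \<open>Linear structure and translations on transforms and counting functions\<close>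

lemma fourier_add:
  fixes f g :: "'a::euclidean_space \<Rightarrow> complex"
  assumes f: "f \<in> schwartz" and g: "g \<in> schwartz"
  shows "fourier (\<lambda>x. f x + g x) = (\<lambda>y. fourier f y + fourier g y)"
proof
  fix y :: 'a
  have "integrable lborel (\<lambda>x. cis (- 2 * pi * (x \<bullet> y)) * h x)" if "h \<in> schwartz" for h :: "'a \<Rightarrow> complex"
    using that by (intro integrable_cis_mult schwartz_integrable) measurable
  then show "fourier (\<lambda>x. f x + g x) y = fourier f y + fourier g y"
    using f g by (simp add: fourier_def distrib_left)
qed

lemma fourier_cmult: "fourier (\<lambda>x. c * f x) = (\<lambda>y. c * fourier f y)"
proof
  fix y
  have eq: "cis (- 2 * pi * (x \<bullet> y)) * (c * f x) = c * (cis (- 2 * pi * (x \<bullet> y)) * f x)" for x by simp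
  show "fourier (\<lambda>x. c * f x) y = c * fourier f y"
    unfolding fourier_def eq by (rule integral_mult_right_zero)
qed

text \<open>Together with \<open>counting_shift\<close> this is the intertwining relation on the
  generating pairs: translating \<open>g\<close> acts as \<open>U_rep t\<close> on its transform and
  as \<open>T_rep t\<close> on its counting function.\<close>

lemma fourier_translate:
  assumes g: "g \<in> schwartz" shows "fourier (\<lambda>x. g (x - t)) = U_rep t (fourier g)"
proof
  fix y
  note schwartz_measurable[OF g, measurable]
  have "fourier (\<lambda>x. g (x - t)) y = (\<integral>x. cis (- 2 * pi * ((x + t) \<bullet> y)) * g (x + t - t) \<partial>lborel)"
    unfolding fourier_def by (rule lborel_integral_translate[symmetric]) measurable
  also have "\<dots> = (\<integral>x. cis (- 2 * pi * (t \<bullet> y)) * (cis (- 2 * pi * (x \<bullet> y)) * g x) \<partial>lborel)"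
  proof (intro Bochner_Integration.integral_cong refl)
    fix x
    have "cis (- 2 * pi * ((x + t) \<bullet> y)) = cis (- 2 * pi * (t \<bullet> y)) * cis (- 2 * pi * (x \<bullet> y))"
      unfolding cis_mult by (simp add: inner_add_left algebra_simps)
    then show "cis (- 2 * pi * ((x + t) \<bullet> y)) * g (x + t - t) = cis (- 2 * pi * (t \<bullet> y)) * (cis (- 2 * pi * (x \<bullet> y)) * g x)"
      by (simp only: mult.assoc add_diff_cancel_right')
  qed
  finally show "fourier (\<lambda>x. g (x - t)) y = U_rep t (fourier g) y"
    by (simp add: U_rep_def fourier_def)
qed

lemma U_rep_measurable:
  assumes "f \<in> borel_measurable M" "sets M = sets borel"
  shows "U_rep t f \<in> borel_measurable M"
proof -
  have "(\<lambda>x. cis (- 2 * pi * (t \<bullet> x))) \<in> borel_measurable M"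
    unfolding measurable_cong_sets[OF assms(2) refl] by measurable
  then show ?thesis unfolding U_rep_def[abs_def] using assms(1) by measurable
qed

lemma U_rep_L2: "f \<in> L2 M \<Longrightarrow> sets M = sets borel \<Longrightarrow> U_rep t f \<in> L2 M"
  using U_rep_measurable[of f M t] by (auto simp: L2_def U_rep_def norm_mult)

lemma U_rep_norm: "L2_norm M (U_rep t f) = L2_norm M f"
  by (simp add: L2_norm_def U_rep_def norm_mult)

context ud_ergodic_process
begin

lemma T_rep_L2:
  assumes F: "F \<in> L2 \<nu>"
  shows "T_rep t F \<in> L2 \<nu>" "L2_norm \<nu> (T_rep t F) = L2_norm \<nu> F"
proof -
  note L2_measurable[OF F, measurable]
  have m: "T_rep t F \<in> borel_measurable \<nu>"
    unfolding T_rep_def[abs_def] by (rule measurable_compose[OF translate_\<nu>]) measurable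
  have "integrable (distr \<nu> \<nu> (translate (- t))) (\<lambda>\<Lambda>. (cmod (F \<Lambda>))\<^sup>2)"
    using L2_integrable[OF F] by (simp add: distr_\<nu>)
  then have "integrable \<nu> (\<lambda>\<Lambda>. (cmod (T_rep t F \<Lambda>))\<^sup>2)"
    unfolding T_rep_def by (subst (asm) integrable_distr_eq) auto
  then show "T_rep t F \<in> L2 \<nu>" using m by (simp add: L2_def)
  have "(\<integral>\<Lambda>. (cmod (F \<Lambda>))\<^sup>2 \<partial>distr \<nu> \<nu> (translate (- t))) = (\<integral>\<Lambda>. (cmod (T_rep t F \<Lambda>))\<^sup>2 \<partial>\<nu>)"
    unfolding T_rep_def by (subst integral_distr) auto
  then show "L2_norm \<nu> (T_rep t F) = L2_norm \<nu> F" by (simp add: L2_norm_def distr_\<nu>)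
qed

lemma counting_L2:
  assumes f: "f \<in> schwartz" shows "counting f \<in> L2 \<nu>"
proof -
  interpret N: prob_space \<nu> by (rule prob_space_\<nu>)
  obtain C where C: "\<And>\<Lambda>. \<Lambda> \<in> X \<Longrightarrow> cmod (counting f \<Lambda>) \<le> C" using counting_schwartz_bounded[OF f] by blast
  show ?thesis
    by (rule L2_bound[OF counting_schwartz_measurable[OF f], of "\<lambda>_. C\<^sup>2"]) (auto intro!: power_mono C)
qed

lemma counting_add:
  "f \<in> schwartz \<Longrightarrow> g \<in> schwartz \<Longrightarrow> \<Lambda> \<in> X \<Longrightarrow> counting (\<lambda>x. f x + g x) \<Lambda> = counting f \<Lambda> + counting g \<Lambda>"
  unfolding counting_def by (intro Bochner_Integration.integral_add schwartz_integrable_configuration)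

lemma counting_cmult: "counting (\<lambda>x. c * f x) \<Lambda> = c * counting f \<Lambda>"
  unfolding counting_def by simp

lemma counting_shift:
  assumes "g \<in> schwartz" "\<Lambda> \<in> X"
  shows "counting (\<lambda>x. g (x - t)) \<Lambda> = T_rep t (counting g) \<Lambda>"
  unfolding T_rep_def using counting_translate[OF X_radon[OF assms(2)] schwartz_measurable[OF assms(1)], of "- t"] by simp

end

subsection \<open>The isometric embedding\<close>

locale diffraction = palm X \<mu> B + tempered \<sigma>
  for X :: "'a::euclidean_space measure set" and \<mu> :: "'a measure measure" and B :: "'a set" and \<sigma> :: "'a measure" +
  assumes transform: "\<And>f. f \<in> schwartz \<Longrightarrow> (\<integral>x. f x \<partial>\<sigma>) = (\<integral>x. fourier f x \<partial>m1)"
begin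

lemma correlation_fourier:
  assumes g: "g \<in> schwartz" and h: "h \<in> schwartz"
  shows "conv_measure (conv g (tilde h)) m1 (- t) = L2_inner \<sigma> (U_rep t (fourier g)) (fourier h)"
proof -
  have "(\<lambda>x. fourier g x * cis (- 2 * pi * (t \<bullet> x)) * cnj (fourier h x)) \<in> schwartz"
    by (intro schwartz_mult schwartz_mult_slow slow_cis schwartz_cnj fourier_schwartz g h)
  then have "(\<lambda>x. U_rep t (fourier g) x * cnj (fourier h x)) \<in> schwartz"
    unfolding U_rep_def by (simp add: mult_ac)
  from transform[OF this] show ?thesis
    unfolding L2_inner_def conv_measure_def fourier_mult_cnj[OF g h] ..
qed

lemma counting_inner:
  assumes g: "g \<in> schwartz" and h: "h \<in> schwartz"
  shows "L2_inner \<sigma> (U_rep t (fourier g)) (fourier h) = L2_inner \<nu> (T_rep t (counting g)) (counting h)"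
  using correlation_fourier[OF g h] counting_correlation[OF g h] by simp

lemma counting_isometry:
  assumes g: "g \<in> schwartz" shows "L2_norm \<nu> (counting g) = L2_norm \<sigma> (fourier g)"
proof -
  have "L2_inner \<nu> (T_rep 0 (counting g)) (counting g) = L2_inner \<nu> (counting g) (counting g)"
    unfolding L2_inner_def
    by (intro Bochner_Integration.integral_cong) (auto simp: T_rep_def translate_0[OF X_radon])
  moreover have "U_rep 0 (fourier g) = fourier g" by (simp add: U_rep_def fun_eq_iff)
  ultimately have "complex_of_real ((L2_norm \<sigma> (fourier g))\<^sup>2) = of_real ((L2_norm \<nu> (counting g))\<^sup>2)"
    using counting_inner[OF g g, of 0] by (simp only: L2_inner_self)
  then have "(L2_norm \<sigma> (fourier g))\<^sup>2 = (L2_norm \<nu> (counting g))\<^sup>2" by (simp only: of_real_eq_iff)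
  then show ?thesis using L2_norm_nonneg power2_eq_imp_eq by metis
qed

text \<open>The graph of the embedding: the closure of the pairs \<open>(fourier g, counting g)\<close>.\<close>

definition embeds :: "('a \<Rightarrow> complex) \<Rightarrow> ('a measure \<Rightarrow> complex) \<Rightarrow> bool" where
  "embeds f F \<longleftrightarrow> f \<in> L2 \<sigma> \<and> F \<in> L2 \<nu> \<and>
    (\<forall>e>0. \<exists>g\<in>schwartz. L2_norm \<sigma> (\<lambda>x. f x - fourier g x) < e \<and> L2_norm \<nu> (\<lambda>\<Lambda>. F \<Lambda> - counting g \<Lambda>) < e)"

lemma embedsE:
  assumes "embeds f F" "e > 0"
  obtains g where "g \<in> schwartz" "L2_norm \<sigma> (\<lambda>x. f x - fourier g x) < e" "L2_norm \<nu> (\<lambda>\<Lambda>. F \<Lambda> - counting g \<Lambda>) < e"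
  using assms unfolding embeds_def by blast

lemma embeds_schwartz: "g \<in> schwartz \<Longrightarrow> embeds (fourier g) (counting g)"
  unfolding embeds_def
  using schwartz_L2[OF fourier_schwartz] counting_L2 by (auto intro!: bexI[of _ g] simp: L2_norm_def)

text \<open>A common approximant has equal norms on both sides, so the two norms differ by at most
  an arbitrary \<open>e\<close>.\<close>

lemma embeds_norm:
  assumes R: "embeds f F" shows "L2_norm \<nu> F = L2_norm \<sigma> f"
proof -
  have L: "f \<in> L2 \<sigma>" "F \<in> L2 \<nu>" using R by (auto simp: embeds_def)
  have "\<bar>L2_norm \<nu> F - L2_norm \<sigma> f\<bar> \<le> e" if e: "e > 0" for e
  proof -
    obtain g where g: "g \<in> schwartz" "L2_norm \<sigma> (\<lambda>x. f x - fourier g x) < e / 2" "L2_norm \<nu> (\<lambda>\<Lambda>. F \<Lambda> - counting g \<Lambda>) < e / 2"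
      using embedsE[OF R, of "e / 2"] e by auto
    have Lg: "fourier g \<in> L2 \<sigma>" "counting g \<in> L2 \<nu>" using schwartz_L2[OF fourier_schwartz] counting_L2 g(1) by auto
    have "L2_norm \<sigma> f \<le> L2_norm \<sigma> (\<lambda>x. f x - fourier g x) + L2_norm \<sigma> (fourier g)"
      using L2_norm_triangle[OF L2_diff[OF L(1) Lg(1)] Lg(1)] by simp
    moreover have "L2_norm \<sigma> (fourier g) \<le> L2_norm \<sigma> (\<lambda>x. f x - fourier g x) + L2_norm \<sigma> f"
      using L2_norm_triangle[OF L2_diff[OF Lg(1) L(1)] L(1)] by (simp add: L2_norm_minus_commute[of \<sigma> f])
    moreover have "L2_norm \<nu> F \<le> L2_norm \<nu> (\<lambda>\<Lambda>. F \<Lambda> - counting g \<Lambda>) + L2_norm \<nu> (counting g)"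
      using L2_norm_triangle[OF L2_diff[OF L(2) Lg(2)] Lg(2)] by simp
    moreover have "L2_norm \<nu> (counting g) \<le> L2_norm \<nu> (\<lambda>\<Lambda>. F \<Lambda> - counting g \<Lambda>) + L2_norm \<nu> F"
      using L2_norm_triangle[OF L2_diff[OF Lg(2) L(2)] L(2)] by (simp add: L2_norm_minus_commute[of \<nu> F])
    ultimately show ?thesis using g(2,3) counting_isometry[OF g(1)] by linarith
  qed
  then have "\<bar>L2_norm \<nu> F - L2_norm \<sigma> f\<bar> \<le> 0" by (rule field_le_epsilon) simp
  then show ?thesis by simp
qed

lemma embeds_add:
  assumes "embeds f F" "embeds g G"
  shows "embeds (\<lambda>x. f x + g x) (\<lambda>\<Lambda>. F \<Lambda> + G \<Lambda>)"
proof -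
  have L: "f \<in> L2 \<sigma>" "F \<in> L2 \<nu>" "g \<in> L2 \<sigma>" "G \<in> L2 \<nu>" using assms by (auto simp: embeds_def)
  have "\<exists>h\<in>schwartz. L2_norm \<sigma> (\<lambda>x. f x + g x - fourier h x) < e \<and> L2_norm \<nu> (\<lambda>\<Lambda>. F \<Lambda> + G \<Lambda> - counting h \<Lambda>) < e"
    if e: "e > 0" for e
  proof -
    obtain u where u: "u \<in> schwartz" "L2_norm \<sigma> (\<lambda>x. f x - fourier u x) < e / 2" "L2_norm \<nu> (\<lambda>\<Lambda>. F \<Lambda> - counting u \<Lambda>) < e / 2"
      using embedsE[OF assms(1), of "e / 2"] e by auto
    obtain v where v: "v \<in> schwartz" "L2_norm \<sigma> (\<lambda>x. g x - fourier v x) < e / 2" "L2_norm \<nu> (\<lambda>\<Lambda>. G \<Lambda> - counting v \<Lambda>) < e / 2"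
      using embedsE[OF assms(2), of "e / 2"] e by auto
    have Lu: "fourier u \<in> L2 \<sigma>" "counting u \<in> L2 \<nu>" "fourier v \<in> L2 \<sigma>" "counting v \<in> L2 \<nu>"
      using schwartz_L2[OF fourier_schwartz] counting_L2 u(1) v(1) by auto
    have "L2_norm \<sigma> (\<lambda>x. f x + g x - fourier (\<lambda>x. u x + v x) x) = L2_norm \<sigma> (\<lambda>x. (f x - fourier u x) + (g x - fourier v x))"
      by (simp add: fourier_add[OF u(1) v(1)] algebra_simps)
    also have "\<dots> \<le> L2_norm \<sigma> (\<lambda>x. f x - fourier u x) + L2_norm \<sigma> (\<lambda>x. g x - fourier v x)"
      by (intro L2_norm_triangle L2_diff L Lu)
    finally have 1: "L2_norm \<sigma> (\<lambda>x. f x + g x - fourier (\<lambda>x. u x + v x) x) < e" using u(2) v(2) by linarith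
    have "L2_norm \<nu> (\<lambda>\<Lambda>. F \<Lambda> + G \<Lambda> - counting (\<lambda>x. u x + v x) \<Lambda>) = L2_norm \<nu> (\<lambda>\<Lambda>. (F \<Lambda> - counting u \<Lambda>) + (G \<Lambda> - counting v \<Lambda>))"
      by (intro L2_norm_cong) (simp add: counting_add[OF u(1) v(1)])
    also have "\<dots> \<le> L2_norm \<nu> (\<lambda>\<Lambda>. F \<Lambda> - counting u \<Lambda>) + L2_norm \<nu> (\<lambda>\<Lambda>. G \<Lambda> - counting v \<Lambda>)"
      by (intro L2_norm_triangle L2_diff L Lu)
    finally have "L2_norm \<nu> (\<lambda>\<Lambda>. F \<Lambda> + G \<Lambda> - counting (\<lambda>x. u x + v x) \<Lambda>) < e" using u(3) v(3) by linarith
    then show ?thesis using 1 schwartz_add[OF u(1) v(1)] by blast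
  qed
  then show ?thesis using L unfolding embeds_def by (auto intro: L2_add)
qed

lemma embeds_cmult:
  assumes R: "embeds f F" shows "embeds (\<lambda>x. c * f x) (\<lambda>\<Lambda>. c * F \<Lambda>)"
proof -
  have L: "f \<in> L2 \<sigma>" "F \<in> L2 \<nu>" using R by (auto simp: embeds_def)
  have p: "cmod c + 1 > 0" by (simp add: add_nonneg_pos)
  have "\<exists>h\<in>schwartz. L2_norm \<sigma> (\<lambda>x. c * f x - fourier h x) < e \<and> L2_norm \<nu> (\<lambda>\<Lambda>. c * F \<Lambda> - counting h \<Lambda>) < e"
    if e: "e > 0" for e
  proof -
    have "e / (cmod c + 1) > 0" using e p by simp
    then obtain u where u: "u \<in> schwartz" "L2_norm \<sigma> (\<lambda>x. f x - fourier u x) < e / (cmod c + 1)"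
      "L2_norm \<nu> (\<lambda>\<Lambda>. F \<Lambda> - counting u \<Lambda>) < e / (cmod c + 1)"
      using embedsE[OF R] by blast
    have lt: "cmod c * a < e" if "a < e / (cmod c + 1)" "a \<ge> 0" for a
    proof -
      have "cmod c * a \<le> (cmod c + 1) * a" using that by (intro mult_right_mono) auto
      also have "\<dots> < e" using that p by (simp add: field_simps)
      finally show ?thesis .
    qed
    have "L2_norm \<sigma> (\<lambda>x. c * f x - fourier (\<lambda>x. c * u x) x) < e"
      unfolding fourier_cmult right_diff_distrib[symmetric] L2_norm_cmult by (intro lt u L2_norm_nonneg)
    moreover have "L2_norm \<nu> (\<lambda>\<Lambda>. c * F \<Lambda> - counting (\<lambda>x. c * u x) \<Lambda>) < e"
      unfolding counting_cmult right_diff_distrib[symmetric] L2_norm_cmult by (intro lt u L2_norm_nonneg)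
    ultimately show ?thesis using schwartz_cmult[OF u(1)] by blast
  qed
  then show ?thesis using L unfolding embeds_def by (auto intro: L2_cmult)
qed

lemma embeds_intertwines:
  assumes R: "embeds f F" shows "embeds (U_rep t f) (T_rep t F)"
proof -
  have L: "f \<in> L2 \<sigma>" "F \<in> L2 \<nu>" using R by (auto simp: embeds_def)
  have "\<exists>h\<in>schwartz. L2_norm \<sigma> (\<lambda>x. U_rep t f x - fourier h x) < e \<and> L2_norm \<nu> (\<lambda>\<Lambda>. T_rep t F \<Lambda> - counting h \<Lambda>) < e"
    if e: "e > 0" for e
  proof -
    obtain u where u: "u \<in> schwartz" "L2_norm \<sigma> (\<lambda>x. f x - fourier u x) < e" "L2_norm \<nu> (\<lambda>\<Lambda>. F \<Lambda> - counting u \<Lambda>) < e"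
      using embedsE[OF R e] .
    have "(\<lambda>x. U_rep t f x - fourier (\<lambda>x. u (x - t)) x) = U_rep t (\<lambda>x. f x - fourier u x)"
      by (rule ext) (simp add: fourier_translate[OF u(1)] U_rep_def right_diff_distrib)
    then have "L2_norm \<sigma> (\<lambda>x. U_rep t f x - fourier (\<lambda>x. u (x - t)) x) < e"
      using u(2) by (simp only: U_rep_norm)
    moreover have "L2_norm \<nu> (\<lambda>\<Lambda>. T_rep t F \<Lambda> - counting (\<lambda>x. u (x - t)) \<Lambda>) = L2_norm \<nu> (T_rep t (\<lambda>\<Lambda>. F \<Lambda> - counting u \<Lambda>))"
      by (intro L2_norm_cong) (simp add: counting_shift[OF u(1)], simp add: T_rep_def)
    moreover have "\<dots> < e"
      using u(3) by (subst T_rep_L2(2)) (auto intro: L2_diff L counting_L2 u(1))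
    ultimately show ?thesis using schwartz_translate[OF u(1)] by (intro bexI[of _ "\<lambda>x. u (x - t)"]) auto
  qed
  then show ?thesis using L unfolding embeds_def by (auto intro: U_rep_L2[OF _ sets_\<sigma>] T_rep_L2)
qed

text \<open>Schwartz approximants of \<open>f\<close> are rewritten as transforms, the isometry
  makes their counting functions a Cauchy sequence, and its limit is a partner of
  \<open>f\<close>.\<close>

lemma embeds_total:
  assumes f: "f \<in> L2 \<sigma>" shows "\<exists>F. embeds f F"
proof -
  interpret N: prob_space \<nu> by (rule prob_space_\<nu>)
  \<comment> \<open>The extra factor \<open>1 / 2\<close> lets two such errors add up to the rate
    \<open>(1 / 2) ^ n\<close> that \<open>L2_complete\<close> demands.\<close>
  have "\<exists>g\<in>schwartz. L2_norm \<sigma> (\<lambda>x. f x - fourier g x) < (1 / 2) ^ n / 2" for n :: nat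
  proof -
    have "(0::real) < (1 / 2) ^ n / 2" by simp
    then obtain h where h: "h \<in> schwartz" "L2_norm \<sigma> (\<lambda>x. f x - h x) < (1 / 2) ^ n / 2"
      using L2_approximable[OF f] unfolding approximable_def by blast
    have "(\<lambda>x. fourier h (- x)) \<in> schwartz" by (intro schwartz_reflect fourier_schwartz h)
    then show ?thesis using h(2) fourier_surj[OF h(1)] by (intro bexI[of _ "\<lambda>x. fourier h (- x)"]) simp_all
  qed
  then obtain g where g: "\<And>n. g n \<in> schwartz" "\<And>n. L2_norm \<sigma> (\<lambda>x. f x - fourier (g n) x) < (1 / 2) ^ n / 2"
    by metis
  have Lg: "fourier (g n) \<in> L2 \<sigma>" "counting (g n) \<in> L2 \<nu>" for n
    using schwartz_L2[OF fourier_schwartz] counting_L2 g(1) by auto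
  have "L2_norm \<nu> (\<lambda>\<Lambda>. counting (g m) \<Lambda> - counting (g n) \<Lambda>) \<le> (1 / 2) ^ n" if nm: "n \<le> m" for m n
  proof -
    let ?d = "\<lambda>x. g m x + (- 1) * g n x"
    have d: "?d \<in> schwartz" by (intro schwartz_add schwartz_cmult g)
    have "L2_norm \<nu> (\<lambda>\<Lambda>. counting (g m) \<Lambda> - counting (g n) \<Lambda>) = L2_norm \<nu> (counting ?d)"
    proof (rule L2_norm_cong)
      fix \<Lambda> assume "\<Lambda> \<in> space \<nu>"
      then have "counting ?d \<Lambda> = counting (g m) \<Lambda> + counting (\<lambda>x. (- 1) * g n x) \<Lambda>"
        by (intro counting_add schwartz_cmult g) simp
      then show "counting (g m) \<Lambda> - counting (g n) \<Lambda> = counting ?d \<Lambda>" unfolding counting_cmult by simp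
    qed
    also have "\<dots> = L2_norm \<sigma> (fourier ?d)" by (rule counting_isometry[OF d])
    also have "\<dots> = L2_norm \<sigma> (\<lambda>x. fourier (g m) x - fourier (g n) x)"
      by (simp only: fourier_add[OF g(1) schwartz_cmult[OF g(1)]] fourier_cmult) simp
    also have "\<dots> \<le> L2_norm \<sigma> (\<lambda>x. fourier (g m) x - f x) + L2_norm \<sigma> (\<lambda>x. f x - fourier (g n) x)"
      by (intro L2_norm_triangle_diff Lg f)
    also have "\<dots> \<le> (1 / 2) ^ m / 2 + (1 / 2) ^ n / 2"
      using g(2)[of m] g(2)[of n] L2_norm_minus_commute[of \<sigma> f "fourier (g m)"] by linarith
    also have "\<dots> \<le> (1 / 2) ^ n"
    proof -
      have "(1 / 2 :: real) ^ m \<le> (1 / 2) ^ n" using nm by (intro power_decreasing) auto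
      then show ?thesis by linarith
    qed
    finally show ?thesis .
  qed
  then obtain F where F: "F \<in> L2 \<nu>" "\<And>n. L2_norm \<nu> (\<lambda>\<Lambda>. F \<Lambda> - counting (g n) \<Lambda>) \<le> (1 / 2) ^ n"
    using N.L2_complete[of "\<lambda>n. counting (g n)"] Lg(2) by blast
  have "\<exists>h\<in>schwartz. L2_norm \<sigma> (\<lambda>x. f x - fourier h x) < e \<and> L2_norm \<nu> (\<lambda>\<Lambda>. F \<Lambda> - counting h \<Lambda>) < e" if e: "e > 0" for e
  proof -
    obtain n where n: "(1 / 2) ^ n < e" using real_arch_pow_inv[OF e, of "1 / 2"] by auto
    have "L2_norm \<sigma> (\<lambda>x. f x - fourier (g n) x) < e"
    proof -
      have "(0::real) \<le> (1 / 2) ^ n" by simp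
      then show ?thesis using g(2)[of n] n by linarith
    qed
    moreover have "L2_norm \<nu> (\<lambda>\<Lambda>. F \<Lambda> - counting (g n) \<Lambda>) < e" using F(2)[of n] n by linarith
    ultimately show ?thesis using g(1) by blast
  qed
  then have "embeds f F" using f F(1) by (simp add: embeds_def)
  then show ?thesis by blast
qed

text \<open>By linearity the differences \<open>f - g\<close> and \<open>F - G\<close> are again
  related, and related functions have equal norms; the first norm is 0.\<close>

lemma embeds_unique:
  assumes "embeds f F" "embeds g G" "AE x in \<sigma>. f x = g x"
  shows "L2_eq \<nu> F G"
proof -
  have L: "f \<in> L2 \<sigma>" "F \<in> L2 \<nu>" "g \<in> L2 \<sigma>" "G \<in> L2 \<nu>" using assms by (auto simp: embeds_def)
  have "embeds (\<lambda>x. f x + (- 1) * g x) (\<lambda>\<Lambda>. F \<Lambda> + (- 1) * G \<Lambda>)"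
    by (intro embeds_add embeds_cmult assms)
  then have "L2_norm \<nu> (\<lambda>\<Lambda>. F \<Lambda> - G \<Lambda>) = L2_norm \<sigma> (\<lambda>x. f x - g x)"
    using embeds_norm by fastforce
  also have "\<dots> = L2_norm \<sigma> (\<lambda>x. 0)"
    using assms(3) by (intro L2_norm_cong_AE L2_diff L) (auto simp: L2_def)
  also have "\<dots> = 0" by (simp add: L2_norm_def)
  finally have "AE \<Lambda> in \<nu>. F \<Lambda> - G \<Lambda> = 0" by (intro L2_norm_eq_0 L2_diff L)
  then show ?thesis using L by (simp add: L2_eq_def)
qed

text \<open>The partner of each \<open>f\<close> is an arbitrary choice. Additivity, homogeneity,
  intertwining and the values on transforms hold because both sides are partners of one and the same
  function, which fixes them up to \<open>L2_eq\<close>.\<close>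

theorem isometric_embedding:
  "\<exists>\<theta>. L2_isometric_embedding \<sigma> \<nu> \<theta>
     \<and> (\<forall>t. \<forall>f\<in>L2 \<sigma>. U_rep t f \<in> L2 \<sigma> \<and> L2_eq \<nu> (\<theta> (U_rep t f)) (T_rep t (\<theta> f)))
     \<and> (\<forall>f\<in>schwartz. fourier f \<in> L2 \<sigma> \<and> L2_eq \<nu> (\<theta> (fourier f)) (counting f))"
proof -
  define \<theta> where "\<theta> f = (SOME F. embeds f F)" for f
  have \<theta>: "embeds f (\<theta> f)" if "f \<in> L2 \<sigma>" for f
    unfolding \<theta>_def by (rule someI_ex[OF embeds_total[OF that]])
  have \<theta>_eq: "L2_eq \<nu> (\<theta> f) F" if "embeds f F" for f F
    using embeds_unique[OF \<theta> that] that by (auto simp: embeds_def)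
  show ?thesis
  proof (intro exI[of _ \<theta>] conjI ballI allI)
    show "L2_isometric_embedding \<sigma> \<nu> \<theta>"
      unfolding L2_isometric_embedding_def
    proof (intro conjI ballI allI impI)
      show "\<theta> f \<in> L2 \<nu>" if "f \<in> L2 \<sigma>" for f using \<theta>[OF that] by (simp add: embeds_def)
      show "L2_eq \<nu> (\<theta> f) (\<theta> g)" if "L2_eq \<sigma> f g" for f g
        using that embeds_unique[OF \<theta> \<theta>] by (auto simp: L2_eq_def[of \<sigma>])
      show "L2_eq \<nu> (\<theta> (\<lambda>x. f x + g x)) (\<lambda>y. \<theta> f y + \<theta> g y)" if "f \<in> L2 \<sigma>" "g \<in> L2 \<sigma>" for f g
        by (intro \<theta>_eq embeds_add \<theta> that)
      show "L2_eq \<nu> (\<theta> (\<lambda>x. c * f x)) (\<lambda>y. c * \<theta> f y)" if "f \<in> L2 \<sigma>" for c f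
        by (intro \<theta>_eq embeds_cmult \<theta> that)
      show "L2_norm \<nu> (\<theta> f) = L2_norm \<sigma> f" if "f \<in> L2 \<sigma>" for f
        by (intro embeds_norm \<theta> that)
    qed
    show "U_rep t f \<in> L2 \<sigma>" if "f \<in> L2 \<sigma>" for t f by (intro U_rep_L2 that sets_\<sigma>)
    show "L2_eq \<nu> (\<theta> (U_rep t f)) (T_rep t (\<theta> f))" if "f \<in> L2 \<sigma>" for t f
      by (intro \<theta>_eq embeds_intertwines \<theta> that)
    show "fourier f \<in> L2 \<sigma>" if "f \<in> schwartz" for f by (intro schwartz_L2 fourier_schwartz that)
    show "L2_eq \<nu> (\<theta> (fourier f)) (counting f)" if "f \<in> schwartz" for f
      by (intro \<theta>_eq embeds_schwartz that)
  qed
qed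

end

theorem proposition9:
  fixes X :: "'a::euclidean_space measure set" and \<mu> :: "'a measure measure"
    and B :: "'a set" and \<mu>\<^sub>1 \<sigma> :: "'a measure"
  assumes process: "ud_ergodic_process X \<mu>"
    and B: "B \<in> sets borel" "bounded B" "emeasure lborel B > 0"
    and moment: "\<mu>\<^sub>1 = first_moment (palm_measure B X \<mu>)"
    and transform: "is_fourier_transform \<mu>\<^sub>1 \<sigma>"
  shows "(\<forall>g\<in>schwartz. \<forall>h\<in>schwartz. \<forall>t.
            conv_measure (conv g (tilde h)) \<mu>\<^sub>1 (- t)
              = L2_inner \<sigma> (U_rep t (fourier g)) (fourier h))
       \<and> (\<forall>g\<in>schwartz. \<forall>h\<in>schwartz. \<forall>t.
            L2_inner \<sigma> (U_rep t (fourier g)) (fourier h)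
              = L2_inner (restrict_space \<mu> X) (T_rep t (counting g)) (counting h))
       \<and> (\<exists>\<theta>. L2_isometric_embedding \<sigma> (restrict_space \<mu> X) \<theta>
            \<and> (\<forall>t. \<forall>f\<in>L2 \<sigma>. U_rep t f \<in> L2 \<sigma> \<and>
                 L2_eq (restrict_space \<mu> X) (\<theta> (U_rep t f)) (T_rep t (\<theta> f)))
            \<and> (\<forall>f\<in>schwartz. fourier f \<in> L2 \<sigma> \<and>
                 L2_eq (restrict_space \<mu> X) (\<theta> (fourier f)) (counting f)))"
proof -
  interpret palm X \<mu> B
    using process B by (intro palm.intro palm_axioms.intro)
  have m1: "\<mu>\<^sub>1 = m1" using moment first_moment_P by (simp add: P_def)
  interpret diffraction X \<mu> B \<sigma>
  proof
    show "radon \<sigma>" using transform by (simp add: is_fourier_transform_def)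
    \<comment> \<open>Translation boundedness of \<open>\<sigma>\<close> enters here, in the form of
      a finite integral of the weight.\<close>
    then show "(\<integral>\<^sup>+x. weight x \<partial>\<sigma>) < \<infinity>"
      using transform by (intro translation_bounded_weight) (simp_all add: is_fourier_transform_def)
    show "(\<integral>x. f x \<partial>\<sigma>) = (\<integral>x. fourier f x \<partial>m1)" if "f \<in> schwartz" for f
      using transform that by (simp add: is_fourier_transform_def m1)
  qed
  show ?thesis
    unfolding m1 using correlation_fourier counting_inner isometric_embedding by blast
qed

end
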